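(* Every $n$-dimensional complex filiform Leibniz algebra of length $n-1$ is isomorphic to one of the following algebras, which are pairwise non-isomorphic (in each case $\{y_1,\dots,y_n\}$ is a basis and all omitted products of basis elements are zero): (1) $NGF_2$: $[y_1,y_1]=y_3$, and $[y_i,y_1]=y_{i+1}$ for $3\le i\le n-1$. (2) $NGF_3(\alpha=1)$ (for even $n$): $[y_i,y_1]=-[y_1,y_i]=y_{i+1}$ for $2\le i\le n-1$, and $[y_i,y_{n+1-i}]=-[y_{n+1-i},y_i]=(-1)^{i+1}y_n$ for $2\le i\le n-1$. (3) $M_1(k)$, $3\le k\le n-1$: $[y_i,y_1]=y_{i+1}$ for $1\le i\le n-2$, and $[y_i,y_n]=y_{k+i-1}$ for $1\le i\le n-k$. (4) $M_2$ (for odd $n$), with parameter $\alpha\in\mathbb{C}$, $\alpha\ne 0$: $[y_i,y_1]=y_{i+1}$ for $1\le i\le n-2$, $[y_i,y_n]=y_{\frac{n+1}{2}+i-1}$ for $1\le i\le \frac{n-1}{2}$, and $[y_n,y_n]=\alpha y_{n-1}$. (5) $M_3$ (for odd $n$): $[y_i,y_1]=y_{i+1}$ for $1\le i\le n-2$, and $[y_n,y_n]=y_{n-1}$. (6) $M_4$: $[y_1,y_1]=y_n$, $[y_i,y_1]=y_{i+1}$ for $2\le i\le n-1$, and $[y_1,y_i]=-y_{i+1}$ for $2\le i\le n-1$.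
   Context: A (right) Leibniz algebra over a field is a vector space $L$ with a bilinear product $[\cdot,\cdot]$ satisfying $[x,[y,z]]=[[x,y],z]-[[x,z],y]$ for all $x,y,z$. The lower central series is $L^1=L$, $L^{k+1}=[L^k,L]$. An $n$-dimensional Leibniz algebra $L$ is filiform if $\dim L^i=n-i$ for $2\le i\le n$. A $\mathbb{Z}$-gradation of $L$ is a decomposition $L=\bigoplus_{i\in\mathbb{Z}}V_i$ with $[V_i,V_j]\subseteq V_{i+j}$. It is connected if there are integers $k_1\le k_t$ such that $V_i\neq 0$ exactly for $k_1\le i\le k_t$; its length is then $k_t-k_1+1$, the number of non-zero subspaces. The length $l(L)$ of a Leibniz algebra $L$ is the maximum of the lengths of all connected gradations of $L$. "Of length $n-1$" means $l(L)=n-1$.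
   Formalization: Pairwise non-isomorphism is stated only for n ≥ 4: for n = 3 the algebras M_4 and M_2 with α = 1/4 are isomorphic, and for n ≤ 2 the listed products are not well defined; the classification itself is stated for all n. *)

theory Defs
  imports Complex_Main "HOL-Library.Function_Algebras"
begin

(* The addition of an algebra is that of the ambient type; the underlying vector space is a
   subspace of it (possibly UNIV), and bracket is relevant on that subspace only. *)
record ('k, 'a) alg =
  alg_carrier :: "'a set"
  alg_scale :: "'k \<Rightarrow> 'a \<Rightarrow> 'a"
  bracket :: "'a \<Rightarrow> 'a \<Rightarrow> 'a"

locale leibniz_algebra = vector_space "alg_scale L"
  for L :: "('k::field, 'a::ab_group_add) alg" +
  assumes subspace_carrier: "subspace (alg_carrier L)"
    and bracket_closed:
      "\<lbrakk>x \<in> alg_carrier L; y \<in> alg_carrier L\<rbrakk> \<Longrightarrow> bracket L x y \<in> alg_carrier L"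
    and bracket_add_left:
      "\<lbrakk>x \<in> alg_carrier L; y \<in> alg_carrier L; z \<in> alg_carrier L\<rbrakk>
        \<Longrightarrow> bracket L (x + y) z = bracket L x z + bracket L y z"
    and bracket_add_right:
      "\<lbrakk>x \<in> alg_carrier L; y \<in> alg_carrier L; z \<in> alg_carrier L\<rbrakk>
        \<Longrightarrow> bracket L x (y + z) = bracket L x y + bracket L x z"
    and bracket_scale_left:
      "\<lbrakk>x \<in> alg_carrier L; y \<in> alg_carrier L\<rbrakk>
        \<Longrightarrow> bracket L (alg_scale L a x) y = alg_scale L a (bracket L x y)"
    and bracket_scale_right:
      "\<lbrakk>x \<in> alg_carrier L; y \<in> alg_carrier L\<rbrakk>
        \<Longrightarrow> bracket L x (alg_scale L a y) = alg_scale L a (bracket L x y)"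
    and leibniz_identity:
      "\<lbrakk>x \<in> alg_carrier L; y \<in> alg_carrier L; z \<in> alg_carrier L\<rbrakk>
        \<Longrightarrow> bracket L x (bracket L y z)
          = bracket L (bracket L x y) z - bracket L (bracket L x z) y"

(* Unlike an equation for vector_space.dim, which is 0 on infinite-dimensional spaces,
   this includes finite-dimensionality. *)
definition has_dimension :: "('k::field, 'a::ab_group_add) alg \<Rightarrow> nat \<Rightarrow> bool" where
  "has_dimension L n \<longleftrightarrow>
    (\<exists>B. finite B \<and> card B = n \<and> \<not> module.dependent (alg_scale L) B
       \<and> module.span (alg_scale L) B = alg_carrier L)"

(* The series is indexed from 1, as in the literature; the value at 0 is not used. *)
primrec lower_central :: "('k::field, 'a::ab_group_add) alg \<Rightarrow> nat \<Rightarrow> 'a set" where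
  "lower_central L 0 = alg_carrier L"
| "lower_central L (Suc k) =
    (if k = 0 then alg_carrier L
     else module.span (alg_scale L)
            {bracket L x y | x y. x \<in> lower_central L k \<and> y \<in> alg_carrier L})"

definition filiform :: "('k::field, 'a::ab_group_add) alg \<Rightarrow> nat \<Rightarrow> bool" where
  "filiform L n \<longleftrightarrow> leibniz_algebra L \<and> has_dimension L n \<and>
    (\<forall>i. 2 \<le> i \<and> i \<le> n \<longrightarrow> vector_space.dim (alg_scale L) (lower_central L i) = n - i)"

definition gradation :: "('k::field, 'a::ab_group_add) alg \<Rightarrow> (int \<Rightarrow> 'a set) \<Rightarrow> bool" where
  "gradation L V \<longleftrightarrow>
    (\<forall>i. module.subspace (alg_scale L) (V i) \<and> V i \<subseteq> alg_carrier L) \<and>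
    (\<forall>x\<in>alg_carrier L. \<exists>!f. (\<forall>i. f i \<in> V i) \<and> finite {i. f i \<noteq> 0} \<and> x = (\<Sum>i | f i \<noteq> 0. f i)) \<and>
    (\<forall>i j. \<forall>x\<in>V i. \<forall>y\<in>V j. bracket L x y \<in> V (i + j))"

definition connected_between :: "(int \<Rightarrow> 'a::zero set) \<Rightarrow> int \<Rightarrow> int \<Rightarrow> bool" where
  "connected_between V k l \<longleftrightarrow> k \<le> l \<and> (\<forall>i. V i \<noteq> {0} \<longleftrightarrow> k \<le> i \<and> i \<le> l)"

definition alg_length :: "('k::field, 'a::ab_group_add) alg \<Rightarrow> int" where
  "alg_length L = Max {l - k + 1 | V k l. gradation L V \<and> connected_between V k l}"

definition alg_isomorphic ::
    "('k::field, 'a::ab_group_add) alg \<Rightarrow> ('k, 'b::ab_group_add) alg \<Rightarrow> bool" where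
  "alg_isomorphic L M \<longleftrightarrow>
    (\<exists>f. bij_betw f (alg_carrier L) (alg_carrier M) \<and>
      (\<forall>x\<in>alg_carrier L. \<forall>y\<in>alg_carrier L. f (x + y) = f x + f y) \<and>
      (\<forall>a. \<forall>x\<in>alg_carrier L. f (alg_scale L a x) = alg_scale M a (f x)) \<and>
      (\<forall>x\<in>alg_carrier L. \<forall>y\<in>alg_carrier L. f (bracket L x y) = bracket M (f x) (f y)))"

(* The n-dimensional space with basis y_1, ..., y_n is realised by the functions
   nat \<Rightarrow> complex vanishing outside {1..n}; basis_vec i is y_i. *)

definition fun_scale :: "complex \<Rightarrow> (nat \<Rightarrow> complex) \<Rightarrow> nat \<Rightarrow> complex" where
  "fun_scale a x = (\<lambda>k. a * x k)"

definition basis_vec :: "nat \<Rightarrow> nat \<Rightarrow> complex" where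
  "basis_vec i = (\<lambda>k. if k = i then 1 else 0)"

(* p i j is the product [y_i, y_j]. *)
definition table_alg :: "nat \<Rightarrow> (nat \<Rightarrow> nat \<Rightarrow> nat \<Rightarrow> complex) \<Rightarrow> (complex, nat \<Rightarrow> complex) alg" where
  "table_alg n p =
    \<lparr>alg_carrier = {x. \<forall>i. i \<notin> {1..n} \<longrightarrow> x i = 0},
     alg_scale = fun_scale,
     bracket = (\<lambda>x y. \<Sum>i=1..n. \<Sum>j=1..n. fun_scale (x i * y j) (p i j))\<rparr>"

datatype family = NGF2 | NGF3 | M1 nat | M2 complex | M3 | M4

(* NGF3 is used for even n only. Its clause for i + j = n + 1 gives both [y_i, y_j] and
   [y_j, y_i]: these are opposite since (-1)^(j+1) = -(-1)^(i+1) for even n. *)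
fun family_table :: "nat \<Rightarrow> family \<Rightarrow> nat \<Rightarrow> nat \<Rightarrow> nat \<Rightarrow> complex" where
  "family_table n NGF2 i j =
    (if i = 1 \<and> j = 1 then basis_vec 3
     else if 3 \<le> i \<and> i \<le> n - 1 \<and> j = 1 then basis_vec (i + 1)
     else 0)"
| "family_table n NGF3 i j =
    (if 2 \<le> i \<and> i \<le> n - 1 \<and> j = 1 then basis_vec (i + 1)
     else if i = 1 \<and> 2 \<le> j \<and> j \<le> n - 1 then - basis_vec (j + 1)
     else if 2 \<le> i \<and> i \<le> n - 1 \<and> i + j = n + 1 then fun_scale ((-1) ^ (i + 1)) (basis_vec n)
     else 0)"
| "family_table n (M1 k) i j =
    (if 1 \<le> i \<and> i \<le> n - 2 \<and> j = 1 then basis_vec (i + 1)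
     else if 1 \<le> i \<and> i \<le> n - k \<and> j = n then basis_vec (k + i - 1)
     else 0)"
| "family_table n (M2 \<alpha>) i j =
    (if 1 \<le> i \<and> i \<le> n - 2 \<and> j = 1 then basis_vec (i + 1)
     else if 1 \<le> i \<and> i \<le> (n - 1) div 2 \<and> j = n then basis_vec ((n + 1) div 2 + i - 1)
     else if i = n \<and> j = n then fun_scale \<alpha> (basis_vec (n - 1))
     else 0)"
| "family_table n M3 i j =
    (if 1 \<le> i \<and> i \<le> n - 2 \<and> j = 1 then basis_vec (i + 1)
     else if i = n \<and> j = n then basis_vec (n - 1)
     else 0)"
| "family_table n M4 i j =
    (if i = 1 \<and> j = 1 then basis_vec n
     else if 2 \<le> i \<and> i \<le> n - 1 \<and> j = 1 then basis_vec (i + 1)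
     else if i = 1 \<and> 2 \<le> j \<and> j \<le> n - 1 then - basis_vec (j + 1)
     else 0)"

definition listed :: "nat \<Rightarrow> family set" where
  "listed n = {NGF2, M4} \<union> {M1 k | k. 3 \<le> k \<and> k \<le> n - 1} \<union>
    (if even n then {NGF3} else insert M3 {M2 \<alpha> | \<alpha>. \<alpha> \<noteq> 0})"

definition family_alg :: "nat \<Rightarrow> family \<Rightarrow> (complex, nat \<Rightarrow> complex) alg" where
  "family_alg n F = table_alg n (family_table n F)"

end

theory Submission
  imports Defs
begin

text \<open>
  Let \<open>L\<close> have dimension \<open>N + 1\<close> with \<open>N \<ge> 3\<close>, and take a connected gradation of length \<open>N\<close>. The lower
  central series is spanned by homogeneous elements, so \<open>L\<close> has a homogeneous basis
  \<open>x, y = z\<^sub>1, z\<^sub>2, \<dots>, z\<^sub>N\<close> with \<open>x, y\<close> generating \<open>L\<close> modulo \<open>L\<^sup>2\<close> and \<open>z\<^sub>j\<close> spanning \<open>L\<^sup>j\<close> modulo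
  \<open>L\<^sup>j\<^sup>+\<^sup>1\<close>; moreover \<open>y\<close> can be chosen with \<open>[L\<^sup>2, y] \<subseteq> L\<^sup>4\<close>. The Leibniz identity in the associated
  graded algebra of the lower central series determines how each \<open>z\<^sub>j\<close> arises from \<open>x\<close> and \<open>y\<close>: either
  always by right multiplication with \<open>x\<close>, or, in the Lie case with \<open>N\<close> odd, with a single exception in
  the last step. Hence the degrees of the \<open>z\<^sub>j\<close> form an arithmetic progression, and since exactly one
  degree is repeated in an interval of \<open>N\<close> degrees, its step is \<open>1\<close> (after replacing \<open>V\<^sub>i\<close> by \<open>V\<^sub>-\<^sub>i\<close>)
  and the remaining degree is confined to a short range. A product is then located by its degree and
  its position in the lower central series, which leaves only the listed algebras and algebras that
  have a gradation of length \<open>N + 1\<close>.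

  The families are told apart by antisymmetry, by \<open>[L, L\<^sup>2] = 0\<close>, and by whether \<open>[[y, y], y] = 0\<close> forces
  \<open>[L, y] = 0\<close>; within \<open>M\<^sub>1, M\<^sub>2, M\<^sub>3\<close> an isomorphism is triangular, and comparing leading coefficients
  recovers the parameters.
\<close>

section \<open>Lower central series and bases\<close>

text \<open>The length hypothesis acts in both directions: it supplies one gradation of length
  \<open>N\<close>, and it forbids any of length \<open>N + 1\<close>. The second half removes every
  algebra with a basis in which \<open>[e_i, e_j]\<close> is a multiple of \<open>e_(i+j)\<close>
  (\<open>alg_length_frame\<close>). The obstacle is that the generators have to stay homogeneous
  while the structure is still being determined: replacing \<open>x\<close> by
  \<open>x - t y\<close> with \<open>t\<close> nonzero is legitimate only if both have the same
  degree. \<open>homogeneous_congruent\<close> resolves this: a correction forced by a congruence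
  modulo a graded term of the lower central series is automatically homogeneous. The parameter
  \<open>k\<close> of \<open>M1\<close> is one more than the degree of \<open>y\<close>. A nonzero
  square of the corrected \<open>y\<close> can only occur at twice that degree, and only at the end
  of the string, so \<open>M2\<close> and \<open>M3\<close> require \<open>N = n - 1\<close> to be
  even. Dimension 4 is the threshold because the choice of \<open>y\<close> uses a nonzero quotient
  of \<open>LC 3\<close> by \<open>LC 4\<close>. In dimension 3 the product is a bilinear form on a
  plane and is normalised through an isotropic vector.\<close>

context vector_space
begin

text \<open>The ambient type need not be finite-dimensional, so a finite \<open>B\<close> whose span
  contains \<open>W\<close> supplies the exchange bound: an element of \<open>W\<close> outside
  \<open>span S\<close> would give an independent set larger than a basis of
  \<open>W\<close>.\<close>

lemma spans_of_card_eq_dim: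
  assumes "finite B" "W \<subseteq> span B" "S \<subseteq> W" "independent S" "card S = dim W"
  shows "W \<subseteq> span S"
proof
  fix v assume v: "v \<in> W"
  have fS: "finite S"
    using independent_span_bound[OF assms(1,4)] assms(2,3) by blast
  obtain T where T: "T \<subseteq> W" "independent T" "W \<subseteq> span T" "card T = dim W"
    using basis_exists by blast
  have fT: "finite T"
    using independent_span_bound[OF assms(1) T(2)] assms(2) T(1) by blast
  show "v \<in> span S"
  proof (rule ccontr)
    assume n: "v \<notin> span S"
    then have "independent (insert v S)" "v \<notin> S"
      using assms(4) independent_insertI span_base by blast+
    moreover have "insert v S \<subseteq> span T"
      using v assms(3) T(3) by blast
    ultimately have "card (insert v S) \<le> card T"
      using independent_span_bound[OF fT] by blast
    then show False
      using fS \<open>v \<notin> S\<close> T(4) assms(5) by simp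
  qed
qed

lemma span_insert_codim_1:
  assumes B: "finite B" "W \<subseteq> span B" and UW: "U \<subseteq> W" "w \<in> W" "w \<notin> U"
    and sub: "subspace U" "subspace W" and d: "dim W = dim U + 1"
  shows "W = span (insert w U)"
proof -
  obtain T where T: "T \<subseteq> U" "independent T" "U \<subseteq> span T" "card T = dim U"
    using basis_exists by blast
  have fT: "finite T"
    using independent_span_bound[OF B(1) T(2)] B(2) T(1) UW(1) by blast
  have sT: "span T = U"
    using T sub(1) by (simp add: span_subspace)
  have w: "w \<notin> span T" "w \<notin> T"
    using UW(3) sT T(1) by auto
  have "W \<subseteq> span (insert w T)"
  proof (rule spans_of_card_eq_dim[OF B])
    show "insert w T \<subseteq> W" using UW T(1) by blast
    show "independent (insert w T)" using w T(2) by (simp add: independent_insert)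
    show "card (insert w T) = dim W" using w fT T(4) d by simp
  qed
  also have "\<dots> \<subseteq> span (insert w U)" by (rule span_mono) (use T(1) in blast)
  finally show ?thesis
    using UW sub(2) span_minimal[of "insert w U" W] by blast
qed

end

context leibniz_algebra
begin

abbreviation scale_op (infixr "*s" 75) where "scale_op \<equiv> alg_scale L"
abbreviation bracket_op (infixl "\<star>" 70) where "x \<star> y \<equiv> bracket L x y"
abbreviation "C \<equiv> alg_carrier L"
abbreviation "LC \<equiv> lower_central L"

lemma zero_closed [simp]: "0 \<in> C"
  and add_closed [simp]: "x \<in> C \<Longrightarrow> y \<in> C \<Longrightarrow> x + y \<in> C"
  and diff_closed [simp]: "x \<in> C \<Longrightarrow> y \<in> C \<Longrightarrow> x - y \<in> C"
  and minus_closed [simp]: "x \<in> C \<Longrightarrow> - x \<in> C"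
  and scale_closed [simp]: "x \<in> C \<Longrightarrow> a *s x \<in> C"
  using subspace_carrier
  by (auto simp: subspace_0 subspace_add subspace_diff subspace_neg subspace_scale)

declare bracket_closed [simp]

lemma span_closed: "S \<subseteq> C \<Longrightarrow> span S \<subseteq> C"
  using span_minimal subspace_carrier by blast

lemma bracket_zero_left [simp]: "y \<in> C \<Longrightarrow> 0 \<star> y = 0"
  using bracket_add_left[of 0 0 y] by simp

lemma bracket_zero_right [simp]: "y \<in> C \<Longrightarrow> y \<star> 0 = 0"
  using bracket_add_right[of y 0 0] by simp

lemma bracket_minus_left: "x \<in> C \<Longrightarrow> y \<in> C \<Longrightarrow> (- x) \<star> y = - (x \<star> y)"
  using bracket_add_left[of x "- x" y] by (simp add: eq_neg_iff_add_eq_0 add.commute)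

lemma bracket_minus_right: "x \<in> C \<Longrightarrow> y \<in> C \<Longrightarrow> x \<star> (- y) = - (x \<star> y)"
  using bracket_add_right[of x y "- y"] by (simp add: eq_neg_iff_add_eq_0 add.commute)

lemma bracket_diff_left:
  "x \<in> C \<Longrightarrow> y \<in> C \<Longrightarrow> z \<in> C \<Longrightarrow> (x - y) \<star> z = x \<star> z - y \<star> z"
  using bracket_add_left[of x "- y" z] by (simp add: bracket_minus_left)

lemma bracket_diff_right:
  "x \<in> C \<Longrightarrow> y \<in> C \<Longrightarrow> z \<in> C \<Longrightarrow> z \<star> (x - y) = z \<star> x - z \<star> y"
  using bracket_add_right[of z x "- y"] by (simp add: bracket_minus_right)

lemmas bracket_simps = bracket_add_left bracket_add_right bracket_diff_left bracket_diff_right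
  bracket_minus_left bracket_minus_right bracket_scale_left bracket_scale_right

lemma sum_closed: "(\<And>i. i \<in> I \<Longrightarrow> f i \<in> C) \<Longrightarrow> sum f I \<in> C"
  using subspace_carrier subspace_sum by blast

lemma bracket_sum_left:
  assumes "\<And>i. i \<in> I \<Longrightarrow> f i \<in> C" "y \<in> C"
  shows "sum f I \<star> y = (\<Sum>i\<in>I. f i \<star> y)"
  using assms by (induction I rule: infinite_finite_induct) (auto simp: bracket_add_left sum_closed)

lemma bracket_sum_right:
  assumes "\<And>i. i \<in> I \<Longrightarrow> f i \<in> C" "y \<in> C"
  shows "y \<star> sum f I = (\<Sum>i\<in>I. y \<star> f i)"
  using assms by (induction I rule: infinite_finite_induct) (auto simp: bracket_add_right sum_closed)

text \<open>Bilinearity, packaged so that later containments only need products of spanning vectors.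
  The bracket is bilinear on \<open>C\<close> only, hence the inclusions of \<open>S\<close> and
  \<open>T\<close>, and both inductions carry membership in \<open>C\<close> along.\<close>

lemma bracket_span:
  assumes x: "x \<in> span S" and y: "y \<in> span T" and "S \<subseteq> C" "T \<subseteq> C" "subspace U"
    and st: "\<And>s t. s \<in> S \<Longrightarrow> t \<in> T \<Longrightarrow> s \<star> t \<in> U"
  shows "x \<star> y \<in> U"
proof -
  have sT: "span T \<subseteq> C" and sS: "span S \<subseteq> C" using assms span_closed by auto
  have 1: "s \<star> y \<in> U" if s: "s \<in> S" for s
  proof -
    have "y \<in> C \<and> s \<star> y \<in> U"
      using y
    proof (induction rule: span_induct_alt)
      case base
      show ?case using assms s by (auto simp: subspace_0)
    next
      case (step c t y)
      have *: "s \<star> (c *s t + y) = c *s (s \<star> t) + s \<star> y"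
        using subsetD[OF \<open>S \<subseteq> C\<close> s] subsetD[OF \<open>T \<subseteq> C\<close> step(1)] step(2)
        by (simp add: bracket_add_right bracket_scale_right)
      show ?case
        unfolding * using assms s step by (auto simp: subspace_add subspace_scale)
    qed
    then show ?thesis ..
  qed
  have "x \<in> C \<and> x \<star> y \<in> U"
    using x
  proof (induction rule: span_induct_alt)
    case base
    show ?case using assms sT by (auto simp: subspace_0)
  next
    case (step c s x)
    have *: "(c *s s + x) \<star> y = c *s (s \<star> y) + x \<star> y"
      using subsetD[OF \<open>S \<subseteq> C\<close> step(1)] subsetD[OF sT y] step(2)
      by (simp add: bracket_add_left bracket_scale_left)
    show ?case
      unfolding * using assms step 1 by (auto simp: subspace_add subspace_scale)
  qed
  then show ?thesis ..
qed

lemma LC_Suc: "k \<ge> 1 \<Longrightarrow> LC (Suc k) = span {x \<star> y | x y. x \<in> LC k \<and> y \<in> C}"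
  by simp

lemma LC_1 [simp]: "LC (Suc 0) = C"
  by simp

declare lower_central.simps [simp del]

lemma LC_properties: "subspace (LC k) \<and> LC k \<subseteq> C \<and> LC (Suc k) \<subseteq> LC k"
proof (induction k)
  case 0
  then show ?case using subspace_carrier by (simp add: lower_central.simps)
next
  case (Suc k)
  have "span {x \<star> y | x y. x \<in> LC (Suc k) \<and> y \<in> C} \<subseteq> LC (Suc k)"
  proof (cases "k = 0")
    case True
    have "span {x \<star> y | x y. x \<in> C \<and> y \<in> C} \<subseteq> C"
      by (rule span_closed) auto
    then show ?thesis using True by simp
  next
    case False
    have "{x \<star> y | x y. x \<in> LC (Suc k) \<and> y \<in> C} \<subseteq> {x \<star> y | x y. x \<in> LC k \<and> y \<in> C}"
      using Suc by auto
    then show ?thesis using LC_Suc[of k] False by (simp add: span_mono)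
  qed
  then show ?case using Suc LC_Suc[of "Suc k"] by (cases "k = 0") (auto simp: LC_Suc subspace_carrier)
qed

lemma subspace_LC [simp]: "subspace (LC k)"
  and LC_closed: "x \<in> LC k \<Longrightarrow> x \<in> C"
  using LC_properties by auto

lemma LC_antimono: "i \<le> j \<Longrightarrow> LC j \<subseteq> LC i"
  using lift_Suc_antimono_le[of LC] LC_properties by blast

lemmas LC_mono = subsetD[OF LC_antimono]

lemma bracket_LC_left: "x \<in> LC k \<Longrightarrow> k \<ge> 1 \<Longrightarrow> y \<in> C \<Longrightarrow> x \<star> y \<in> LC (Suc k)"
  unfolding LC_Suc by (rule span_base) auto

text \<open>The Leibniz identity turns \<open>x \<star> (u \<star> v)\<close> into left-normed
  products, to which \<open>bracket_LC_left\<close> applies. The second of them uses the induction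
  hypothesis at \<open>Suc i\<close>, so \<open>i\<close> has to stay arbitrary.\<close>

lemma bracket_LC:
  assumes "i \<ge> 1" "j \<ge> 1" "x \<in> LC i" "y \<in> LC j"
  shows "x \<star> y \<in> LC (i + j)"
  using assms(2,1,3,4)
proof (induction j arbitrary: i x y rule: dec_induct)
  case base
  then show ?case using bracket_LC_left[of x i y] by simp
next
  case (step j)
  let ?T = "{x \<star> y | x y. x \<in> LC j \<and> y \<in> C}"
  show ?case
  proof (rule bracket_span[of x "{x}" y ?T])
    show "x \<in> span {x}" by (simp add: span_base)
    show "y \<in> span ?T" using step LC_Suc by simp
    show "{x} \<subseteq> C" "?T \<subseteq> C" using step LC_closed by auto
    fix s t assume "s \<in> {x}" "t \<in> ?T"
    then obtain u v where uv: "s = x" "t = u \<star> v" "u \<in> LC j" "v \<in> C" by auto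
    have "(x \<star> u) \<star> v \<in> LC (i + Suc j)"
      using step.IH[of i x u] step uv bracket_LC_left[of "x \<star> u" "i + j" v] by simp
    moreover have "(x \<star> v) \<star> u \<in> LC (i + Suc j)"
      using step.IH[of "Suc i" "x \<star> v" u] bracket_LC_left[of x i v] step uv by simp
    moreover have "s \<star> t = (x \<star> u) \<star> v - (x \<star> v) \<star> u"
      using uv step LC_closed by (simp add: leibniz_identity)
    ultimately show "s \<star> t \<in> LC (i + Suc j)"
      by (simp add: subspace_diff)
  qed simp
qed

end

section \<open>Isomorphisms, table algebras and coordinates in a basis\<close>

lemma alg_isomorphic_sym:
  assumes iso: "alg_isomorphic L M"
    and closed: "\<And>x y. x \<in> alg_carrier L \<Longrightarrow> y \<in> alg_carrier L \<Longrightarrow> x + y \<in> alg_carrier L"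
      "\<And>a x. x \<in> alg_carrier L \<Longrightarrow> alg_scale L a x \<in> alg_carrier L"
      "\<And>x y. x \<in> alg_carrier L \<Longrightarrow> y \<in> alg_carrier L \<Longrightarrow> bracket L x y \<in> alg_carrier L"
  shows "alg_isomorphic M L"
proof -
  obtain f where f: "bij_betw f (alg_carrier L) (alg_carrier M)"
    "\<forall>x\<in>alg_carrier L. \<forall>y\<in>alg_carrier L. f (x + y) = f x + f y"
    "\<forall>a. \<forall>x\<in>alg_carrier L. f (alg_scale L a x) = alg_scale M a (f x)"
    "\<forall>x\<in>alg_carrier L. \<forall>y\<in>alg_carrier L. f (bracket L x y) = bracket M (f x) (f y)"
    using iso unfolding alg_isomorphic_def by blast
  define g where "g = inv_into (alg_carrier L) f"
  have g: "bij_betw g (alg_carrier M) (alg_carrier L)"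
    unfolding g_def by (rule bij_betw_inv_into[OF f(1)])
  have gf: "g (f x) = x" if "x \<in> alg_carrier L" for x
    unfolding g_def using f(1) that by (rule bij_betw_inv_into_left)
  have fg: "f (g x) = x" if "x \<in> alg_carrier M" for x
    unfolding g_def using f(1) that by (rule bij_betw_inv_into_right)
  have gc: "g x \<in> alg_carrier L" if "x \<in> alg_carrier M" for x
    using g that by (rule bij_betwE[THEN bspec])
  show ?thesis
    unfolding alg_isomorphic_def
  proof (intro exI[of _ g] conjI ballI allI)
    fix x y a assume x: "x \<in> alg_carrier M" and y: "y \<in> alg_carrier M"
    show "g (x + y) = g x + g y"
      using gf[OF closed(1)[OF gc[OF x] gc[OF y]]] f(2) x y gc fg by simp
    show "g (bracket M x y) = bracket L (g x) (g y)"
      using gf[OF closed(3)[OF gc[OF x] gc[OF y]]] f(4) x y gc fg by simp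
  next
    fix a x assume x: "x \<in> alg_carrier M"
    show "g (alg_scale M a x) = alg_scale L a (g x)"
      using gf[OF closed(2)[OF gc[OF x]]] f(3) x gc fg by simp
  qed (rule g)
qed

lemma sum_fun_apply: "(\<Sum>i\<in>I. f i) k = (\<Sum>i\<in>I. f i k)"
  for f :: "'i \<Rightarrow> 'b \<Rightarrow> 'c::comm_monoid_add"
  by (induction I rule: infinite_finite_induct) auto

lemma bracket_table_alg:
  "bracket (table_alg n p) x y m = (\<Sum>i=1..n. \<Sum>j=1..n. x i * y j * p i j m)"
  by (simp add: table_alg_def sum_fun_apply fun_scale_def)

lemma carrier_table_alg: "x \<in> alg_carrier (table_alg n p) \<longleftrightarrow> (\<forall>i. i \<notin> {1..n} \<longrightarrow> x i = 0)"
  by (simp add: table_alg_def)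

lemma scale_table_alg: "alg_scale (table_alg n p) a x m = a * x m"
  by (simp add: table_alg_def fun_scale_def)

context leibniz_algebra
begin

definition comb :: "nat \<Rightarrow> (nat \<Rightarrow> 'a) \<Rightarrow> (nat \<Rightarrow> 'k) \<Rightarrow> 'a" where
  "comb n e c = (\<Sum>i=1..n. c i *s e i)"

text \<open>Independence is a consequence of counting: \<open>n\<close> vectors span a space of
  dimension \<open>n\<close> (\<open>frame_independent\<close>). For an explicit basis only spanning
  has to be checked.\<close>

definition frame :: "nat \<Rightarrow> (nat \<Rightarrow> 'a) \<Rightarrow> bool" where
  "frame n e \<longleftrightarrow> has_dimension L n \<and> e ` {1..n} \<subseteq> C \<and> C \<subseteq> span (e ` {1..n})"

lemma frame_closed: "frame n e \<Longrightarrow> i \<in> {1..n} \<Longrightarrow> e i \<in> C"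
  unfolding frame_def by blast

lemma comb_closed: "frame n e \<Longrightarrow> comb n e c \<in> C"
  unfolding comb_def by (intro sum_closed) (auto simp: frame_closed)

lemma has_dimensionE:
  assumes "has_dimension L n"
  obtains B where "finite B" "card B = n" "independent B" "span B = C"
  using assms unfolding has_dimension_def by blast

lemma has_dimension_dim: "has_dimension L n \<Longrightarrow> dim C = n"
  by (metis has_dimensionE dim_span_eq_card_independent)

lemma frame_independent:
  assumes "frame n e"
  shows "inj_on e {1..n}" "independent (e ` {1..n})"
proof -
  obtain T where T: "T \<subseteq> e ` {1..n}" "independent T" "e ` {1..n} \<subseteq> span T"
    using basis_exists by metis
  have "span T = C"
    using T assms unfolding frame_def
    by (metis order_antisym span_closed span_minimal subset_trans subspace_span)
  then have "card T = n"
    using T(2) assms dim_span_eq_card_independent has_dimension_dim unfolding frame_def by metis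
  moreover have "card (e ` {1..n}) \<le> n"
    using card_image_le[of "{1..n}" e] by simp
  ultimately have "T = e ` {1..n}" "card (e ` {1..n}) = n"
    using T(1) card_seteq[of "e ` {1..n}" T] by auto
  then show "inj_on e {1..n}" "independent (e ` {1..n})"
    using T(2) by (auto intro: eq_card_imp_inj_on)
qed

lemma comb_eq_0:
  assumes "frame n e" "comb n e c = 0" "i \<in> {1..n}"
  shows "c i = 0"
proof -
  note inj = frame_independent(1)[OF assms(1)]
  let ?u = "\<lambda>v. c (inv_into {1..n} e v)"
  have "(\<Sum>v\<in>e ` {1..n}. ?u v *s v) = (\<Sum>i=1..n. ?u (e i) *s e i)"
    by (rule sum.reindex_cong[OF inj]) auto
  also have "\<dots> = comb n e c"
    unfolding comb_def using inj by (intro sum.cong) auto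
  finally have "?u (e i) = 0"
    using assms independentD[OF frame_independent(2)[OF assms(1)], of "e ` {1..n}" ?u "e i"] by simp
  then show ?thesis using inj assms(3) by simp
qed

lemma comb_diff: "comb n e c - comb n e c' = comb n e (\<lambda>i. c i - c' i)"
  by (simp add: comb_def sum_subtractf scale_left_diff_distrib)

lemma comb_unique:
  assumes "frame n e" "comb n e c = comb n e c'" "i \<in> {1..n}"
  shows "c i = c' i"
  using comb_eq_0[OF assms(1), of "\<lambda>i. c i - c' i" i] assms(2,3) by (simp flip: comb_diff)

lemma frame_ex_comb:
  assumes "frame n e" "x \<in> C"
  shows "\<exists>c. (\<forall>i. i \<notin> {1..n} \<longrightarrow> c i = 0) \<and> x = comb n e c"
proof -
  note inj = frame_independent(1)[OF assms(1)]
  obtain u where u: "x = (\<Sum>v\<in>e ` {1..n}. u v *s v)"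
    using assms span_finite[of "e ` {1..n}"] unfolding frame_def by auto
  also have "\<dots> = comb n e (\<lambda>i. if i \<in> {1..n} then u (e i) else 0)"
    unfolding comb_def by (rule sum.reindex_cong[OF inj]) auto
  finally show ?thesis by (intro exI[of _ "\<lambda>i. if i \<in> {1..n} then u (e i) else 0"]) auto
qed

lemma bracket_comb:
  assumes "frame n e"
  shows "comb n e c \<star> comb n e c' = (\<Sum>i=1..n. \<Sum>j=1..n. (c i * c' j) *s (e i \<star> e j))"
proof -
  have e: "e i \<in> C" if "i \<in> {1..n}" for i
    using assms that by (rule frame_closed)
  have "comb n e c \<star> comb n e c' = (\<Sum>i=1..n. c i *s (e i \<star> comb n e c'))"
    unfolding comb_def[of n e c] using e comb_closed[OF assms]
    by (subst bracket_sum_left) (auto intro!: sum.cong simp: bracket_scale_left)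
  also have "\<dots> = (\<Sum>i=1..n. \<Sum>j=1..n. (c i * c' j) *s (e i \<star> e j))"
  proof (intro sum.cong refl)
    fix i assume "i \<in> {1..n}"
    then have "e i \<star> comb n e c' = (\<Sum>j=1..n. c' j *s (e i \<star> e j))"
      unfolding comb_def using e
      by (subst bracket_sum_right) (auto intro!: sum.cong simp: bracket_scale_right)
    then show "c i *s (e i \<star> comb n e c') = (\<Sum>j=1..n. (c i * c' j) *s (e i \<star> e j))"
      by (simp add: scale_sum_right)
  qed
  finally show ?thesis .
qed

end

lemma (in leibniz_algebra) frame_nonzero:
  assumes "frame n e" "i \<in> {1..n}"
  shows "e i \<noteq> 0"
  using frame_independent(2)[OF assms(1)] assms(2) dependent_zero by (metis imageI)

text \<open>The coordinate map \<open>comb n e\<close> naturally runs from the table algebra to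
  \<open>L\<close>, and is inverted at the end. Vanishing of \<open>p i j\<close> outside
  \<open>{1..n}\<close> makes the carrier of the table closed under its product, which the inversion
  needs.\<close>

lemma frame_isomorphic:
  fixes L :: "(complex, 'b::ab_group_add) alg"
  assumes "leibniz_algebra L" and e: "leibniz_algebra.frame L n e"
    and p: "\<And>i j m. i \<in> {1..n} \<Longrightarrow> j \<in> {1..n} \<Longrightarrow> m \<notin> {1..n} \<Longrightarrow> p i j m = 0"
    and br: "\<And>i j. i \<in> {1..n} \<Longrightarrow> j \<in> {1..n} \<Longrightarrow>
      bracket L (e i) (e j) = leibniz_algebra.comb L n e (p i j)"
  shows "alg_isomorphic L (table_alg n p)"
proof -
  interpret leibniz_algebra L by fact
  let ?T = "table_alg n p"
  have "alg_isomorphic ?T L"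
    unfolding alg_isomorphic_def
  proof (intro exI[of _ "comb n e"] conjI ballI allI)
    show "bij_betw (comb n e) (alg_carrier ?T) C"
      unfolding bij_betw_def
    proof
      show "inj_on (comb n e) (alg_carrier ?T)"
      proof (rule inj_onI)
        fix x y assume xy: "x \<in> alg_carrier ?T" "y \<in> alg_carrier ?T" "comb n e x = comb n e y"
        show "x = y"
        proof
          fix i show "x i = y i"
            using xy comb_unique[OF e xy(3), of i] by (cases "i \<in> {1..n}") (auto simp: carrier_table_alg)
        qed
      qed
      show "comb n e ` alg_carrier ?T = C"
        using comb_closed[OF e] frame_ex_comb[OF e] by (auto simp: carrier_table_alg image_iff Bex_def)
    qed
  next
    fix x y assume "x \<in> alg_carrier ?T" "y \<in> alg_carrier ?T"
    show "comb n e (x + y) = comb n e x + comb n e y"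
      by (simp add: comb_def scale_left_distrib sum.distrib)
    have "comb n e (bracket ?T x y) = (\<Sum>i=1..n. \<Sum>j=1..n. (x i * y j) *s comb n e (p i j))"
    proof -
      have "comb n e (bracket ?T x y)
          = (\<Sum>m=1..n. \<Sum>i=1..n. \<Sum>j=1..n. (x i * y j) *s (p i j m *s e m))"
        by (simp add: comb_def bracket_table_alg scale_sum_left)
      also have "\<dots> = (\<Sum>i=1..n. \<Sum>m=1..n. \<Sum>j=1..n. (x i * y j) *s (p i j m *s e m))"
        by (rule sum.swap)
      also have "\<dots> = (\<Sum>i=1..n. \<Sum>j=1..n. \<Sum>m=1..n. (x i * y j) *s (p i j m *s e m))"
        by (intro sum.cong refl sum.swap)
      also have "\<dots> = (\<Sum>i=1..n. \<Sum>j=1..n. (x i * y j) *s comb n e (p i j))"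
        by (simp only: comb_def scale_sum_right)
      finally show ?thesis .
    qed
    also have "\<dots> = (\<Sum>i=1..n. \<Sum>j=1..n. (x i * y j) *s (e i \<star> e j))"
      by (intro sum.cong refl) (simp add: br)
    also have "\<dots> = comb n e x \<star> comb n e y"
      by (simp add: bracket_comb[OF e])
    finally show "comb n e (bracket ?T x y) = comb n e x \<star> comb n e y" .
  next
    fix a x assume "x \<in> alg_carrier ?T"
    show "comb n e (alg_scale ?T a x) = a *s comb n e x"
      by (simp add: comb_def scale_table_alg scale_sum_right)
  qed
  then show ?thesis
    by (rule alg_isomorphic_sym)
      (auto simp: carrier_table_alg scale_table_alg bracket_table_alg p intro!: sum.neutral)
qed

context leibniz_algebra
begin

section \<open>Gradations\<close>

definition is_decomp :: "(int \<Rightarrow> 'a set) \<Rightarrow> 'a \<Rightarrow> (int \<Rightarrow> 'a) \<Rightarrow> bool" where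
  "is_decomp V x f \<longleftrightarrow> (\<forall>i. f i \<in> V i) \<and> finite {i. f i \<noteq> 0} \<and> x = (\<Sum>i | f i \<noteq> 0. f i)"

text \<open>The homogeneous projection of degree \<open>d\<close>. The definite description selects
  the whole decomposition at once; \<open>gradation_decomp\<close> makes it unique for
  \<open>x\<close> in the carrier.\<close>

definition component :: "(int \<Rightarrow> 'a set) \<Rightarrow> int \<Rightarrow> 'a \<Rightarrow> 'a" where
  "component V d x = (THE f. is_decomp V x f) d"

lemma gradation_subspace: "gradation L V \<Longrightarrow> subspace (V i)"
  and gradation_closed: "gradation L V \<Longrightarrow> x \<in> V i \<Longrightarrow> x \<in> C"
  and gradation_bracket: "gradation L V \<Longrightarrow> x \<in> V i \<Longrightarrow> y \<in> V j \<Longrightarrow> x \<star> y \<in> V (i + j)"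
  and gradation_decomp: "gradation L V \<Longrightarrow> x \<in> C \<Longrightarrow> \<exists>!f. is_decomp V x f"
  unfolding gradation_def is_decomp_def by auto

lemma component_eqI: "gradation L V \<Longrightarrow> x \<in> C \<Longrightarrow> is_decomp V x f \<Longrightarrow> component V d x = f d"
  unfolding component_def using gradation_decomp[of V x] by (metis the1_equality)

lemma sum_support:
  fixes f :: "int \<Rightarrow> 'a"
  assumes "finite A" "{i. f i \<noteq> 0} \<subseteq> A"
  shows "(\<Sum>i | f i \<noteq> 0. f i) = sum f A"
  using assms by (intro sum.mono_neutral_left) auto

lemma component_lincomb:
  assumes V: "gradation L V" and x: "x \<in> C" and y: "y \<in> C"
  shows "component V d (c *s x + y) = c *s component V d x + component V d y"
proof -
  obtain f g where f: "is_decomp V x f" and g: "is_decomp V y g"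
    using gradation_decomp[OF V] x y by metis
  let ?A = "{i. f i \<noteq> 0} \<union> {i. g i \<noteq> 0}"
  let ?h = "\<lambda>i. c *s f i + g i"
  have fin: "finite ?A" using f g unfolding is_decomp_def by auto
  have "c *s x + y = c *s sum f ?A + sum g ?A"
    using f g fin sum_support[of ?A f] sum_support[of ?A g] unfolding is_decomp_def by auto
  also have "\<dots> = sum ?h ?A" by (simp add: scale_sum_right sum.distrib)
  also have "\<dots> = (\<Sum>i | ?h i \<noteq> 0. ?h i)"
    using fin by (intro sum_support[symmetric]) auto
  finally have "c *s x + y = (\<Sum>i | ?h i \<noteq> 0. ?h i)" .
  moreover have "finite {i. ?h i \<noteq> 0}" using fin by (rule rev_finite_subset) auto
  moreover have "?h i \<in> V i" for i
    using f g gradation_subspace[OF V] unfolding is_decomp_def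
    by (intro subspace_add subspace_scale) auto
  ultimately have "is_decomp V (c *s x + y) ?h"
    unfolding is_decomp_def by blast
  moreover have "c *s x + y \<in> C" using x y by simp
  ultimately show ?thesis
    using component_eqI[OF V x f, of d] component_eqI[OF V y g, of d]
      component_eqI[OF V, of "c *s x + y" ?h d] by simp
qed

lemma component_homogeneous:
  assumes V: "gradation L V" and x: "x \<in> V e"
  shows "component V d x = (if d = e then x else 0)"
proof -
  let ?f = "\<lambda>i. if i = e then x else 0"
  have eq: "{i. ?f i \<noteq> 0} = (if x = 0 then {} else {e})" by auto
  have "is_decomp V x ?f"
    unfolding is_decomp_def eq using x gradation_subspace[OF V] by (auto simp: subspace_0)
  then show ?thesis using component_eqI[OF V gradation_closed[OF V x], of ?f d] by simp
qed

text \<open>The projection of degree \<open>d\<close> is linear, fixes the members of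
  \<open>S\<close> of degree \<open>d\<close> and kills those of any other degree.\<close>

lemma component_in_span:
  assumes V: "gradation L V" and S: "S \<subseteq> (\<Union>i. V i)" and v: "v \<in> span S"
  shows "component V d v \<in> span (S \<inter> V d)"
proof -
  have SC: "S \<subseteq> C" using S gradation_closed[OF V] by blast
  have "v \<in> C \<and> component V d v \<in> span (S \<inter> V d)"
    using v
  proof (induction rule: span_induct_alt)
    case base
    have "0 \<in> V d" using gradation_subspace[OF V] by (rule subspace_0)
    then show ?case using component_homogeneous[OF V, of 0 d d] by (simp add: span_zero)
  next
    case (step c s y)
    obtain e where e: "s \<in> V e" using S step by auto
    have "component V d s \<in> span (S \<inter> V d)"
      using component_homogeneous[OF V e, of d] e step by (auto simp: span_zero span_base)
    then show ?case
      using step SC component_lincomb[OF V, of s y d c] by (auto simp: span_add span_scale)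
  qed
  then show ?thesis ..
qed

lemma homogeneous_in_span:
  assumes "gradation L V" "S \<subseteq> (\<Union>i. V i)" "v \<in> span S" "v \<in> V d"
  shows "v \<in> span (S \<inter> V d)"
  using component_in_span[OF assms(1-3), of d] component_homogeneous[OF assms(1,4), of d] by simp

lemma homogeneous_spaces_disjoint:
  assumes "gradation L V" "x \<in> V i" "x \<in> V j" "i \<noteq> j"
  shows "x = 0"
  using component_homogeneous[OF assms(1,2), of i] component_homogeneous[OF assms(1,3), of i] assms(4)
  by simp

lemma carrier_span_homogeneous:
  assumes V: "gradation L V"
  shows "C = span (\<Union>i. V i)"
proof
  show "span (\<Union>i. V i) \<subseteq> C"
    using gradation_closed[OF V] by (intro span_closed) auto
  show "C \<subseteq> span (\<Union>i. V i)"
  proof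
    fix x assume "x \<in> C"
    then obtain f where "is_decomp V x f" using gradation_decomp[OF V] by blast
    then show "x \<in> span (\<Union>i. V i)"
      unfolding is_decomp_def by (metis UNIV_I UN_I span_base span_sum)
  qed
qed

text \<open>Products of homogeneous elements are homogeneous, so \<open>bracket_span\<close> on
  homogeneous spanning sets carries the property from \<open>LC k\<close> to
  \<open>LC (Suc k)\<close>. All later arguments that combine weight and degree rest on
  this.\<close>

lemma LC_span_homogeneous:
  assumes V: "gradation L V" and k: "k \<ge> 1"
  shows "LC k = span (LC k \<inter> (\<Union>i. V i))"
  using k
proof (induction k rule: dec_induct)
  case base
  have "(\<Union>i. V i) \<subseteq> C" using gradation_closed[OF V] by auto
  then show ?case using carrier_span_homogeneous[OF V] by (simp add: Int_absorb1)
next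
  case (step k)
  let ?H = "\<Union>i. V i"
  have HC: "?H \<subseteq> C" using gradation_closed[OF V] by auto
  have "x \<star> y \<in> span (LC (Suc k) \<inter> ?H)" if xy: "x \<in> LC k" "y \<in> C" for x y
  proof (rule bracket_span)
    show "x \<in> span (LC k \<inter> ?H)" using step.IH xy by blast
    show "y \<in> span ?H" using carrier_span_homogeneous[OF V] xy by blast
    fix s t assume st: "s \<in> LC k \<inter> ?H" "t \<in> ?H"
    then have "s \<star> t \<in> LC (Suc k)"
      using bracket_LC_left[of s k t] HC step(1) by auto
    moreover have "s \<star> t \<in> ?H" using st gradation_bracket[OF V] by blast
    ultimately show "s \<star> t \<in> span (LC (Suc k) \<inter> ?H)" by (simp add: span_base)
  qed (use HC in auto)
  then have "{x \<star> y | x y. x \<in> LC k \<and> y \<in> C} \<subseteq> span (LC (Suc k) \<inter> ?H)"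
    by blast
  then have "LC (Suc k) \<subseteq> span (LC (Suc k) \<inter> ?H)"
    unfolding LC_Suc[OF step(1)] by (rule span_minimal) simp
  then show ?case
    by (meson Int_lower1 span_minimal subset_antisym subspace_LC)
qed

text \<open>Reversing the degrees later allows \<open>x\<close> to have nonnegative degree.
  Decompositions for the two gradations correspond under \<open>f \<circ> uminus\<close>.\<close>

lemma gradation_uminus:
  assumes "gradation L V"
  shows "gradation L (\<lambda>i. V (- i))"
proof -
  have "\<exists>!f. is_decomp (\<lambda>i. V (- i)) x f" if x: "x \<in> C" for x
  proof -
    have iff: "is_decomp (\<lambda>i. V (- i)) x f \<longleftrightarrow> is_decomp V x (f \<circ> uminus)" for f
    proof -
      have bij: "bij_betw uminus {i. f i \<noteq> 0} {i. (f \<circ> uminus) i \<noteq> 0}"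
        by (rule bij_betw_byWitness[where f' = uminus]) auto
      have "(\<Sum>i | (f \<circ> uminus) i \<noteq> 0. (f \<circ> uminus) i) = (\<Sum>i | f i \<noteq> 0. f i)"
        using sum.reindex_bij_betw[OF bij, of "f \<circ> uminus"] by simp
      moreover have "finite {i. (f \<circ> uminus) i \<noteq> 0} \<longleftrightarrow> finite {i. f i \<noteq> 0}"
        using bij_betw_finite[OF bij] by simp
      moreover have "(\<forall>i. f i \<in> V (- i)) \<longleftrightarrow> (\<forall>i. (f \<circ> uminus) i \<in> V i)"
        by (metis comp_apply minus_minus)
      ultimately show ?thesis unfolding is_decomp_def by simp
    qed
    obtain f where f: "is_decomp V x f" "\<And>g. is_decomp V x g \<Longrightarrow> g = f"
      using gradation_decomp[OF assms x] by blast
    have u: "h \<circ> uminus \<circ> uminus = h" for h :: "int \<Rightarrow> 'a" by auto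
    show ?thesis
    proof (rule ex1I[of _ "f \<circ> uminus"])
      show "is_decomp (\<lambda>i. V (- i)) x (f \<circ> uminus)" by (simp only: iff u f(1))
      show "g = f \<circ> uminus" if "is_decomp (\<lambda>i. V (- i)) x g" for g
      proof -
        have "g \<circ> uminus = f" using f(2) that unfolding iff .
        then show ?thesis using u[of g] by simp
      qed
    qed
  qed
  moreover have "x \<star> y \<in> V (- (i + j))" if "x \<in> V (- i)" "y \<in> V (- j)" for i j x y
    using gradation_bracket[OF assms that] by simp
  ultimately show ?thesis
    using gradation_subspace[OF assms] gradation_closed[OF assms]
    unfolding gradation_def is_decomp_def by (simp add: subset_iff)
qed

lemma gradation_trivial: "gradation L (\<lambda>i. if i = 0 then C else {0})"
  (is "gradation L ?V")
proof -
  have dec: "is_decomp ?V x f \<longleftrightarrow> f = (\<lambda>i. if i = 0 then x else 0)" if x: "x \<in> C" for x f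
  proof
    assume f: "is_decomp ?V x f"
    then have z: "f i = 0" if "i \<noteq> 0" for i using that unfolding is_decomp_def by (metis singletonD)
    have "x = sum f {0}"
      using f z sum_support[of "{0}" f] unfolding is_decomp_def by auto
    then show "f = (\<lambda>i. if i = 0 then x else 0)" using z by auto
  next
    assume f: "f = (\<lambda>i. if i = 0 then x else 0)"
    then have "{i. f i \<noteq> 0} = (if x = 0 then {} else {0})" by auto
    then show "is_decomp ?V x f" using f x unfolding is_decomp_def by auto
  qed
  show ?thesis
    unfolding gradation_def
    using subspace_carrier dec unfolding is_decomp_def by auto
qed

lemma connected_length_le:
  assumes V: "gradation L V" and c: "connected_between V k l" and n: "has_dimension L n"
  shows "l - k + 1 \<le> int n"
proof -
  have "\<forall>i. \<exists>v. k \<le> i \<and> i \<le> l \<longrightarrow> v \<in> V i \<and> v \<noteq> 0"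
    using c subspace_0[OF gradation_subspace[OF V]] unfolding connected_between_def
    by (metis insertI1 singletonD subsetI subset_antisym empty_subsetI insert_subset)
  then obtain v where v: "\<And>i. k \<le> i \<Longrightarrow> i \<le> l \<Longrightarrow> v i \<in> V i \<and> v i \<noteq> 0" by metis
  have inj: "inj_on v {k..l}"
    using v homogeneous_spaces_disjoint[OF V] by (intro inj_onI) (metis atLeastAtMost_iff)
  have ind: "independent (v ` {k..l})"
    unfolding dependent_def
  proof clarify
    fix i assume i: "i \<in> {k..l}" and sp: "v i \<in> span (v ` {k..l} - {v i})"
    have "v i \<in> span ((v ` {k..l} - {v i}) \<inter> V i)"
      using sp v i by (intro homogeneous_in_span[OF V]) fastforce+
    moreover have "(v ` {k..l} - {v i}) \<inter> V i = {}"
    proof (intro equals0I)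
      fix w assume "w \<in> (v ` {k..l} - {v i}) \<inter> V i"
      then obtain j where "j \<in> {k..l}" "w = v j" "j \<noteq> i" "v j \<in> V i" by blast
      then show False using v[of j] homogeneous_spaces_disjoint[OF V, of "v j" j i] by auto
    qed
    ultimately show False using v[of i] i by simp
  qed
  obtain B where B: "finite B" "card B = n" "span B = C" using n by (rule has_dimensionE)
  have "v ` {k..l} \<subseteq> span B"
  proof (clarify)
    fix i assume "i \<in> {k..l}"
    then have "v i \<in> V i" using v[of i] by simp
    then show "v i \<in> span B" using B gradation_closed[OF V] by simp
  qed
  then have "card {k..l} \<le> n"
    using independent_span_bound[OF B(1) ind] B card_image[OF inj] by simp
  then show ?thesis by simp
qed

text \<open>\<open>Max\<close> carries information only for a finite nonempty set. The dimension
  bounds all lengths, and the trivial gradation is a member because \<open>n \<ge> 1\<close> makes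
  the carrier nonzero.\<close>

lemma alg_length:
  assumes n: "has_dimension L n" "n \<ge> 1"
  shows "\<exists>V k l. gradation L V \<and> connected_between V k l \<and> l - k + 1 = alg_length L"
    and "gradation L V \<Longrightarrow> connected_between V k l \<Longrightarrow> l - k + 1 \<le> alg_length L"
proof -
  let ?S = "{l - k + 1 | V k l. gradation L V \<and> connected_between V k l}"
  have "?S \<subseteq> {0..int n}"
    using connected_length_le[OF _ _ n(1)] by (auto simp: connected_between_def)
  then have fin: "finite ?S" by (rule finite_subset) simp
  have "C \<noteq> {0}"
  proof
    assume C: "C = {0}"
    obtain B where "finite B" "card B = n" "independent B" "span B = C" using n(1) by (rule has_dimensionE)
    then show False using C n(2) dependent_zero span_superset[of B]
      by (metis card.empty not_one_le_zero subset_singletonD insertI1)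
  qed
  then have "connected_between (\<lambda>i. if i = 0 then C else {0}) 0 0"
    unfolding connected_between_def by auto
  then have ne: "?S \<noteq> {}" using gradation_trivial by blast
  show "\<exists>V k l. gradation L V \<and> connected_between V k l \<and> l - k + 1 = alg_length L"
    using Max_in[OF fin ne] unfolding alg_length_def by (smt (verit) mem_Collect_eq)
  show "gradation L V \<Longrightarrow> connected_between V k l \<Longrightarrow> l - k + 1 \<le> alg_length L"
    unfolding alg_length_def by (rule Max_ge[OF fin]) blast
qed

text \<open>The gradation puts \<open>e i\<close> into degree \<open>i\<close>. The lemma serves to
  exclude algebras: such a basis realises the full length \<open>n\<close>.\<close>

lemma alg_length_frame:
  assumes e: "frame n e" and n: "n \<ge> 1"
    and br: "\<And>i j. i \<in> {1..n} \<Longrightarrow> j \<in> {1..n} \<Longrightarrow>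
      e i \<star> e j \<in> (if i + j \<le> n then span {e (i + j)} else {0})"
  shows "alg_length L \<ge> int n"
proof -
  define V where "V d = (if 1 \<le> d \<and> d \<le> int n then span {e (nat d)} else {0})" for d :: int
  have Vsub: "subspace (V i)" for i by (simp add: V_def)
  have VC: "V i \<subseteq> C" for i
  proof (cases "1 \<le> i \<and> i \<le> int n")
    case True
    then have "nat i \<in> {1..n}" by auto
    then have "{e (nat i)} \<subseteq> C" using frame_closed[OF e] by simp
    then show ?thesis using True span_closed by (simp add: V_def)
  next
    case False
    then show ?thesis by (auto simp: V_def)
  qed
  have dec: "\<exists>!f. is_decomp V x f" if x: "x \<in> C" for x
  proof -
    obtain c where c: "x = comb n e c" using frame_ex_comb[OF e x] by blast
    define g where "g c d = (if 1 \<le> d \<and> d \<le> int n then c (nat d) *s e (nat d) else 0)"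
      for c :: "nat \<Rightarrow> 'k" and d :: int
    have gsum: "(\<Sum>i | g c i \<noteq> 0. g c i) = comb n e c" for c
    proof -
      have "(\<Sum>i | g c i \<noteq> 0. g c i) = (\<Sum>i\<in>{1..int n}. g c i)"
        by (rule sum_support) (auto simp: g_def split: if_splits)
      also have "\<dots> = comb n e c"
        unfolding comb_def
        by (rule sum.reindex_bij_witness[where i = int and j = nat]) (auto simp: g_def)
      finally show ?thesis .
    qed
    show ?thesis
    proof (rule ex1I[of _ "g c"])
      have "finite {i. g c i \<noteq> 0}"
        by (rule finite_subset[of _ "{1..int n}"]) (auto simp: g_def split: if_splits)
      then show "is_decomp V x (g c)"
        unfolding is_decomp_def gsum c by (auto simp: g_def V_def span_base span_scale)
    next
      fix f assume f: "is_decomp V x f"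
      have "\<forall>i. \<exists>a. i \<in> {1..n} \<longrightarrow> f (int i) = a *s e i"
      proof
        fix i
        have "f (int i) \<in> V (int i)" using f unfolding is_decomp_def by blast
        then show "\<exists>a. i \<in> {1..n} \<longrightarrow> f (int i) = a *s e i"
          by (auto simp: V_def span_singleton)
      qed
      then obtain c' where c': "\<And>i. i \<in> {1..n} \<Longrightarrow> f (int i) = c' i *s e i" by metis
      have f0: "f d = 0" if "\<not> (1 \<le> d \<and> d \<le> int n)" for d
        using f that unfolding is_decomp_def V_def by (metis singletonD)
      have fg: "f = g c'"
      proof
        fix d show "f d = g c' d"
        proof (cases "1 \<le> d \<and> d \<le> int n")
          case True
          then have "nat d \<in> {1..n}" by auto
          from c'[OF this] show ?thesis using True by (simp add: g_def)
        next
          case False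
          then show ?thesis using f0 by (auto simp: g_def)
        qed
      qed
      then have eq: "comb n e c' = comb n e c"
        using f c gsum unfolding is_decomp_def by metis
      have "g c' = g c"
      proof
        fix d show "g c' d = g c d"
        proof (cases "1 \<le> d \<and> d \<le> int n")
          case True
          then have "nat d \<in> {1..n}" by auto
          from comb_unique[OF e eq this] show ?thesis by (simp add: g_def)
        qed (auto simp: g_def)
      qed
      then show "f = g c" using fg by simp
    qed
  qed
  have brV: "x \<star> y \<in> V (i + j)" if x: "x \<in> V i" and y: "y \<in> V j" for i j x y
  proof (cases "(1 \<le> i \<and> i \<le> int n) \<and> (1 \<le> j \<and> j \<le> int n)")
    case True
    then have ij: "nat i \<in> {1..n}" "nat j \<in> {1..n}" by auto
    show ?thesis
    proof (rule bracket_span)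
      show "x \<in> span {e (nat i)}" "y \<in> span {e (nat j)}" using x y True by (auto simp: V_def)
      show "{e (nat i)} \<subseteq> C" "{e (nat j)} \<subseteq> C" using ij frame_closed[OF e] by simp_all
      show "subspace (V (i + j))" by fact
      show "s \<star> t \<in> V (i + j)" if "s \<in> {e (nat i)}" "t \<in> {e (nat j)}" for s t
      proof -
        have "nat (i + j) = nat i + nat j" using True by (simp add: nat_add_distrib)
        then show ?thesis using br[OF ij] that True by (auto simp: V_def split: if_splits)
      qed
    qed
  next
    case False
    then have "x = 0 \<or> y = 0" using x y by (auto simp: V_def split: if_splits)
    then show ?thesis using x y VC Vsub by (auto simp: subspace_0 subset_iff)
  qed
  have "gradation L V"
    unfolding gradation_def using Vsub VC dec brV unfolding is_decomp_def by blast
  moreover have "connected_between V 1 (int n)"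
  proof -
    have "V i \<noteq> {0}" if "1 \<le> i \<and> i \<le> int n" for i
    proof -
      have "nat i \<in> {1..n}" using that by auto
      then show ?thesis
        using that frame_nonzero[OF e] span_base[of "e (nat i)" "{e (nat i)}"] by (auto simp: V_def)
    qed
    then show ?thesis using n by (auto simp: connected_between_def V_def)
  qed
  ultimately show ?thesis
    using alg_length(2)[of n V 1 "int n"] e n unfolding frame_def by simp
qed

end

section \<open>Structure constants of the associated graded algebra\<close>

definition weight :: "nat \<Rightarrow> nat" where
  "weight p = (if p = 0 then 1 else p)"

lemma weight_simps [simp]: "weight 0 = 1" "p \<ge> 1 \<Longrightarrow> weight p = p" "weight (Suc p) = Suc p"
  by (auto simp: weight_def)

lemma weight_ge_1 [simp]: "1 \<le> weight p" "Suc 0 \<le> weight p"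
  by (auto simp: weight_def)

lemma weight_add_ge_2 [simp]: "2 \<le> weight p + weight q" "2 \<le> weight p + (weight q + weight r)"
  by (auto simp: weight_def)

text \<open>
  Index \<open>0\<close> stands for \<open>x\<close> and index \<open>i \<ge> 1\<close> for \<open>z\<^sub>i\<close>, so both \<open>0\<close> and \<open>1\<close> have weight \<open>1\<close>; \<open>P p q\<close> is the
  coefficient of the product of the basis elements \<open>p\<close> and \<open>q\<close>, which lies in weight
  \<open>weight p + weight q\<close>.
\<close>

locale graded_constants =
  fixes N :: nat and P :: "nat \<Rightarrow> nat \<Rightarrow> 'k::field_char_0"
  assumes N: "N \<ge> 3"
    and leibniz: "weight p + weight q + weight r \<le> N \<Longrightarrow>
      P q r * P p (weight q + weight r)
        = P p q * P (weight p + weight q) r - P p r * P (weight p + weight r) q"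
    and onto: "2 \<le> i \<Longrightarrow> i < N \<Longrightarrow> P i 0 \<noteq> 0 \<or> P i 1 \<noteq> 0"
    and onto_2: "P 0 0 \<noteq> 0 \<or> P 0 1 \<noteq> 0 \<or> P 1 0 \<noteq> 0 \<or> P 1 1 \<noteq> 0"
    and P_2_0: "P 2 0 \<noteq> 0" and P_2_1: "P 2 1 = 0"
begin

text \<open>By the Leibniz identity \<open>[p, [u, u]] = 0\<close> and
  \<open>[p, [u, v] + [v, u]] = 0\<close>. If one of these symmetric products has a nonzero
  coefficient in weight 2, then \<open>z 2\<close> annihilates from the right at leading order, and
  the remaining claims follow by dividing by the nonzero constants of right multiplication by
  \<open>x\<close>.\<close>

lemma not_antisymmetric:
  assumes na: "P 0 0 \<noteq> 0 \<or> P 1 1 \<noteq> 0 \<or> P 1 0 + P 0 1 \<noteq> 0"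
  shows "P 0 1 = 0" "P 1 1 = 0" "2 \<le> i \<Longrightarrow> i < N \<Longrightarrow> P i 1 = 0 \<and> P i 0 \<noteq> 0"
proof -
  have ann: "P p 2 = 0" if "weight p + 2 \<le> N" for p
  proof -
    have "P 0 0 * P p 2 = 0" using leibniz[of p 0 0] that by (simp add: numeral_2_eq_2)
    moreover have "P 1 1 * P p 2 = 0" using leibniz[of p 1 1] that by (simp add: numeral_2_eq_2)
    moreover have "P 1 0 * P p 2 = P p 1 * P (weight p + 1) 0 - P p 0 * P (weight p + 1) 1"
      using leibniz[of p 1 0] that by (simp add: numeral_2_eq_2)
    moreover have "P 0 1 * P p 2 = P p 0 * P (weight p + 1) 1 - P p 1 * P (weight p + 1) 0"
      using leibniz[of p 0 1] that by (simp add: numeral_2_eq_2)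
    ultimately have "P 0 0 * P p 2 = 0" "P 1 1 * P p 2 = 0" "(P 1 0 + P 0 1) * P p 2 = 0"
      by (simp_all add: distrib_right)
    then show ?thesis using na by auto
  qed
  have step: "P i 1 = 0" if "2 \<le> i" "i < N" for i
    using that
  proof (induction i rule: dec_induct)
    case base
    show ?case by (rule P_2_1)
  next
    case (step i)
    have "P 1 0 * P i 2 = P i 1 * P (i + 1) 0 - P i 0 * P (i + 1) 1"
      using leibniz[of i 1 0] step by (simp add: numeral_2_eq_2)
    moreover have "P i 2 = 0" using ann[of i] step by simp
    ultimately show ?case using step onto[of i] by simp
  qed
  show "2 \<le> i \<Longrightarrow> i < N \<Longrightarrow> P i 1 = 0 \<and> P i 0 \<noteq> 0" using step onto by blast
  show "P 0 1 = 0"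
    using leibniz[of 0 0 1] ann[of 0] N P_2_0 P_2_1 by (simp add: numeral_2_eq_2)
  show "P 1 1 = 0"
    using leibniz[of 1 1 0] ann[of 1] N P_2_0 P_2_1 by (simp add: numeral_2_eq_2)
qed

end

locale graded_constants_lie = graded_constants +
  assumes P00: "P 0 0 = 0" and P11: "P 1 1 = 0" and P01: "P 0 1 = - P 1 0"
    and P10: "P 1 0 = 1" and normal: "2 \<le> i \<Longrightarrow> i < N \<Longrightarrow> P i 0 \<noteq> 0 \<Longrightarrow> P i 0 = 1"
begin

text \<open>Both claims are proved together, since \<open>onto\<close> provides only one nonzero
  value among \<open>P m 0\<close> and \<open>P m 1\<close>; the induction step divides by whichever
  it is.\<close>

lemma antisymmetric:
  assumes "1 \<le> m" "m < N"
  shows "P 0 m = - P m 0" "P 1 m = - P m 1"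
proof -
  have "P 0 m = - P m 0 \<and> P 1 m = - P m 1"
    using assms
  proof (induction m rule: dec_induct)
    case base
    then show ?case using P01 P11 by simp
  next
    case (step m)
    then have IH: "P 0 m = - P m 0" "P 1 m = - P m 1" by auto
    have 1: "P m 0 * P 0 (m+1) = P 0 m * P (m+1) 0"
      using leibniz[of 0 m 0] step P00 by simp
    have 2: "P m 1 * P 1 (m+1) = P 1 m * P (m+1) 1"
      using leibniz[of 1 m 1] step P11 by (simp add: add.commute)
    \<comment> \<open>The unknown \<open>P 2 m\<close> enters this instance and the next with the
      opposite coefficients \<open>- P 1 0\<close> and \<open>- P 0 1\<close>, so it can be
      eliminated.\<close>
    have 3: "P m 0 * P 1 (m+1) = P 1 m * P (m+1) 0 - P 1 0 * P 2 m"
      using leibniz[of 1 m 0] step by (simp add: numeral_2_eq_2 add.commute)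
    have 4: "P m 1 * P 0 (m+1) = P 0 m * P (m+1) 1 - P 0 1 * P 2 m"
      using leibniz[of 0 m 1] step by (simp add: numeral_2_eq_2 add.commute)
    show ?case
    proof (cases "P m 0 = 0")
      case True
      then have nz: "P m 1 \<noteq> 0" using onto[of m] step P10 by (cases "m = 1") auto
      have "P m 1 * P 1 (m+1) = P m 1 * (- P (m+1) 1)" using 2 IH by simp
      then have a: "P 1 (m+1) = - P (m+1) 1" using nz by (simp only: mult_cancel_left) simp
      have "P m 1 * P 0 (m+1) = P m 1 * (- P (m+1) 0)"
        using 3 4 True IH P10 P01 by simp
      then show ?thesis using nz a by (simp only: mult_cancel_left) simp
    next
      case False
      have "P m 0 * P 0 (m+1) = P m 0 * (- P (m+1) 0)" using 1 IH by simp
      then have a: "P 0 (m+1) = - P (m+1) 0" using False by (simp only: mult_cancel_left) simp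
      have "P m 0 * P 1 (m+1) = P m 0 * (- P (m+1) 1)"
        using 3 4 IH P10 P01 a by algebra
      then show ?thesis using False a by (simp only: mult_cancel_left) simp
    qed
  qed
  then show "P 0 m = - P m 0" "P 1 m = - P m 1" by auto
qed

text \<open>The triples \<open>0, m, 1\<close> and \<open>m, 1, 0\<close> express
  \<open>P 2 m\<close> and \<open>P m 2\<close> through right multiplications by \<open>x\<close>
  and \<open>y\<close>; antisymmetry against \<open>x\<close> makes the two expressions opposite.
  This closes the sign argument in \<open>switch\<close>.\<close>

lemma antisymmetric_2:
  assumes "1 \<le> m" "m + 2 \<le> N"
  shows "P 2 m = - P m 2"
proof -
  have "P m 1 * P 0 (m+1) = P 0 m * P (m+1) 1 - P 0 1 * P 2 m"
    using leibniz[of 0 m 1] assms by (simp add: numeral_2_eq_2 add.commute)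
  moreover have "P 1 0 * P m 2 = P m 1 * P (m+1) 0 - P m 0 * P (m+1) 1"
    using leibniz[of m 1 0] assms by (simp add: numeral_2_eq_2)
  moreover have "P 0 m = - P m 0" "P 0 (m+1) = - P (m+1) 0"
    using antisymmetric assms by auto
  ultimately have "P 2 m + P m 2 = 0" using P10 P01 by (simp add: algebra_simps)
  then show ?thesis by (simp only: eq_neg_iff_add_eq_0)
qed

lemma shift_eq:
  assumes "1 \<le> i" "1 \<le> j" "i + j < N"
  shows "P j 0 * P i (j + 1) = P i j * P (i + j) 0 - P i 0 * P (i + 1) j"
  using leibniz[of i j 0] assms by simp

text \<open>
  Here \<open>p + 1\<close> is the first weight \<open>\<ge> 2\<close> in which right multiplication by \<open>y\<close> does not vanish. The signs
  along the antidiagonal \<open>i + j = p + 2\<close> force \<open>p\<close> to be odd, and antisymmetry along the next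
  antidiagonal leaves no room for weight \<open>p + 3\<close>.
\<close>

lemma switch:
  assumes p: "2 \<le> p" "p + 1 < N" and zero: "\<And>i. 2 \<le> i \<Longrightarrow> i \<le> p \<Longrightarrow> P i 1 = 0"
    and nz: "P (p + 1) 1 \<noteq> 0"
  shows "odd p" "p + 2 = N"
    "1 \<le> i \<Longrightarrow> 1 \<le> j \<Longrightarrow> i + j < N \<Longrightarrow> P i j = 0"
    "1 \<le> i \<Longrightarrow> 1 \<le> j \<Longrightarrow> i + j = N \<Longrightarrow> P i j = (-1)^(j-1) * P (N - 1) 1"
proof -
  have one: "P i 0 = 1" if "1 \<le> i" "i \<le> p" for i
    using that P10 onto[of i] normal[of i] zero[of i] p by (cases "i = 1") auto
  have low: "P i j = 0" if "1 \<le> j" "1 \<le> i" "i + j \<le> p + 1" for i j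
    using that
  proof (induction j arbitrary: i rule: dec_induct)
    case base
    then show ?case using zero[of i] P11 by (cases "i = 1") auto
  next
    case (step j)
    have "P j 0 * P i (j + 1) = P i j * P (i + j) 0 - P i 0 * P (i + 1) j"
      using shift_eq[of i j] step p by simp
    then show ?case using one[of j] step.IH[of i] step.IH[of "i + 1"] step by simp
  qed
  define c where "c = P (p + 1) 1"
  have mid: "P i j = (-1)^(j-1) * c" if "1 \<le> j" "1 \<le> i" "i + j = p + 2" for i j
    using that
  proof (induction j arbitrary: i rule: dec_induct)
    case base
    then have "i = p + 1" by simp
    then show ?case by (simp add: c_def)
  next
    case (step j)
    have "P j 0 * P i (j + 1) = P i j * P (i + j) 0 - P i 0 * P (i + 1) j"
      using shift_eq[of i j] step p by simp
    moreover have "P i j = 0" using low[of j i] step by simp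
    moreover have "P i 0 = 1" "P j 0 = 1" using one step by auto
    moreover have "P (i + 1) j = (-1)^(j-1) * c" using step.IH[of "i + 1"] step by simp
    ultimately show ?case using step(1) by (cases j) auto
  qed
  \<comment> \<open>The antidiagonal \<open>i + j = p + 2\<close> links \<open>P (p + 1) 1\<close>
    to \<open>P 1 (p + 1)\<close> with the sign \<open>(-1) ^ p\<close>, whereas antisymmetry
    demands the sign -1.\<close>
  show odd: "odd p"
  proof
    assume "even p"
    then have "P 1 (p + 1) = c" using mid[of "p + 1" 1] by simp
    moreover have "P 1 (p + 1) = - c" using antisymmetric(2)[of "p + 1"] p by (simp add: c_def)
    ultimately show False using nz by (simp add: c_def)
  qed
  have p3: "p \<ge> 3" using odd p by (cases "p = 2") auto
  show pN: "p + 2 = N"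
  proof (rule ccontr)
    assume "p + 2 \<noteq> N"
    then have pN: "p + 3 \<le> N" using p by simp
    define \<eta> \<theta> where "\<eta> = P (p + 2) 0" and "\<theta> = P (p + 2) 1"
    \<comment> \<open>Each product on the right contains a constant of total weight at most
      \<open>p + 1\<close>, hence zero, while \<open>P 2 p\<close> lies on the nonvanishing
      antidiagonal. This forces \<open>\<theta> = 0\<close>.\<close>
    have "P 2 p * P 1 (p + 2) = P 1 2 * P 3 p - P 1 p * P (p + 1) 2"
      using leibniz[of 1 2 p] pN p3 by (simp add: numeral_3_eq_3 add.commute)
    moreover have "P 1 2 = 0" "P 1 p = 0" using low p3 by auto
    moreover have "P 2 p \<noteq> 0" using mid[of p 2] p3 nz by (simp add: c_def)
    ultimately have "P 1 (p + 2) = 0" by simp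
    then have \<theta>: "\<theta> = 0" using antisymmetric(2)[of "p + 2"] pN by (simp add: \<theta>_def)
    \<comment> \<open>The constants on the antidiagonal \<open>i + j = p + 3\<close>, with
      alternating signs chosen so that \<open>shift_eq\<close> becomes an arithmetic progression
      with difference \<open>c * \<eta>\<close>.\<close>
    define g where "g i = (-1)^i * P i (p + 3 - i)" for i
    have gp: "g (p + 1) = c * \<eta>"
      using shift_eq[of "p + 1" 1] pN odd P10 \<theta>
      by (simp add: g_def c_def \<eta>_def \<theta>_def numeral_2_eq_2)
    have gstep: "g i = c * \<eta> + g (i + 1)" if "2 \<le> i" "i \<le> p" for i
    proof -
      define j where "j = p + 2 - i"
      have j: "1 \<le> j" "j \<le> p" "i + j = p + 2" using that by (auto simp: j_def)
      have "P j 0 * P i (j + 1) = P i j * P (i + j) 0 - P i 0 * P (i + 1) j"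
        using shift_eq[of i j] j that pN by simp
      then have 1: "P i (j + 1) = (-1)^(j-1) * c * \<eta> - P (i + 1) j"
        using one j that mid[of j i] by (simp add: \<eta>_def)
      have "even (j - 1) \<longleftrightarrow> even i" using j odd by presburger
      then have 2: "(-1)^(j-1) = ((-1)^i :: 'a)" by (simp add: minus_one_power_iff)
      have 3: "(-1)^i * (-1)^i = (1 :: 'a)" by (simp flip: power_mult_distrib)
      have "p + 3 - i = j + 1" "p + 3 - (i + 1) = j" using j by auto
      then have "g i = (-1)^i * P i (j + 1)" "g (i + 1) = - ((-1)^i * P (i + 1) j)"
        unfolding g_def by simp_all
      moreover have "s * u = c * \<eta> + - (s * v)"
        if "u = s * c * \<eta> - v" "s * s = 1" for s u v :: 'a
        using that by algebra
      ultimately show ?thesis using 1[unfolded 2] 3 by metis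
    qed
    have gsum: "g (p + 1 - m) = of_nat m * c * \<eta> + g (p + 1)" if "m + 1 \<le> p" for m
      using that
    proof (induction m)
      case (Suc m)
      have "p + 1 - Suc m + 1 = p + 1 - m" using Suc by simp
      then show ?case using gstep[of "p + 1 - Suc m"] Suc by (simp add: algebra_simps)
    qed simp
    \<comment> \<open>The ends also satisfy \<open>g 2 = - g (p + 1)\<close> by antisymmetry and
      \<open>g (p + 1) = c * \<eta>\<close>, so \<open>(p + 1) * c * \<eta> = 0\<close>.
      Characteristic zero yields \<open>\<eta> = 0\<close>, and then neither generator reaches
      weight \<open>p + 3\<close>.\<close>
    have "g 2 = of_nat (p - 1) * c * \<eta> + g (p + 1)"
      using gsum[of "p - 1"] p by simp
    moreover have "g 2 = - g (p + 1)"
      using antisymmetric_2[of "p + 1"] pN odd by (simp add: g_def numeral_2_eq_2)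
    ultimately have "(of_nat (p - 1) + 2) * c * \<eta> = 0"
      using gp by (simp add: algebra_simps)
    moreover have "of_nat (p - 1) + 2 = (of_nat (p + 1) :: 'a)"
      using p by (simp add: of_nat_diff)
    ultimately have "\<eta> = 0"
      using nz by (metis add_is_0 c_def mult_eq_0_iff of_nat_eq_0_iff one_neq_zero)
    then show False using onto[of "p + 2"] \<theta> pN by (simp add: \<eta>_def \<theta>_def)
  qed
  show "1 \<le> i \<Longrightarrow> 1 \<le> j \<Longrightarrow> i + j < N \<Longrightarrow> P i j = 0"
    using low[of j i] pN by simp
  have "N - 1 = p + 1" using pN by simp
  then show "1 \<le> i \<Longrightarrow> 1 \<le> j \<Longrightarrow> i + j = N \<Longrightarrow> P i j = (-1)^(j-1) * P (N - 1) 1"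
    using mid[of j i] pN by (simp add: c_def)
qed

end

section \<open>Adapted homogeneous bases\<close>

locale filiform_algebra = leibniz_algebra L for L :: "('k::field_char_0, 'a::ab_group_add) alg" +
  fixes N :: nat
  assumes N: "N \<ge> 3"
    and has_dim: "has_dimension L (Suc N)"
    and dim_LC: "2 \<le> i \<Longrightarrow> i \<le> Suc N \<Longrightarrow> dim (LC i) = Suc N - i"
begin

lemma finite_span:
  obtains B where "finite B" "card B = Suc N" "span B = C"
  using has_dimensionE[OF has_dim] .

lemma LC_step:
  assumes "2 \<le> j" "j \<le> N" "w \<in> LC j" "w \<notin> LC (Suc j)"
  shows "LC j = span (insert w (LC (Suc j)))"
proof -
  obtain B where B: "finite B" "card B = Suc N" "span B = C" using finite_span .
  show ?thesis
  proof (rule span_insert_codim_1[OF B(1)])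
    show "LC j \<subseteq> span B" using LC_properties[of j] B by simp
    show "dim (LC j) = dim (LC (Suc j)) + 1" using dim_LC[of j] dim_LC[of "Suc j"] assms by simp
  qed (use assms LC_properties in auto)
qed

lemma LC_coefficient:
  assumes "2 \<le> j" "j \<le> N" "w \<in> LC j" "w \<notin> LC (Suc j)" "u \<in> LC j"
  shows "\<exists>c. u - c *s w \<in> LC (Suc j)"
  using LC_step[OF assms(1-4)] assms(5) span_breakdown_eq[of u w "LC (Suc j)"]
  by (metis span_eq_iff subspace_LC)

lemma LC_psubset: "2 \<le> j \<Longrightarrow> j \<le> N \<Longrightarrow> \<not> LC j \<subseteq> LC (Suc j)"
proof
  assume "2 \<le> j" "j \<le> N" "LC j \<subseteq> LC (Suc j)"
  then have "LC j = LC (Suc j)" using LC_antimono[of j "Suc j"] by auto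
  then show False using dim_LC[of j] dim_LC[of "Suc j"] \<open>2 \<le> j\<close> \<open>j \<le> N\<close> by simp
qed

lemma LC_top: "LC j = {0}" if "j > N"
proof -
  obtain B where B: "finite B" "card B = Suc N" "span B = C" using finite_span .
  obtain T where T: "T \<subseteq> LC (Suc N)" "independent T" "LC (Suc N) \<subseteq> span T" "card T = dim (LC (Suc N))"
    using basis_exists by blast
  have "finite T" using independent_span_bound[OF B(1) T(2)] B T(1) LC_properties by auto
  moreover have "card T = 0" using T(4) dim_LC[of "Suc N"] N by simp
  ultimately have "LC (Suc N) \<subseteq> {0}" using T(3) by simp
  then have "LC j \<subseteq> {0}" using LC_antimono[of "Suc N" j] that by auto
  then show ?thesis using subspace_0[OF subspace_LC[of j]] by auto
qed

definition generators :: "'a \<Rightarrow> 'a \<Rightarrow> bool" where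
  "generators x y \<longleftrightarrow> x \<in> C \<and> y \<in> C \<and> C \<subseteq> span (insert x (insert y (LC 2)))"

text \<open>Modulo \<open>LC (j + 2)\<close> only the products of \<open>w\<close> with the two
  generators matter: replacing \<open>w\<close> by an element of \<open>LC (Suc j)\<close>, or a
  generator by an element of \<open>LC 2\<close>, gains one more weight.\<close>

lemma generators_bracket:
  assumes g: "generators x y" and j: "2 \<le> j" "j \<le> N" and w: "w \<in> LC j" "w \<notin> LC (Suc j)"
    and U: "subspace U" "LC (j + 2) \<subseteq> U" "w \<star> x \<in> U" "w \<star> y \<in> U"
  shows "LC (Suc j) \<subseteq> U"
proof -
  have "u \<star> v \<in> U" if "u \<in> LC j" "v \<in> C" for u v
  proof (rule bracket_span)
    show "u \<in> span (insert w (LC (Suc j)))" using LC_step[OF j w] that by simp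
    show "v \<in> span (insert x (insert y (LC 2)))" using g that unfolding generators_def by auto
    show "insert w (LC (Suc j)) \<subseteq> C" "insert x (insert y (LC 2)) \<subseteq> C"
      using w g LC_closed unfolding generators_def by auto
    fix s t assume s: "s \<in> insert w (LC (Suc j))" and t: "t \<in> insert x (insert y (LC 2))"
    have "s \<star> t \<in> LC (j + 2)" if "t \<in> LC 2"
      using bracket_LC[of j 2 s t] s w that j LC_mono[of j "Suc j"] by auto
    moreover have "s \<star> t \<in> LC (j + 2)" if "s \<in> LC (Suc j)" "t \<in> {x, y}"
      using bracket_LC_left[of s "Suc j" t] that g unfolding generators_def by auto
    ultimately show "s \<star> t \<in> U" using U s t by auto
  qed (rule U)
  then show ?thesis
    using LC_Suc[of j] j span_minimal[OF _ U(1), of "{x \<star> y |x y. x \<in> LC j \<and> y \<in> C}"] by auto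
qed

lemma generators_step:
  assumes "generators x y" and j: "2 \<le> j" "j < N" and w: "w \<in> LC j" "w \<notin> LC (Suc j)"
  shows "w \<star> x \<notin> LC (j + 2) \<or> w \<star> y \<notin> LC (j + 2)"
proof (rule ccontr)
  assume "\<not> ?thesis"
  then have "LC (Suc j) \<subseteq> LC (j + 2)"
    using assms by (intro generators_bracket[of x y j w]) auto
  then show False using LC_psubset[of "Suc j"] j by simp
qed

lemma generators_bracket_2:
  assumes g: "generators x y"
    and U: "subspace U" "LC 3 \<subseteq> U" "x \<star> x \<in> U" "x \<star> y \<in> U" "y \<star> x \<in> U" "y \<star> y \<in> U"
  shows "LC 2 \<subseteq> U"
proof -
  have "u \<star> v \<in> U" if "u \<in> C" "v \<in> C" for u v
  proof (rule bracket_span)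
    let ?S = "insert x (insert y (LC 2))"
    show "u \<in> span ?S" "v \<in> span ?S" using g that unfolding generators_def by auto
    show "?S \<subseteq> C" "?S \<subseteq> C"
      using g LC_closed unfolding generators_def by auto
    fix s t assume s: "s \<in> ?S" and t: "t \<in> ?S"
    have C: "s \<in> C" "t \<in> C" using s t \<open>?S \<subseteq> C\<close> by auto
    have "s \<star> t \<in> LC 3" if "t \<in> LC 2"
      using bracket_LC[of 1 2 s t] that C by (simp add: numeral_3_eq_3)
    moreover have "s \<star> t \<in> LC 3" if "s \<in> LC 2"
      using bracket_LC_left[of s 2 t] that C by (simp add: numeral_3_eq_3)
    ultimately show "s \<star> t \<in> U" using U s t by auto
  qed (rule U)
  then show ?thesis
    using LC_Suc[of 1] span_minimal[OF _ U(1), of "{x \<star> y |x y. x \<in> C \<and> y \<in> C}"]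
    by (auto simp: numeral_2_eq_2)
qed

definition adapted :: "'a \<Rightarrow> (nat \<Rightarrow> 'a) \<Rightarrow> bool" where
  "adapted x z \<longleftrightarrow> generators x (z 1) \<and>
    (\<forall>j. 2 \<le> j \<and> j \<le> N \<longrightarrow> z j \<in> LC j \<and> z j \<notin> LC (Suc j))"

definition elt :: "'a \<Rightarrow> (nat \<Rightarrow> 'a) \<Rightarrow> nat \<Rightarrow> 'a" where
  "elt x z p = (if p = 0 then x else z p)"

lemma elt_simps [simp]: "elt x z 0 = x" "p \<ge> 1 \<Longrightarrow> elt x z p = z p" "elt x z (Suc p) = z (Suc p)"
  by (auto simp: elt_def)

definition lead :: "(nat \<Rightarrow> 'a) \<Rightarrow> nat \<Rightarrow> 'a \<Rightarrow> 'k \<Rightarrow> bool" where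
  "lead z j u c \<longleftrightarrow> u \<in> C \<and> u - c *s z j \<in> LC (Suc j)"

text \<open>A structure constant of the associated graded algebra. For
  \<open>weight p + weight q \<le> N\<close> the choice is pinned down by \<open>lead_ex\<close> and
  \<open>lead_unique\<close>.\<close>

definition const :: "'a \<Rightarrow> (nat \<Rightarrow> 'a) \<Rightarrow> nat \<Rightarrow> nat \<Rightarrow> 'k" where
  "const x z p q = (SOME c. lead z (weight p + weight q) (elt x z p \<star> elt x z q) c)"

context
  fixes x z assumes ad: "adapted x z"
begin

lemma adapted_LC: "2 \<le> j \<Longrightarrow> j \<le> N \<Longrightarrow> z j \<in> LC j"
  and adapted_notin: "2 \<le> j \<Longrightarrow> j \<le> N \<Longrightarrow> z j \<notin> LC (Suc j)"
  and adapted_generators: "generators x (z 1)"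
  using ad unfolding adapted_def by auto

lemma elt_LC: "p \<le> N \<Longrightarrow> elt x z p \<in> LC (weight p)"
  using adapted_generators adapted_LC[of p]
  by (cases "p \<le> 1") (auto simp: generators_def elt_def weight_def le_Suc_eq)

lemma elt_closed: "p \<le> N \<Longrightarrow> elt x z p \<in> C"
  using elt_LC LC_closed by blast

lemma adapted_closed: "1 \<le> j \<Longrightarrow> j \<le> N \<Longrightarrow> z j \<in> C"
  using elt_closed[of j] by simp

lemma LC_span_adapted: "2 \<le> j \<Longrightarrow> j \<le> Suc N \<Longrightarrow> LC j = span (z ` {j..N})"
proof (induction "Suc N - j" arbitrary: j)
  case 0
  then show ?case using LC_top[of j] by simp
next
  case (Suc m)
  then have IH: "LC (Suc j) = span (z ` {Suc j..N})" by simp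
  have j: "j \<le> N" using Suc by simp
  have "LC j = span (insert (z j) (span (z ` {Suc j..N})))"
    using LC_step[of j "z j"] adapted_LC[of j] adapted_notin[of j] Suc j unfolding IH by blast
  also have "\<dots> = span (insert (z j) (z ` {Suc j..N}))"
    by (simp add: span_insert span_span)
  also have "insert (z j) (z ` {Suc j..N}) = z ` {j..N}"
    using j by (auto simp: image_iff) (metis atLeastAtMost_iff le_antisym not_less_eq_eq)
  finally show ?case .
qed

lemma carrier_span_adapted: "C = span (insert x (z ` {1..N}))"
proof
  have *: "z ` {2..N} \<subseteq> z ` {1..N}" by auto
  have "insert x (insert (z 1) (LC 2)) \<subseteq> span (insert x (z ` {1..N}))"
    using LC_span_adapted[of 2] N span_mono[of "z ` {2..N}" "insert x (z ` {1..N})"] *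
    by (auto intro: span_base)
  then show "C \<subseteq> span (insert x (z ` {1..N}))"
    using adapted_generators span_minimal unfolding generators_def by blast
  show "span (insert x (z ` {1..N})) \<subseteq> C"
    using adapted_closed adapted_generators unfolding generators_def by (intro span_closed) auto
qed

lemma lead_ex:
  assumes "2 \<le> j" "j \<le> N" "u \<in> LC j"
  shows "\<exists>c. lead z j u c"
  using LC_coefficient[of j "z j" u] adapted_LC adapted_notin assms LC_closed unfolding lead_def by auto

lemma lead_unique:
  assumes "2 \<le> j" "j \<le> N" "lead z j u c" "lead z j u c'"
  shows "c = c'"
proof (rule ccontr)
  assume ne: "c \<noteq> c'"
  have "(u - c *s z j) - (u - c' *s z j) \<in> LC (Suc j)"
    using assms(3,4) subspace_diff[OF subspace_LC] unfolding lead_def by blast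
  then have "(c' - c) *s z j \<in> LC (Suc j)" by (simp add: scale_left_diff_distrib)
  then have "inverse (c' - c) *s ((c' - c) *s z j) \<in> LC (Suc j)"
    by (rule subspace_scale[OF subspace_LC])
  then show False using ne adapted_notin assms by simp
qed

lemma lead_diff: "lead z j u c \<Longrightarrow> lead z j v d \<Longrightarrow> lead z j (u - v) (c - d)"
  unfolding lead_def
  using subspace_diff[OF subspace_LC, of "u - c *s z j" "Suc j" "v - d *s z j"]
  by (simp add: scale_left_diff_distrib algebra_simps)

lemma lead_0_iff: "lead z j u 0 \<longleftrightarrow> u \<in> LC (Suc j)"
  unfolding lead_def using LC_closed by auto

lemma lead_const:
  assumes "weight p + weight q \<le> N"
  shows "lead z (weight p + weight q) (elt x z p \<star> elt x z q) (const x z p q)"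
proof -
  have pq: "p \<le> N" "q \<le> N" using assms by (auto simp: weight_def split: if_splits)
  have "2 \<le> weight p + weight q" by simp
  moreover have "elt x z p \<star> elt x z q \<in> LC (weight p + weight q)"
    using elt_LC pq by (intro bracket_LC) auto
  ultimately show ?thesis
    unfolding const_def using lead_ex assms by (blast intro: someI_ex)
qed

lemma lead_trans:
  assumes "lead z j u c" "v - d *s u \<in> LC (Suc j)" "v \<in> C"
  shows "lead z j v (d * c)"
proof -
  have "(v - d *s u) + d *s (u - c *s z j) \<in> LC (Suc j)"
    using assms unfolding lead_def by (intro subspace_add subspace_scale) auto
  then show ?thesis using assms(3) unfolding lead_def by (simp add: scale_right_diff_distrib)
qed

text \<open>The error \<open>u - c *s z b\<close> has weight at least \<open>b + 1\<close>, so its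
  products with basis elements disappear at leading order. This is what makes the constants multiply
  as in an algebra.\<close>

lemma lead_bracket:
  assumes "2 \<le> b" "weight p + b \<le> N" "lead z b u c"
  shows "lead z (weight p + b) (elt x z p \<star> u) (c * const x z p b)"
    and "lead z (b + weight p) (u \<star> elt x z p) (c * const x z b p)"
proof -
  have p: "p \<le> N" and b: "b \<le> N" using assms weight_ge_1[of p] by (auto simp: weight_def split: if_splits)
  have C: "u \<in> C" "z b \<in> C" "elt x z p \<in> C" using assms adapted_closed elt_closed p b by (auto simp: lead_def)
  let ?t = "u - c *s z b"
  have t: "?t \<in> LC (Suc b)" using assms by (simp add: lead_def)
  have w: "weight b = b" "elt x z b = z b" using assms by auto
  have "elt x z p \<star> u - c *s (elt x z p \<star> z b) = elt x z p \<star> ?t"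
    using C by (simp add: bracket_simps)
  also have "\<dots> \<in> LC (weight p + Suc b)" using elt_LC[OF p] t by (intro bracket_LC) auto
  finally show "lead z (weight p + b) (elt x z p \<star> u) (c * const x z p b)"
    using lead_trans[of "weight p + b" "elt x z p \<star> z b" "const x z p b" "elt x z p \<star> u" c]
      lead_const[of p b] assms w C by simp
  have "u \<star> elt x z p - c *s (z b \<star> elt x z p) = ?t \<star> elt x z p"
    using C by (simp add: bracket_simps)
  also have "\<dots> \<in> LC (Suc b + weight p)" using elt_LC[OF p] t by (intro bracket_LC) auto
  finally show "lead z (b + weight p) (u \<star> elt x z p) (c * const x z b p)"
    using lead_trans[of "b + weight p" "z b \<star> elt x z p" "const x z b p" "u \<star> elt x z p" c]
      lead_const[of b p] assms w C by (simp add: add.commute)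
qed

lemma const_leibniz:
  assumes "weight p + weight q + weight r \<le> N"
  shows "const x z q r * const x z p (weight q + weight r)
    = const x z p q * const x z (weight p + weight q) r
      - const x z p r * const x z (weight p + weight r) q"
proof -
  let ?e = "elt x z" and ?P = "const x z"
  have w: "1 \<le> weight p" "1 \<le> weight q" "1 \<le> weight r" by auto
  have C: "?e p \<in> C" "?e q \<in> C" "?e r \<in> C"
  proof -
    have "p \<le> N" "q \<le> N" "r \<le> N"
      using assms by (auto simp: weight_def split: if_splits)
    then show "?e p \<in> C" "?e q \<in> C" "?e r \<in> C" by (auto intro: elt_closed)
  qed
  have "lead z (weight p + (weight q + weight r)) (?e p \<star> (?e q \<star> ?e r))
      (?P q r * ?P p (weight q + weight r))"
    using assms w by (intro lead_bracket(1) lead_const) auto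
  moreover have "lead z (weight p + weight q + weight r) ((?e p \<star> ?e q) \<star> ?e r)
      (?P p q * ?P (weight p + weight q) r)"
    using assms w by (intro lead_bracket(2) lead_const) auto
  moreover have "lead z (weight p + weight r + weight q) ((?e p \<star> ?e r) \<star> ?e q)
      (?P p r * ?P (weight p + weight r) q)"
    using assms w by (intro lead_bracket(2) lead_const) auto
  ultimately show ?thesis
    using leibniz_identity[OF C] assms w
      lead_diff[of "weight p + weight q + weight r" "(?e p \<star> ?e q) \<star> ?e r" _ "(?e p \<star> ?e r) \<star> ?e q"]
    by (intro lead_unique[of "weight p + weight q + weight r" "?e p \<star> (?e q \<star> ?e r)"])
      (auto simp: ac_simps)
qed

lemma const_eq_0_iff:
  assumes "weight p + weight q \<le> N"
  shows "const x z p q = 0 \<longleftrightarrow> elt x z p \<star> elt x z q \<in> LC (Suc (weight p + weight q))"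
proof -
  show ?thesis
    using lead_const[OF assms] lead_unique[of "weight p + weight q" "elt x z p \<star> elt x z q"] assms
    by (metis lead_0_iff weight_add_ge_2(1))
qed

lemma const_eqI:
  assumes "weight p + weight q \<le> N" "lead z (weight p + weight q) (elt x z p \<star> elt x z q) c"
  shows "const x z p q = c"
proof -
  show ?thesis
    using lead_const[OF assms(1)] lead_unique[OF weight_add_ge_2(1)] assms by blast
qed

lemma graded_constants_const:
  assumes "z 2 \<star> x \<notin> LC 4" "z 2 \<star> z 1 \<in> LC 4"
  shows "graded_constants N (const x z)"
proof
  note iff = const_eq_0_iff
  show "3 \<le> N" by (rule N)
  show "const x z 2 0 \<noteq> 0" "const x z 2 1 = 0"
    using assms iff[of 2 0] iff[of 2 1] N by (auto simp: eval_nat_numeral)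
  show "const x z i 0 \<noteq> 0 \<or> const x z i 1 \<noteq> 0" if i: "2 \<le> i" "i < N" for i
    using generators_step[OF adapted_generators i adapted_LC adapted_notin] iff[of i 0] iff[of i 1] i
    by auto
  show "const x z 0 0 \<noteq> 0 \<or> const x z 0 1 \<noteq> 0 \<or> const x z 1 0 \<noteq> 0 \<or> const x z 1 1 \<noteq> 0"
  proof (rule ccontr)
    assume "\<not> ?thesis"
    then have "LC 2 \<subseteq> LC 3"
      using iff[of 0 0] iff[of 0 1] iff[of 1 0] iff[of 1 1] N adapted_generators
      by (intro generators_bracket_2[of x "z 1"]) (auto simp: eval_nat_numeral)
    then show False using LC_psubset[of 2] N by (simp add: eval_nat_numeral)
  qed
qed (rule const_leibniz)

end

end

context filiform_algebra
begin

lemma adapted_frame: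
  assumes "adapted x z"
  shows "frame (Suc N) (\<lambda>i. if i = 1 then x else z (i - 1))"
proof -
  let ?e = "\<lambda>i. if i = 1 then x else z (i - 1)"
  have "?e ` {1..Suc N} = insert x (z ` {1..N})" (is "?A = ?B")
  proof
    have "?e i \<in> ?B" if "i \<in> {1..Suc N}" for i
    proof (cases "i = 1")
      case False
      then have "i - 1 \<in> {1..N}" using that by auto
      then show ?thesis using False by (metis imageI insertI2)
    qed simp
    then show "?A \<subseteq> ?B" by blast
    have "z j \<in> ?A" if "j \<in> {1..N}" for j
      using that by (intro image_eqI[of _ _ "Suc j"]) auto
    moreover have "x \<in> ?A" by (intro image_eqI[of _ _ 1]) auto
    ultimately show "?B \<subseteq> ?A" by blast
  qed
  then show ?thesis
    using carrier_span_adapted[OF assms] has_dim span_superset[of "insert x (z ` {1..N})"]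
    unfolding frame_def by simp
qed

lemma adapted_nonzero:
  assumes "adapted x z"
  shows "x \<noteq> 0" "1 \<le> j \<Longrightarrow> j \<le> N \<Longrightarrow> z j \<noteq> 0"
  using frame_nonzero[OF adapted_frame[OF assms], of 1] frame_nonzero[OF adapted_frame[OF assms], of "Suc j"]
  by auto

end

section \<open>Homogeneous bases adapted to the lower central series\<close>

locale graded_filiform = filiform_algebra +
  fixes V :: "int \<Rightarrow> 'b set" and k l :: int
  assumes grad: "gradation L V" and conn: "connected_between V k l" and len: "l - k + 1 = int N"
    and alg_length: "alg_length L = int N"
begin

lemmas V_subspace = gradation_subspace[OF grad]
  and V_closed = gradation_closed[OF grad]
  and V_bracket = gradation_bracket[OF grad]

lemma ex_homogeneous:
  assumes "j \<ge> 1" "\<not> LC j \<subseteq> U" "subspace U"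
  shows "\<exists>h i. h \<in> LC j \<and> h \<in> V i \<and> h \<notin> U"
proof (rule ccontr)
  assume "\<not> ?thesis"
  then have "LC j \<inter> (\<Union>i. V i) \<subseteq> U" by auto
  then have "LC j \<subseteq> U" using LC_span_homogeneous[OF grad assms(1)] span_minimal[OF _ assms(3)] by metis
  then show False using assms(2) by simp
qed

text \<open>With different degrees, \<open>u\<close> would be a homogeneous component of
  \<open>u - t *s v\<close>; since \<open>LC j\<close> is a graded subspace it would contain
  \<open>u\<close>.\<close>

lemma homogeneous_congruent:
  assumes "j \<ge> 1" "u \<in> V e" "v \<in> V e'" "u - t *s v \<in> LC j" "u \<notin> LC j"
  shows "e = e'"
proof (rule ccontr)
  assume ne: "e \<noteq> e'"
  let ?H = "LC j \<inter> (\<Union>i. V i)"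
  have "u - t *s v = (- t) *s v + u" by simp
  then have "component V e (u - t *s v) = u"
    using component_lincomb[OF grad V_closed[OF assms(3)] V_closed[OF assms(2)], of e "- t"]
      component_homogeneous[OF grad assms(2), of e] component_homogeneous[OF grad assms(3), of e] ne
    by simp
  moreover have "component V e (u - t *s v) \<in> span (?H \<inter> V e)"
    using component_in_span[OF grad, of ?H] LC_span_homogeneous[OF grad assms(1)] assms(4) by blast
  moreover have "span (?H \<inter> V e) \<subseteq> LC j"
    by (rule span_minimal) auto
  ultimately show False using assms(5) by auto
qed

text \<open>Right multiplication from \<open>LC 2\<close> modulo \<open>LC 3\<close> to
  \<open>LC 3\<close> modulo \<open>LC 4\<close> is a map between lines, hence a linear functional
  on the generators modulo \<open>LC 2\<close>: \<open>y\<close> lies in its kernel and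
  \<open>x\<close> does not. The quantifiers over \<open>LC 2\<close> avoid fixing
  \<open>z 2\<close> at this stage.\<close>

definition good :: "'b \<Rightarrow> 'b \<Rightarrow> int \<Rightarrow> int \<Rightarrow> bool" where
  "good x y a b \<longleftrightarrow> generators x y \<and> x \<in> V a \<and> y \<in> V b \<and>
    (\<exists>w\<in>LC 2. w \<star> x \<notin> LC 4) \<and> (\<forall>w\<in>LC 2. w \<star> y \<in> LC 4)"

lemma ex_generators: "\<exists>x y a b. generators x y \<and> x \<in> V a \<and> y \<in> V b"
proof -
  obtain B where B: "finite B" "card B = Suc N" "span B = C" using finite_span .
  obtain T where T: "T \<subseteq> LC 2" "independent T" "LC 2 \<subseteq> span T" "card T = dim (LC 2)"
    using basis_exists by blast
  have sT: "span T = LC 2" using T span_subspace[OF T(1,3)] by simp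
  have cT: "card T = N - 1" using T(4) dim_LC[of 2] N by simp
  have fT: "finite T"
    using independent_span_bound[OF B(1) T(2)] B T(1) LC_closed by blast
  have big: "\<not> C \<subseteq> span S" if "finite S" "card S \<le> N" for S
    using dim_le_card[of C S] that has_dimension_dim[OF has_dim] by auto
  obtain x a where x: "x \<in> V a" "x \<notin> span T"
    using ex_homogeneous[of 1 "span T"] big[OF fT] cT by auto
  have xT: "card (insert x T) = N" using fT cT x N span_base[of x T] by (subst card_insert_disjoint) auto
  obtain y b where y: "y \<in> V b" "y \<notin> span (insert x T)"
    using ex_homogeneous[of 1 "span (insert x T)"] big[of "insert x T"] fT xT by auto
  have yT: "y \<notin> insert x T" using y span_base by blast
  have "C \<subseteq> span (insert y (insert x T))"
  proof (rule spans_of_card_eq_dim[OF B(1)])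
    show "C \<subseteq> span B" using B by simp
    show "insert y (insert x T) \<subseteq> C" using x y T(1) LC_closed V_closed by blast
    show "independent (insert y (insert x T))"
      using x y T(2) by (simp add: independent_insertI)
    show "card (insert y (insert x T)) = dim C"
      using yT fT xT has_dimension_dim[OF has_dim] by simp
  qed
  also have "\<dots> \<subseteq> span (insert x (insert y (LC 2)))"
    by (rule span_mono) (use T(1) in auto)
  finally have "generators x y" unfolding generators_def using x y V_closed by blast
  then show ?thesis using x y by blast
qed

lemma generators_swap: "generators x y \<longleftrightarrow> generators y x"
  unfolding generators_def by (auto simp: insert_commute)

lemma generators_shear:
  assumes "generators x y"
  shows "generators (x - t *s y) y"
proof -
  let ?S = "insert (x - t *s y) (insert y (LC 2))"
  have "(x - t *s y) + t *s y \<in> span ?S"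
    by (intro span_add span_scale) (auto intro: span_base)
  then have "insert x (insert y (LC 2)) \<subseteq> span ?S" by (auto intro: span_base)
  then have "C \<subseteq> span ?S" using assms span_minimal unfolding generators_def by blast
  then show ?thesis using assms unfolding generators_def by simp
qed

lemma bracket_LC_2_iff:
  assumes w: "w \<in> LC 2" "w \<notin> LC 3" and y: "y \<in> C"
  shows "w \<star> y \<in> LC 4 \<longleftrightarrow> (\<forall>v\<in>LC 2. v \<star> y \<in> LC 4)"
proof
  assume wy: "w \<star> y \<in> LC 4"
  show "\<forall>v\<in>LC 2. v \<star> y \<in> LC 4"
  proof
    fix v assume v: "v \<in> LC 2"
    obtain c where c: "v - c *s w \<in> LC 3"
      using LC_coefficient[of 2 w v] w v N by (auto simp: numeral_3_eq_3)
    have "v \<in> C" "w \<in> C" using v w LC_closed by auto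
    then have "v \<star> y = (v - c *s w) \<star> y + c *s (w \<star> y)" using y by (simp add: bracket_simps)
    moreover have "(v - c *s w) \<star> y \<in> LC 4"
      using bracket_LC_left[OF c _ y] by (simp add: eval_nat_numeral)
    ultimately show "v \<star> y \<in> LC 4" using wy by (simp add: subspace_add subspace_scale)
  qed
qed (use w in blast)

lemma ex_good: "\<exists>x y a b. good x y a b"
proof -
  obtain x y a b where g: "generators x y" "x \<in> V a" "y \<in> V b" using ex_generators by blast
  obtain w e where w: "w \<in> LC 2" "w \<in> V e" "w \<notin> LC 3"
    using ex_homogeneous[of 2 "LC 3"] LC_psubset[of 2] N by (auto simp: numeral_3_eq_3)
  have C: "x \<in> C" "y \<in> C" "w \<in> C" using g w LC_closed unfolding generators_def by auto
  have goodI: "\<exists>x y a b. good x y a b"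
    if "generators x y" "x \<in> V a" "y \<in> V b" "w \<star> x \<notin> LC 4" "w \<star> y \<in> LC 4" for x y a b
    using that bracket_LC_2_iff[OF w(1,3)] V_closed w(1) unfolding good_def by blast
  consider "w \<star> x \<notin> LC 4" "w \<star> y \<in> LC 4" | "w \<star> y \<notin> LC 4" "w \<star> x \<in> LC 4"
    | "w \<star> y \<notin> LC 4" "w \<star> x \<notin> LC 4"
    using generators_step[OF g(1), of 2 w] w N by (auto simp: eval_nat_numeral)
  then show ?thesis
  proof cases
    case 1
    then show ?thesis using goodI g by blast
  next
    case 2
    then show ?thesis using goodI[of y x] g generators_swap by blast
  next
    case 3
    have "w \<star> y \<in> LC 3" "w \<star> x \<in> LC 3"
      using bracket_LC_left[OF w(1)] C by (auto simp: eval_nat_numeral)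
    then obtain t where t: "w \<star> y - t *s (w \<star> x) \<in> LC 4"
      using LC_coefficient[of 3 "w \<star> x" "w \<star> y"] 3 N by (auto simp: eval_nat_numeral)
    \<comment> \<open>The correction \<open>y - t *s x\<close> is homogeneous because the congruence
      itself forces equal degrees.\<close>
    have "e + b = e + a"
      using homogeneous_congruent[OF _ V_bracket[OF w(2) g(3)] V_bracket[OF w(2) g(2)] t] 3 by simp
    then have "y - t *s x \<in> V a" using g V_subspace by (simp add: subspace_diff subspace_scale)
    moreover have "generators x (y - t *s x)" using g generators_shear generators_swap by blast
    moreover have "w \<star> (y - t *s x) \<in> LC 4" using t C by (simp add: bracket_simps)
    ultimately show ?thesis using goodI g 3 by blast
  qed
qed

definition hadapted :: "'b \<Rightarrow> (nat \<Rightarrow> 'b) \<Rightarrow> int \<Rightarrow> (nat \<Rightarrow> int) \<Rightarrow> bool" where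
  "hadapted x z a d \<longleftrightarrow> adapted x z \<and> x \<in> V a \<and> (\<forall>j. 1 \<le> j \<and> j \<le> N \<longrightarrow> z j \<in> V (d j))"

text \<open>
  The normalisation \<open>z\<^sub>j\<^sub>+\<^sub>1 = [z\<^sub>j, x]\<close> whenever possible makes every nonzero structure constant of right
  multiplication by \<open>x\<close> equal to \<open>1\<close>.
\<close>

definition chain :: "'b \<Rightarrow> (nat \<Rightarrow> 'b) \<Rightarrow> bool" where
  "chain x z \<longleftrightarrow>
    (\<forall>j. 1 \<le> j \<and> j < N \<and> z j \<star> x \<notin> LC (j + 2) \<longrightarrow> z (j + 1) = z j \<star> x) \<and>
    (\<forall>j. 2 \<le> j \<and> j < N \<and> z j \<star> x \<in> LC (j + 2) \<longrightarrow> z (j + 1) = z j \<star> z 1) \<and>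
    (z 1 \<star> x \<in> LC 3 \<and> x \<star> x \<notin> LC 3 \<longrightarrow> z 2 = x \<star> x)"

lemma ex_chain:
  assumes "good x y a b"
  shows "\<exists>z d. hadapted x z a d \<and> z 1 = y \<and> d 1 = b \<and> chain x z"
proof -
  have g: "generators x y" "x \<in> V a" "y \<in> V b" using assms unfolding good_def by auto
  have C: "x \<in> C" "y \<in> C" using g unfolding generators_def by auto
  obtain h e where h: "h \<in> LC 2" "h \<in> V e" "h \<notin> LC 3"
    using ex_homogeneous[of 2 "LC 3"] LC_psubset[of 2] N by (auto simp: numeral_3_eq_3)
  \<comment> \<open>The value at 0 only starts the recursion; the sequence proper begins with
    \<open>z 1 = y\<close>. The element \<open>h\<close> is the fallback in weight 2, where
    \<open>y \<star> x\<close> and \<open>x \<star> x\<close> may both vanish modulo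
    \<open>LC 3\<close>. In higher weights \<open>generators_step\<close> guarantees that
    \<open>u \<star> y\<close> survives when \<open>u \<star> x\<close> does not.\<close>
  define z where "z = rec_nat x (\<lambda>j u. if j = 0 then y
    else if u \<star> x \<notin> LC (j + 2) then u \<star> x
    else if j = 1 then (if x \<star> x \<notin> LC 3 then x \<star> x else h) else u \<star> y)"
  have z1: "z 1 = y" by (simp add: z_def)
  have zS: "z (Suc j) = (if z j \<star> x \<notin> LC (j + 2) then z j \<star> x
    else if j = 1 then (if x \<star> x \<notin> LC 3 then x \<star> x else h) else z j \<star> y)" if "j \<ge> 1" for j
    using that by (simp add: z_def)
  have sq: "u \<star> v \<in> LC 2" if "u \<in> C" "v \<in> C" for u v
    using bracket_LC_left[of u 1 v] that by (simp add: numeral_2_eq_2)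
  have z2: "z 2 \<in> LC 2 \<and> z 2 \<notin> LC 3 \<and> (\<exists>i. z 2 \<in> V i)"
    using zS[of 1] z1 sq C h V_bracket[OF g(2,2)] V_bracket[OF g(3,2)]
    by (auto simp: numeral_2_eq_2 numeral_3_eq_3)
  have z: "z j \<in> LC j \<and> z j \<notin> LC (Suc j) \<and> (\<exists>i. z j \<in> V i)" if "2 \<le> j" "j \<le> N" for j
    using that
  proof (induction j rule: dec_induct)
    case base
    then show ?case using z2 by (simp add: numeral_3_eq_3 numeral_2_eq_2)
  next
    case (step j)
    then obtain i where IH: "z j \<in> LC j" "z j \<notin> LC (Suc j)" "z j \<in> V i" by auto
    have "z j \<star> x \<in> LC (Suc j)" "z j \<star> y \<in> LC (Suc j)"
      using bracket_LC_left IH C step by auto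
    moreover have "z j \<star> x \<in> V (i + a)" "z j \<star> y \<in> V (i + b)" using V_bracket IH g by auto
    moreover have "z j \<star> x \<notin> LC (j + 2) \<or> z j \<star> y \<notin> LC (j + 2)"
      using generators_step[OF g(1) _ _ IH(1,2)] step by auto
    ultimately show ?case using zS[of j] step by auto
  qed
  have "\<forall>j. \<exists>i. 1 \<le> j \<and> j \<le> N \<longrightarrow> z j \<in> V i \<and> (j = 1 \<longrightarrow> i = b)"
  proof
    fix j show "\<exists>i. 1 \<le> j \<and> j \<le> N \<longrightarrow> z j \<in> V i \<and> (j = 1 \<longrightarrow> i = b)"
      using z[of j] z1 g by (cases "j = 1") auto
  qed
  then obtain d where d: "\<And>j. 1 \<le> j \<Longrightarrow> j \<le> N \<Longrightarrow> z j \<in> V (d j) \<and> (j = 1 \<longrightarrow> d j = b)"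
    by metis
  have "hadapted x z a d"
    unfolding hadapted_def adapted_def using g d z z1 by auto
  moreover have "chain x z"
    unfolding chain_def using zS z1 zS[of 1] by (auto simp: numeral_2_eq_2 numeral_3_eq_3)
  ultimately show ?thesis using z1 d[of 1] N by auto
qed

context
  fixes x z a d
  assumes had: "hadapted x z a d"
begin

lemma hadapted_adapted: "adapted x z"
  and hadapted_x: "x \<in> V a"
  and hadapted_z: "1 \<le> j \<Longrightarrow> j \<le> N \<Longrightarrow> z j \<in> V (d j)"
  using had unfolding hadapted_def by auto

lemma degree_unique: "1 \<le> j \<Longrightarrow> j \<le> N \<Longrightarrow> z j \<in> V e \<Longrightarrow> d j = e"
  using homogeneous_spaces_disjoint[OF grad hadapted_z] adapted_nonzero(2)[OF hadapted_adapted] by blast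

lemma degrees: "{k..l} = insert a (d ` {1..N})"
proof -
  let ?S = "insert x (z ` {1..N})"
  have S: "?S \<subseteq> (\<Union>i. V i)" using hadapted_x hadapted_z atLeastAtMost_iff by blast
  have "V i \<noteq> {0} \<longleftrightarrow> i \<in> insert a (d ` {1..N})" for i
  proof
    assume "V i \<noteq> {0}"
    then obtain v where v: "v \<in> V i" "v \<noteq> 0" using subspace_0[OF V_subspace] by blast
    have "v \<in> span ?S" using V_closed[OF v(1)] carrier_span_adapted[OF hadapted_adapted] by simp
    then have "v \<in> span (?S \<inter> V i)" using homogeneous_in_span[OF grad S] v by blast
    then have "?S \<inter> V i \<noteq> {}" using v by auto
    then consider "x \<in> V i" | j where "j \<in> {1..N}" "z j \<in> V i" by blast
    then show "i \<in> insert a (d ` {1..N})"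
    proof cases
      case 1
      then have "a = i"
        using homogeneous_spaces_disjoint[OF grad hadapted_x] adapted_nonzero(1)[OF hadapted_adapted] by blast
      then show ?thesis by simp
    next
      case (2 j)
      then have "d j = i" using degree_unique by simp
      then show ?thesis using 2 by auto
    qed
  next
    assume "i \<in> insert a (d ` {1..N})"
    then consider "i = a" | j where "j \<in> {1..N}" "i = d j" by blast
    then show "V i \<noteq> {0}"
    proof cases
      case 1
      then show ?thesis using hadapted_x adapted_nonzero(1)[OF hadapted_adapted] by auto
    next
      case (2 j)
      then show ?thesis using hadapted_z[of j] adapted_nonzero(2)[OF hadapted_adapted, of j] by auto
    qed
  qed
  then show ?thesis using conn unfolding connected_between_def by auto
qed

text \<open>Weight and degree are intersected: \<open>LC j\<close> is spanned by the homogeneous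
  \<open>z m\<close> with \<open>m \<ge> j\<close>, so projecting to degree \<open>e\<close> keeps
  only those with \<open>d m = e\<close>. Congruences modulo the lower central series become
  equations in this way.\<close>

lemma locate:
  assumes "2 \<le> j" "v \<in> LC j" "v \<in> V e"
  shows "v \<in> span (z ` {m \<in> {j..N}. d m = e})"
proof (cases "j \<le> Suc N")
  case True
  have "v \<in> span (z ` {j..N} \<inter> V e)"
  proof (rule homogeneous_in_span[OF grad])
    have "m \<ge> 1" if "m \<in> {j..N}" for m using that assms(1) by simp
    then show "z ` {j..N} \<subseteq> (\<Union>i. V i)" using hadapted_z by fastforce
    show "v \<in> span (z ` {j..N})"
      using assms LC_span_adapted[OF hadapted_adapted _ True] by simp
  qed (use assms in simp)
  moreover have "z ` {j..N} \<inter> V e \<subseteq> z ` {m \<in> {j..N}. d m = e}"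
    using degree_unique assms(1) by auto
  ultimately show ?thesis using span_mono by blast
next
  case False
  then have "v = 0" using LC_top[of j] assms by auto
  then show ?thesis by (simp add: span_zero)
qed

lemma locate_zero:
  assumes "2 \<le> j" "v \<in> LC j" "v \<in> V e" "\<And>m. j \<le> m \<Longrightarrow> m \<le> N \<Longrightarrow> d m \<noteq> e"
  shows "v = 0"
proof -
  have "{m \<in> {j..N}. d m = e} = {}" using assms(4) by auto
  then show ?thesis using locate[OF assms(1-3)] by (metis image_empty span_empty singletonD)
qed

lemma locate_one:
  assumes "2 \<le> j" "v \<in> LC j" "v \<in> V e" "\<And>m. j \<le> m \<Longrightarrow> m \<le> N \<Longrightarrow> d m = e \<Longrightarrow> m = m0"
  shows "\<exists>c. v = c *s z m0"
proof -
  have "z ` {m \<in> {j..N}. d m = e} \<subseteq> {z m0}" using assms(4) by auto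
  then have "v \<in> span {z m0}" using locate[OF assms(1-3)] span_mono by blast
  then show ?thesis by (auto simp: span_singleton)
qed

end

end

section \<open>The algebras of dimension at least four\<close>

text \<open>Step 0 would leave at most two degrees. Otherwise the \<open>N\<close> terms of the
  progression are distinct and already fill the interval; it contains \<open>b\<close> and
  \<open>b + a\<close>, hence \<open>b + 1\<close>, so \<open>a\<close> divides 1.\<close>

lemma interval_progression:
  fixes a b e k l :: int
  assumes eq: "{k..l} = insert e ((\<lambda>i. b + (int i - 1) * a) ` {1..N})"
    and len: "l - k + 1 = int N" and N: "N \<ge> 3" and a: "a \<ge> 0"
  shows "a = 1" "b \<le> e" "e \<le> b + int N - 1"
proof -
  let ?d = "\<lambda>i. b + (int i - 1) * a"
  have card: "card {k..l} = N" using len by simp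
  have a0: "a \<noteq> 0"
  proof
    assume "a = 0"
    then have "{k..l} \<subseteq> {e, b}" using eq by auto
    then have "card {k..l} \<le> 2" using card_mono[of "{e, b}" "{k..l}"] card_insert_le_m1[of 2 "{b}" e] by simp
    then show False using card N by simp
  qed
  have "inj_on ?d {1..N}" using a0 by (auto intro!: inj_onI)
  then have "card (?d ` {1..N}) = N" by (simp add: card_image)
  then have eq2: "?d ` {1..N} = {k..l}" using eq card by (intro card_subset_eq) auto
  have mem: "?d i \<in> {k..l}" if "1 \<le> i" "i \<le> N" for i
    unfolding eq2[symmetric] using that by auto
  have "b + 1 \<in> {k..l}" using mem[of 1] mem[of 2] N a a0 by auto
  then obtain i where "b + 1 = ?d i" unfolding eq2[symmetric] by blast
  then have "(int i - 1) * a = 1" by simp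
  then show a1: "a = 1" using a by (simp add: zmult_eq_1_iff)
  have "e \<in> {k..l}" unfolding eq by simp
  then have "e \<in> ?d ` {1..N}" unfolding eq2 .
  then show "b \<le> e" "e \<le> b + int N - 1" using a1 by auto
qed

text \<open>The span of the first \<open>N - 1\<close> terms forces \<open>a = 1\<close> once
  \<open>N \<ge> 5\<close>. They then fill the interval up to one endpoint, \<open>b - 1\<close> or
  \<open>b + N - 1\<close>, which has to be \<open>1\<close> or \<open>2 * b + N - 2\<close>. Of the
  four combinations the two with \<open>b - 1\<close> push the other of these degrees outside the
  interval.\<close>

lemma interval_switch:
  fixes a b k l :: int and d :: "nat \<Rightarrow> int"
  assumes eq: "{k..l} = insert a (d ` {1..N})" and len: "l - k + 1 = int N"
    and N: "N \<ge> 5" and a: "a \<ge> 0"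
    and d: "\<And>i. 1 \<le> i \<Longrightarrow> i < N \<Longrightarrow> d i = b + (int i - 1) * a"
    and dN: "d N = b + d (N - 1)"
  shows "a = 1 \<and> (b = 1 \<or> b = 2 - int N)"
proof -
  have card: "card {k..l} = N" using len by simp
  have dN': "d N = 2 * b + (int N - 2) * a"
    using dN d[of "N - 1"] N by (simp add: of_nat_diff)
  have mem: "d i \<in> {k..l}" if "1 \<le> i" "i \<le> N" for i unfolding eq using that by auto
  have a0: "a \<noteq> 0"
  proof
    assume a0: "a = 0"
    have "d i \<in> {b, 2 * b}" if "i \<in> {1..N}" for i
      using that d[of i] dN' a0 by (cases "i = N") auto
    then have "d ` {1..N} \<subseteq> {b, 2 * b}" by blast
    then have "{k..l} \<subseteq> {0, b, 2 * b}" using eq a0 by auto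
    then have "card {k..l} \<le> card {0, b, 2 * b}" by (intro card_mono) auto
    also have "\<dots> \<le> 3" by (auto simp: card_insert_if)
    finally show False using card N by simp
  qed
  have b1: "k \<le> b" using mem[of 1] d[of 1] N by simp
  have b2: "b + (int N - 2) * a \<le> l" using mem[of "N - 1"] d[of "N - 1"] N by (simp add: of_nat_diff)
  have a1: "a = 1"
  proof (rule ccontr)
    assume "a \<noteq> 1"
    then have "(int N - 2) * 2 \<le> (int N - 2) * a" using a a0 N by (intro mult_left_mono) auto
    moreover have "(int N - 2) * a \<le> int N - 1" using b1 b2 len by linarith
    moreover have "int N \<ge> 5" using N by simp
    ultimately show False by (simp add: algebra_simps)
  qed
  have set: "e = 1 \<or> e = 2 * b + int N - 2 \<or> (b \<le> e \<and> e \<le> b + int N - 2)" if "e \<in> {k..l}" for e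
  proof -
    consider "e = 1" | i where "1 \<le> i" "i \<le> N" "e = d i" using \<open>e \<in> {k..l}\<close> a1 unfolding eq by auto
    then show ?thesis
    proof cases
      case (2 i)
      then show ?thesis using dN' d[of i] a1 by (cases "i = N") auto
    qed simp
  qed
  have "1 \<in> {k..l}" unfolding eq using a1 by simp
  moreover have "2 * b + int N - 2 \<in> {k..l}" using mem[of N] dN' a1 N by simp
  moreover have "k \<in> {k..l}" "l \<in> {k..l}" using len N by auto
  ultimately show ?thesis using set[of k] set[of l] b1 b2 a1 len N by auto
qed

section \<open>Recognising a listed algebra from its products on a basis\<close>

lemma (in filiform_algebra) adapted_frameI:
  assumes "adapted x z" "\<And>i. i \<in> {1..Suc N} \<Longrightarrow> e i \<in> C"
    and "x \<in> span (e ` {1..Suc N})" "\<And>j. 1 \<le> j \<Longrightarrow> j \<le> N \<Longrightarrow> z j \<in> span (e ` {1..Suc N})"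
  shows "frame (Suc N) e"
proof -
  have "insert x (z ` {1..N}) \<subseteq> span (e ` {1..Suc N})" using assms(3,4) by auto
  then have "C \<subseteq> span (e ` {1..Suc N})"
    using carrier_span_adapted[OF assms(1)] span_minimal by simp
  then show ?thesis using assms(2) has_dim unfolding frame_def by blast
qed

locale complex_leibniz_algebra = leibniz_algebra L for L :: "(complex, 'a::ab_group_add) alg"
begin

lemma comb_basis_vec [simp]: "m \<in> {1..n} \<Longrightarrow> comb n e (basis_vec m) = e m"
proof -
  assume m: "m \<in> {1..n}"
  have "comb n e (basis_vec m) = (\<Sum>i\<in>{1..n}. if i = m then e i else 0)"
    unfolding comb_def basis_vec_def by (intro sum.cong) auto
  then show ?thesis using m by simp
qed

lemma comb_zero [simp]: "comb n e 0 = 0"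
  by (simp add: comb_def)

lemma comb_uminus [simp]: "comb n e (- c) = - comb n e c"
  by (simp add: comb_def sum_negf)

lemma comb_fun_scale [simp]: "comb n e (fun_scale a c) = a *s comb n e c"
  by (simp add: comb_def fun_scale_def scale_sum_right)

lemma frame_family:
  assumes "frame n e"
    and "\<And>i j. i \<in> {1..n} \<Longrightarrow> j \<in> {1..n} \<Longrightarrow> e i \<star> e j = comb n e (family_table n F i j)"
    and "\<And>i j m. i \<in> {1..n} \<Longrightarrow> j \<in> {1..n} \<Longrightarrow> m \<notin> {1..n} \<Longrightarrow> family_table n F i j m = 0"
  shows "alg_isomorphic L (family_alg n F)"
  unfolding family_alg_def
  by (rule frame_isomorphic[OF _ assms(1,3,2)]) (simp_all add: leibniz_algebra_axioms)

end

lemma fun_scale_apply: "fun_scale a x m = a * x m"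
  by (simp add: fun_scale_def)

lemma family_table_outside:
  assumes "n \<ge> 3" "F \<in> listed n" "i \<in> {1..n}" "j \<in> {1..n}" "m \<notin> {1..n}"
  shows "family_table n F i j m = 0"
proof -
  have b: "basis_vec p m = 0" if "p \<in> {1..n}" for p using that assms(5) by (auto simp: basis_vec_def)
  show ?thesis
  proof (cases F)
    case (M2 \<alpha>)
    have "(n + 1) div 2 + (n - 1) div 2 \<le> n" "1 \<le> (n + 1) div 2" using assms(1) by linarith+
    then have "i \<le> (n - 1) div 2 \<Longrightarrow> (n + 1) div 2 + i - 1 \<in> {1..n}"
      using assms(3) by auto
    moreover have "i \<le> n - 2 \<Longrightarrow> i + 1 \<in> {1..n}" "n - 1 \<in> {1..n}"
      using assms(1) by auto
    ultimately show ?thesis using M2 b unfolding family_table.simps by (auto simp: fun_scale_apply)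
  next
    case (M1 k)
    have "i \<le> n - k \<Longrightarrow> k + i - 1 \<in> {1..n}" "i \<le> n - 2 \<Longrightarrow> i + 1 \<in> {1..n}"
      using assms(1-3) M1 by (auto simp: listed_def split: if_splits)
    then show ?thesis using M1 b by auto
  next
    case M3
    have "i \<le> n - 2 \<Longrightarrow> i + 1 \<in> {1..n}" "n - 1 \<in> {1..n}"
      using assms(1) by auto
    then show ?thesis using M3 b by auto
  next
    case NGF2
    have "i \<le> n - 1 \<Longrightarrow> i + 1 \<in> {1..n}" "3 \<in> {1..n}" using assms(1) by auto
    then show ?thesis using NGF2 b by auto
  next
    case NGF3
    have "i \<le> n - 1 \<Longrightarrow> i + 1 \<in> {1..n}" "j \<le> n - 1 \<Longrightarrow> j + 1 \<in> {1..n}" "n \<in> {1..n}"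
      using assms(1) by auto
    then show ?thesis using NGF3 b by (auto simp: fun_scale_apply)
  next
    case M4
    have "i \<le> n - 1 \<Longrightarrow> i + 1 \<in> {1..n}" "j \<le> n - 1 \<Longrightarrow> j + 1 \<in> {1..n}" "n \<in> {1..n}"
      using assms(1) by auto
    then show ?thesis using M4 b by auto
  qed
qed

locale complex_graded_filiform = graded_filiform L N V k l + complex_leibniz_algebra L
  for L :: "(complex, 'a::ab_group_add) alg" and N V k l
begin

lemma frame_listed:
  assumes "frame (Suc N) e" "F \<in> listed (Suc N)"
    and "\<And>i j. i \<in> {1..Suc N} \<Longrightarrow> j \<in> {1..Suc N} \<Longrightarrow> e i \<star> e j = comb (Suc N) e (family_table (Suc N) F i j)"
  shows "\<exists>F\<in>listed (Suc N). alg_isomorphic L (family_alg (Suc N) F)"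
  using frame_family[OF assms(1,3)] family_table_outside[OF _ assms(2)] N assms(2) by auto

lemma bracket_top: "u \<in> LC N \<Longrightarrow> v \<in> C \<Longrightarrow> u \<star> v = 0"
  using bracket_LC_left[of u N v] LC_top[of "Suc N"] N by simp

text \<open>The right powers of \<open>x\<close> form a string in degrees \<open>1, ..., N\<close>,
  and \<open>y\<close> has some degree \<open>\<beta>\<close> in this range. After subtracting a
  multiple of the string element of that degree, only two scalars remain: \<open>\<mu>\<close> in
  \<open>x \<star> y'\<close> and \<open>\<nu>\<close> in \<open>y' \<star> y'\<close>. Whether each
  vanishes distinguishes \<open>M1\<close>, \<open>M2\<close>, \<open>M3\<close> and
  \<open>NGF2\<close>.\<close>

lemma case_square:
  assumes had: "hadapted x z a d" and a: "a \<ge> 0"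
    and z2: "z 2 = x \<star> x" and zS: "\<And>i. 2 \<le> i \<Longrightarrow> i < N \<Longrightarrow> z (i + 1) = z i \<star> x"
    and yx: "z 1 \<star> x \<in> LC 3" and xy: "x \<star> z 1 \<in> LC 3" and yy: "z 1 \<star> z 1 \<in> LC 3"
  shows "\<exists>F\<in>listed (Suc N). alg_isomorphic L (family_alg (Suc N) F)"
proof -
  note ad = hadapted_adapted[OF had]
  note zV = hadapted_z[OF had] and xV = hadapted_x[OF had]
  define y b where "y = z 1" and "b = d 1"
  have yV: "y \<in> V b" using zV[of 1] N by (simp add: y_def b_def)
  have x: "x \<in> C" and y: "y \<in> C" using xV yV V_closed by auto
  have z: "z j \<in> C" if "1 \<le> j" "j \<le> N" for j using adapted_closed[OF ad] that by simp
  have d: "d j = int j * a" if "2 \<le> j" "j \<le> N" for j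
    using that
  proof (induction j rule: dec_induct)
    case base
    then show ?case using degree_unique[OF had, of 2 "a + a"] V_bracket[OF xV xV] z2 by simp
  next
    case (step j)
    then have "z (j + 1) \<in> V (int j * a + a)" using zS[of j] V_bracket[OF zV[of j] xV] by simp
    then show ?case using degree_unique[OF had, of "Suc j" "int j * a + a"] step by (simp add: algebra_simps)
  qed
  have "{k..l} = insert b ((\<lambda>i. a + (int i - 1) * a) ` {1..N})"
  proof -
    have 1: "{1..N} = insert 1 {2..N}" using N by auto
    have "d ` {2..N} = (\<lambda>i. a + (int i - 1) * a) ` {2..N}"
      using d by (intro image_cong) (auto simp: algebra_simps)
    then show ?thesis using degrees[OF had] unfolding 1 by (auto simp: b_def)
  qed
  from interval_progression[OF this len N a]
  have a1: "a = 1" and b: "1 \<le> b" "b \<le> int N" by auto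
  define \<beta> where "\<beta> = nat b"
  have \<beta>: "1 \<le> \<beta>" "\<beta> \<le> N" "b = int \<beta>" using b by (auto simp: \<beta>_def)
  \<comment> \<open>Starting the string at \<open>x\<close> and continuing it by 0 beyond
    \<open>N\<close> makes \<open>w j \<star> x = w (Suc j)\<close> valid for all
    \<open>j \<ge> 1\<close>.\<close>
  define w where "w j = (if j = 1 then x else if j \<le> N then z j else 0)" for j
  have wC: "w j \<in> C" if "j \<ge> 1" for j using that x z by (simp add: w_def)
  have wS: "w j \<star> x = w (Suc j)" if j: "j \<ge> 1" for j
  proof -
    consider "j = 1" | "2 \<le> j" "j < N" | "j = N" | "j > N" using j by linarith
    then show ?thesis
    proof cases
      case 1
      then show ?thesis using z2 N by (simp add: w_def numeral_2_eq_2)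
    next
      case 2
      then show ?thesis using zS[of j] by (simp add: w_def)
    next
      case 3
      then show ?thesis using bracket_top[of "z N" x] adapted_LC[OF ad, of N] x N by (simp add: w_def)
    qed (use x j N in \<open>simp add: w_def\<close>)
  qed
  \<comment> \<open>The Leibniz identity with equal last arguments gives
    \<open>u \<star> (x \<star> x) = 0\<close>; right multiplication by \<open>x\<close> carries
    this along the string.\<close>
  have ann: "u \<star> w j = 0" if "j \<ge> 2" "u \<in> C" for u j
    using that
  proof (induction j arbitrary: u rule: dec_induct)
    case base
    have "w 2 = x \<star> x" using N z2 by (simp add: w_def)
    then show ?case using leibniz_identity[of u x x] x base by simp
  next
    case (step j)
    then show ?case using leibniz_identity[of u "w j" x] wS[of j] wC[of j] x by simp
  qed
  have loc: "\<exists>c. v = c *s w m" if "v \<in> LC i" "v \<in> V (int m)" "2 \<le> i" for v i m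
  proof (cases "i \<le> m \<and> m \<le> N")
    case True
    then show ?thesis
      using locate_one[OF had that(3,1,2), of m] d a1 that by (auto simp: w_def)
  next
    case False
    have "v = 0"
      using locate_zero[OF had that(3,1,2)] d a1 that(3) False by auto
    then show ?thesis by (intro exI[of _ 0]) simp
  qed
  have loc0: "v = 0" if "v \<in> LC 3" "v \<in> V 2" for v
    using locate_zero[OF had _ that] d a1 by simp
  have yxV: "y \<star> x \<in> V (int (\<beta> + 1))" and xyV: "x \<star> y \<in> V (int (\<beta> + 1))"
    and wV: "w j \<in> V (int j)" if "j \<ge> 1" for j
    using V_bracket[OF yV xV] V_bracket[OF xV yV] \<beta> a1 xV that zV[of j] d[of j] subspace_0[OF V_subspace]
    by (auto simp: w_def add.commute)
  \<comment> \<open>Among \<open>z 2, ..., z N\<close> only \<open>z (Suc \<beta>)\<close> can have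
    degree \<open>\<beta> + 1\<close>. For \<open>\<beta> = 1\<close> this is \<open>z 2\<close>,
    which membership in \<open>LC 3\<close> rules out.\<close>
  obtain c where c: "y \<star> x = c *s w (Suc \<beta>)" "\<beta> = 1 \<Longrightarrow> c = 0"
  proof (cases "\<beta> = 1")
    case True
    then have "y \<star> x = 0" using loc0[of "y \<star> x"] yx yxV[of 1] by (simp add: y_def numeral_2_eq_2)
    then show ?thesis using that[of 0] by simp
  next
    case False
    then show ?thesis using loc[of "y \<star> x" 3 "Suc \<beta>"] yx yxV[of 1] that by (auto simp: y_def)
  qed
  define y' where "y' = y - c *s w \<beta>"
  have y'C: "y' \<in> C" using y wC \<beta> by (simp add: y'_def)
  have y'V: "y' \<in> V (int \<beta>)"
    unfolding y'_def using yV wV[of \<beta>] \<beta> V_subspace by (simp add: subspace_diff subspace_scale)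
  have y'x: "y' \<star> x = 0"
    unfolding y'_def using y x wC[of \<beta>] \<beta> c wS[of \<beta>] by (simp add: bracket_simps)
  \<comment> \<open>For \<open>\<beta> = 1\<close> the vector \<open>w \<beta>\<close> is
    \<open>x\<close>, whose square is not zero, but then \<open>c = 0\<close>.\<close>
  have "c *s (x \<star> w \<beta>) = 0" using c(2) ann[of \<beta> x] x \<beta> by (cases "\<beta> = 1") auto
  then have xy': "x \<star> y' = x \<star> y"
    unfolding y'_def using y x wC[of \<beta>] \<beta> by (simp add: bracket_simps)
  obtain \<mu> where \<mu>: "x \<star> y' = \<mu> *s w (Suc \<beta>)" "\<beta> = 1 \<or> \<beta> = N \<Longrightarrow> \<mu> = 0"
  proof (cases "\<beta> = 1 \<or> \<beta> = N")
    case True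
    have "x \<star> y = 0" if "\<beta> = 1"
      using loc0[of "x \<star> y"] xy xyV[of 1] that by (simp add: y_def numeral_2_eq_2)
    moreover have "x \<star> y = 0" if "\<beta> = N"
      using loc[of "x \<star> y" 3 "Suc \<beta>"] xy xyV[of 1] that N by (auto simp: y_def w_def)
    ultimately show ?thesis using that[of 0] xy' True by auto
  next
    case False
    then show ?thesis using loc[of "x \<star> y" 3 "Suc \<beta>"] xy xyV[of 1] that xy' by (auto simp: y_def)
  qed
  have wy': "w j \<star> y' = \<mu> *s w (\<beta> + j)" if "j \<ge> 1" for j
    using that
  proof (induction j rule: dec_induct)
    case base
    then show ?case using \<mu> by (simp add: w_def)
  next
    case (step j)
    have "w j \<star> (x \<star> y') = (w j \<star> x) \<star> y' - (w j \<star> y') \<star> x"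
      using leibniz_identity wC step x y'C by simp
    moreover have "w j \<star> (x \<star> y') = 0"
      using \<mu> ann[of "Suc \<beta>" "w j"] wC step \<beta> by (simp add: bracket_simps)
    ultimately have "w (Suc j) \<star> y' = (w j \<star> y') \<star> x" using wS step by simp
    also have "\<dots> = \<mu> *s w (\<beta> + Suc j)"
      using step wS[of "\<beta> + j"] wC[of "\<beta> + j"] \<beta> x by (simp add: bracket_simps)
    finally show ?case .
  qed
  have y'w: "y' \<star> w j = 0" if "j \<ge> 1" for j
    using that ann[of j y'] y'C y'x by (cases "j = 1") (auto simp: w_def)
  obtain \<nu> where \<nu>: "y' \<star> y' = \<nu> *s w (2 * \<beta>)" "2 * \<beta> \<noteq> N \<Longrightarrow> \<nu> = 0"
  proof (cases "\<beta> = 1")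
    case True
    then have "y' = y" using c by (simp add: y'_def)
    then have "y' \<star> y' \<in> LC 3" "y' \<star> y' \<in> V 2"
      using yy V_bracket[OF y'V y'V] True by (auto simp: y_def)
    then have "y' \<star> y' = 0" by (rule loc0)
    then show ?thesis using that[of 0] by simp
  next
    case False
    have "y' \<star> y' \<in> LC 2" using bracket_LC_left[of y' 1 y'] y'C by (simp add: numeral_2_eq_2)
    moreover have "y' \<star> y' \<in> V (int (2 * \<beta>))" using V_bracket[OF y'V y'V] by simp
    ultimately obtain \<nu> where \<nu>: "y' \<star> y' = \<nu> *s w (2 * \<beta>)" using loc by blast
    \<comment> \<open>Since \<open>y' \<star> x = 0\<close>, right multiplication by
      \<open>x\<close> annihilates \<open>y' \<star> y'\<close>. A multiple of
      \<open>w (2 * \<beta>)\<close> with this property is zero unless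
      \<open>2 * \<beta> = N\<close>, the end of the string.\<close>
    have "y' \<star> (y' \<star> x) = (y' \<star> y') \<star> x - (y' \<star> x) \<star> y'"
      using leibniz_identity y'C x by blast
    then have nu0: "\<nu> *s w (Suc (2 * \<beta>)) = 0"
      using y'x y'C \<nu> x wC[of "2 * \<beta>"] wS[of "2 * \<beta>"] \<beta> by (simp add: bracket_simps)
    show ?thesis
    proof (cases "2 * \<beta> = N")
      case True
      then show ?thesis using that[OF \<nu>] by simp
    next
      case F: False
      have "y' \<star> y' = 0"
      proof (cases "2 * \<beta> < N")
        case True
        then have "w (Suc (2 * \<beta>)) \<noteq> 0"
          using adapted_nonzero(2)[OF ad, of "Suc (2 * \<beta>)"] \<beta> by (simp add: w_def)
        then show ?thesis using nu0 \<nu> by simp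
      next
        case False
        then show ?thesis using \<nu> F N by (simp add: w_def)
      qed
      then show ?thesis using that[of 0] by simp
    qed
  qed
  have fr: "frame (Suc N) (\<lambda>i. if i = Suc N then s *s y' else w i)" (is "frame _ ?e") if s: "s \<noteq> 0" for s
  proof (rule adapted_frameI[OF ad])
    have w_in: "w j \<in> span (?e ` {1..Suc N})" if "1 \<le> j" "j \<le> N" for j
      using that by (intro span_base image_eqI[of _ _ j]) auto
    show "?e i \<in> C" if "i \<in> {1..Suc N}" for i using that y'C wC by simp
    show "x \<in> span (?e ` {1..Suc N})" using w_in[of 1] N by (simp add: w_def)
    show "z j \<in> span (?e ` {1..Suc N})" if j: "1 \<le> j" "j \<le> N" for j
    proof (cases "j = 1")
      case True
      have "s *s y' \<in> span (?e ` {1..Suc N})"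
        by (intro span_base image_eqI[of _ _ "Suc N"]) auto
      then have "inverse s *s (s *s y') \<in> span (?e ` {1..Suc N})"
        by (rule span_scale)
      then have "y' + c *s w \<beta> \<in> span (?e ` {1..Suc N})"
        using w_in[of \<beta>] \<beta> s by (intro span_add span_scale[of "w \<beta>"]) simp_all
      then show ?thesis using True by (simp add: y'_def y_def)
    next
      case False
      then show ?thesis using w_in[OF j] j by (simp add: w_def)
    qed
  qed
  show ?thesis
  proof (cases "\<mu> = 0")
    case False
    \<comment> \<open>Scaling \<open>y'\<close> normalises \<open>x \<star> (s *s y')\<close> to
      \<open>w (Suc \<beta>)\<close>. No freedom is left for \<open>\<nu>\<close>, which becomes the
      parameter \<open>s * s * \<nu>\<close> of \<open>M2\<close>.\<close>
    define s where "s = inverse \<mu>"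
    let ?e = "\<lambda>i. if i = Suc N then s *s y' else w i"
    have s: "s \<noteq> 0" "s * \<mu> = 1" using False by (auto simp: s_def)
    have b2: "2 \<le> \<beta>" "\<beta> < N" using \<mu>(2) False \<beta> by (auto simp: le_less)
    have bw: "?e i \<star> ?e j = (if i \<le> N \<and> j = 1 then w (Suc i) else if i \<le> N \<and> j = Suc N then w (\<beta> + i)
        else if i = Suc N \<and> j = Suc N then (s * s * \<nu>) *s w N else 0)"
      if ij: "i \<in> {1..Suc N}" "j \<in> {1..Suc N}" for i j
    proof -
      have C: "w i \<in> C" "w j \<in> C" using wC ij by auto
      have w1: "w (Suc 0) = x" by (simp add: w_def)
      have "y' \<star> y' = \<nu> *s w N" using \<nu> by (cases "2 * \<beta> = N") auto
      then show ?thesis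
        using ij C y'C wS[of i] wy'[of i] y'w[of j] ann[of j "w i"] s y'x x w1 N
        by (auto simp: bracket_simps mult.assoc)
    qed
    show ?thesis
    proof (cases "\<nu> = 0")
      case True
      show ?thesis
      proof (rule frame_listed[OF fr[OF s(1)]])
        show "M1 (Suc \<beta>) \<in> listed (Suc N)" using b2 by (auto simp: listed_def)
        show "?e i \<star> ?e j = comb (Suc N) ?e (family_table (Suc N) (M1 (Suc \<beta>)) i j)"
          if "i \<in> {1..Suc N}" "j \<in> {1..Suc N}" for i j
          unfolding bw[OF that] using that b2 True by (auto simp: w_def)
      qed
    next
      case nu: False
      then have bN: "N = 2 * \<beta>" using \<nu>(2) by auto
      show ?thesis
      proof (rule frame_listed[OF fr[OF s(1)]])
        show "M2 (s * s * \<nu>) \<in> listed (Suc N)" using s nu bN by (auto simp: listed_def)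
        show "?e i \<star> ?e j = comb (Suc N) ?e (family_table (Suc N) (M2 (s * s * \<nu>)) i j)"
          if "i \<in> {1..Suc N}" "j \<in> {1..Suc N}" for i j
          unfolding bw[OF that] using that b2 bN by (auto simp: w_def)
      qed
    qed
  next
    case \<mu>0: True
    show ?thesis
    proof (cases "\<nu> = 0")
      case False
      \<comment> \<open>With \<open>\<mu> = 0\<close> the scale of \<open>y'\<close> is still free,
        and a complex square root turns \<open>\<nu>\<close> into 1.\<close>
      define s where "s = inverse (csqrt \<nu>)"
      have "s\<^sup>2 * \<nu> = 1" using False by (simp add: s_def power_inverse)
      then have s: "s \<noteq> 0" "s * s * \<nu> = 1" using False by (auto simp: s_def power2_eq_square)
      let ?e = "\<lambda>i. if i = Suc N then s *s y' else w i"
      have bN: "N = 2 * \<beta>" using \<nu>(2) False by auto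
      have bw: "?e i \<star> ?e j = (if i \<le> N \<and> j = 1 then w (Suc i)
          else if i = Suc N \<and> j = Suc N then w N else 0)"
        if ij: "i \<in> {1..Suc N}" "j \<in> {1..Suc N}" for i j
      proof -
        have C: "w i \<in> C" "w j \<in> C" using wC ij by auto
        have w1: "w (Suc 0) = x" by (simp add: w_def)
        have "s *s (s *s (y' \<star> y')) = w N" using \<nu>(1) s(2) bN by (simp add: mult.assoc)
        then show ?thesis
          using ij C y'C wS[of i] wy'[of i] y'w[of j] ann[of j "w i"] \<mu>0 y'x x w1 N
          by (auto simp: bracket_simps)
      qed
      show ?thesis
      proof (rule frame_listed[OF fr[OF s(1)]])
        show "M3 \<in> listed (Suc N)" using bN by (auto simp: listed_def)
        show "?e i \<star> ?e j = comb (Suc N) ?e (family_table (Suc N) M3 i j)"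
          if "i \<in> {1..Suc N}" "j \<in> {1..Suc N}" for i j
          unfolding bw[OF that] using that N by (auto simp: w_def)
      qed
    next
      case \<nu>0: True
      let ?e = "\<lambda>i. if i = 1 then x else if i = 2 then y' else w (i - 1)"
      have "frame (Suc N) ?e"
      proof (rule adapted_frameI[OF ad])
        have w_in: "w j \<in> span (?e ` {1..Suc N})" if "1 \<le> j" "j \<le> N" for j
          using that N by (cases "j = 1")
            (auto intro!: span_base image_eqI[of _ _ "1"] image_eqI[of _ _ "Suc j"] simp: w_def)
        show "?e i \<in> C" if "i \<in> {1..Suc N}" for i using that y'C wC[of "i - 1"] x by auto
        show "x \<in> span (?e ` {1..Suc N})" using w_in[of 1] N by (simp add: w_def)
        show "z j \<in> span (?e ` {1..Suc N})" if j: "1 \<le> j" "j \<le> N" for j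
        proof (cases "j = 1")
          case True
          have "y' \<in> span (?e ` {1..Suc N})"
            using N by (intro span_base image_eqI[of _ _ "2"]) auto
          then have "y' + c *s w \<beta> \<in> span (?e ` {1..Suc N})"
            using w_in \<beta> by (intro span_add span_scale) auto
          then show ?thesis using True by (simp add: y'_def y_def)
        next
          case False
          then show ?thesis using w_in[OF j] j by (simp add: w_def)
        qed
      qed
      then show ?thesis
      proof (rule frame_listed)
        show "NGF2 \<in> listed (Suc N)" by (auto simp: listed_def)
        fix i j assume ij: "i \<in> {1..Suc N}" "j \<in> {1..Suc N}"
        have xw: "x = w 1" by (simp add: w_def)
        have e: "?e i = w 1 \<or> ?e i = y' \<or> (i \<ge> 3 \<and> ?e i = w (i - 1))" using ij by (auto simp: w_def)
        have C: "?e i \<in> C" using ij wC[of "i - 1"] x y'C by (cases "i \<le> 2") auto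
        have 1: "?e i \<star> ?e j = 0" if "j \<noteq> 1"
        proof (cases "j = 2")
          case True
          then show ?thesis using wy'[of 1] wy'[of "i - 1"] \<mu>0 \<nu> \<nu>0 ij by (auto simp: xw)
        next
          case False
          then show ?thesis using ann[of "j - 1", OF _ C] that ij by auto
        qed
        have 2: "?e i \<star> ?e 1 = (if i = 1 then w 2 else if i = 2 then 0 else w i)"
          using wS[of 1] wS[of "i - 1"] y'x ij by (auto simp: xw numeral_2_eq_2)
        show "?e i \<star> ?e j = comb (Suc N) ?e (family_table (Suc N) NGF2 i j)"
        proof (cases "j = 1")
          case True
          then show ?thesis using 2 ij N by (auto simp: w_def numeral_2_eq_2 numeral_3_eq_3)
        next
          case False
          then show ?thesis using 1 by simp
        qed
      qed
    qed
  qed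
qed

section \<open>The string of right multiples of \<open>y\<close> by \<open>x\<close>\<close>

lemma string_frame:
  assumes ad: "adapted x z" and "x - u \<in> span (z ` {2..N})"
  shows "frame (Suc N) (\<lambda>i. if i = 1 then u else z (i - 1))" (is "frame _ ?e")
proof (rule adapted_frameI[OF ad])
  have z_in: "z j \<in> span (?e ` {1..Suc N})" if "1 \<le> j" "j \<le> N" for j
    using that by (intro span_base image_eqI[of _ _ "Suc j"]) auto
  then show "z j \<in> span (?e ` {1..Suc N})" if "1 \<le> j" "j \<le> N" for j using that .
  have xC: "x \<in> C" using adapted_generators[OF ad] unfolding generators_def by blast
  have *: "span (z ` {2..N}) \<subseteq> C \<inter> span (?e ` {1..Suc N})"
    using z_in adapted_closed[OF ad] by (intro span_minimal subspace_inter subspace_carrier) auto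
  then have "x - u \<in> C" "x - u \<in> span (?e ` {1..Suc N})" using assms(2) by auto
  moreover have "u \<in> span (?e ` {1..Suc N})" by (intro span_base image_eqI[of _ _ 1]) auto
  ultimately show "x \<in> span (?e ` {1..Suc N})" using span_add[of "x - u" _ u] by simp
  have "x - (x - u) \<in> C" using \<open>x - u \<in> C\<close> xC diff_closed by blast
  then have "u \<in> C" by simp
  then show "?e i \<in> C" if "i \<in> {1..Suc N}" for i
    using that adapted_closed[OF ad, of "i - 1"] by auto
qed

context
  fixes x z a d
  assumes had: "hadapted x z a d" and a: "a \<ge> 0"
    and zS: "\<And>i. 1 \<le> i \<Longrightarrow> i < N \<Longrightarrow> z (i + 1) = z i \<star> x"
    and xx: "x \<star> x \<in> LC 3" and yy: "z 1 \<star> z 1 \<in> LC 3"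
    and zy: "\<And>i. 2 \<le> i \<Longrightarrow> i < N \<Longrightarrow> z i \<star> z 1 \<in> LC (i + 2)"
begin

lemma string_degrees: "a = 1" "d 1 \<le> 1" "1 \<le> i \<Longrightarrow> i \<le> N \<Longrightarrow> d i = d 1 + int i - 1"
proof -
  note zV = hadapted_z[OF had] and xV = hadapted_x[OF had]
  have d: "d j = d 1 + (int j - 1) * a" if "1 \<le> j" "j \<le> N" for j
    using that
  proof (induction j rule: dec_induct)
    case (step j)
    then have "z (j + 1) \<in> V (d 1 + (int j - 1) * a + a)"
      using zS[of j] V_bracket[OF zV[of j] xV] by simp
    then show ?case
      using degree_unique[OF had, of "Suc j"] step by (simp add: algebra_simps)
  qed simp
  then have "d ` {1..N} = (\<lambda>j. d 1 + (int j - 1) * a) ` {1..N}" by (intro image_cong refl d) auto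
  then have "{k..l} = insert a ((\<lambda>j. d 1 + (int j - 1) * a) ` {1..N})"
    using degrees[OF had] by simp
  from interval_progression[OF this len N a]
  have "a = 1" "d 1 \<le> a" by auto
  then show "a = 1" "d 1 \<le> 1" by auto
  show "1 \<le> i \<Longrightarrow> i \<le> N \<Longrightarrow> d i = d 1 + int i - 1" using d[of i] \<open>a = 1\<close> by simp
qed

lemma string_closed: "x \<in> C" "1 \<le> j \<Longrightarrow> j \<le> N \<Longrightarrow> z j \<in> C"
  by (rule V_closed[OF hadapted_x[OF had]], rule V_closed[OF hadapted_z[OF had]])

text \<open>Degrees grow with the weight along the string, so nonzero homogeneous elements of
  \<open>LC j\<close> start at the degree of \<open>z j\<close>. The bound
  \<open>d 1 \<le> 1\<close> places products with \<open>z 1\<close> just below that start.\<close>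

lemma string_locate:
  assumes "v \<in> LC j" "v \<in> V e" "2 \<le> j" "e < d 1 + int j - 1"
  shows "v = 0"
proof (rule locate_zero[OF had assms(3,1,2)])
  show "d m \<noteq> e" if "j \<le> m" "m \<le> N" for m
    using string_degrees(3)[of m] that assms(3,4) by simp
qed

lemma string_z1: "1 \<le> i \<Longrightarrow> i \<le> N \<Longrightarrow> z i \<star> z 1 = 0"
proof -
  assume i: "1 \<le> i" "i \<le> N"
  have V: "z i \<star> z 1 \<in> V (d i + d 1)" using hadapted_z[OF had] V_bracket i by simp
  consider "i = 1" | "2 \<le> i" "i < N" | "i = N" using i by linarith
  then show ?thesis
  proof cases
    case 1
    then show ?thesis using string_locate[OF _ V, of 3] yy string_degrees(2) by simp
  next
    case 2
    then show ?thesis using string_locate[OF zy V] string_degrees(2) string_degrees(3)[of i] by simp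
  next
    case 3
    then show ?thesis
      using bracket_top[of "z N" "z 1"] adapted_LC[OF hadapted_adapted[OF had], of N] string_closed N by simp
  qed
qed

lemma string_x: "1 \<le> i \<Longrightarrow> i \<le> N \<Longrightarrow> z i \<star> x = (if i < N then z (i + 1) else 0)"
proof (cases "i < N")
  case False
  assume "1 \<le> i" "i \<le> N"
  then have "i = N" using False by simp
  moreover have "z N \<in> LC N" using adapted_LC[OF hadapted_adapted[OF had], of N] N by simp
  ultimately show ?thesis using bracket_top[of "z N" x] string_closed(1) by simp
qed (use zS[of i] in simp)

lemma string_xx: "\<exists>\<gamma> m. x \<star> x = \<gamma> *s z m \<and> 3 \<le> m \<and> m \<le> N"
\<comment> \<open>The weight \<open>3 - d 1\<close> solves \<open>d m = 2\<close>, the degree of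
  \<open>x \<star> x\<close>.\<close>
proof (cases "3 \<le> nat (3 - d 1) \<and> nat (3 - d 1) \<le> N")
  case True
  have V: "x \<star> x \<in> V 2" using V_bracket[OF hadapted_x[OF had] hadapted_x[OF had]] string_degrees(1) by simp
  have "\<exists>c. x \<star> x = c *s z (nat (3 - d 1))"
  proof (rule locate_one[OF had _ xx V])
    show "m = nat (3 - d 1)" if "3 \<le> m" "m \<le> N" "d m = 2" for m
      using string_degrees(3)[of m] that by simp
  qed simp
  then show ?thesis using True by blast
next
  case False
  have V: "x \<star> x \<in> V 2" using V_bracket[OF hadapted_x[OF had] hadapted_x[OF had]] string_degrees(1) by simp
  have "x \<star> x = 0"
  proof (rule locate_zero[OF had _ xx V])
    show "d m \<noteq> 2" if "3 \<le> m" "m \<le> N" for m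
      using string_degrees(3)[of m] that False by auto
  qed simp
  then show ?thesis using N by (intro exI[of _ 0] exI[of _ 3]) simp
qed

text \<open>The difference has degree \<open>d 1 + 1\<close>, while \<open>LC 3\<close> starts at
  \<open>d 1 + 2\<close>. The value \<open>c = 0\<close> serves the null case and
  \<open>c = -1\<close> the Lie-like case.\<close>

lemma string_antisymmetric:
  assumes "x \<star> z 1 - c *s (z 1 \<star> x) \<in> LC 3"
  shows "x \<star> z 1 = c *s (z 1 \<star> x)"
proof -
  have "x \<star> z 1 - c *s (z 1 \<star> x) \<in> V (d 1 + 1)"
    using V_bracket[OF hadapted_x[OF had] hadapted_z[OF had, of 1]] V_bracket[OF hadapted_z[OF had, of 1] hadapted_x[OF had]]
      string_degrees(1) N V_subspace
    by (simp add: subspace_diff subspace_scale add.commute)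
  then have "x \<star> z 1 - c *s (z 1 \<star> x) = 0" by (intro string_locate[OF assms]) auto
  then show ?thesis by simp
qed

text \<open>All \<open>z j\<close> now annihilate from the right, up to \<open>j = 1\<close>
  included for the vectors of the final basis. What remains is right multiplication by one generator
  along a string, and such an algebra has a gradation of length \<open>N + 1\<close>.\<close>

lemma case_string_null: "x \<star> z 1 \<in> LC 3 \<Longrightarrow> False"
proof -
  assume xy: "x \<star> z 1 \<in> LC 3"
  have xy0: "x \<star> z 1 = 0" using string_antisymmetric[of 0] xy by simp
  note C = string_closed
  have ann: "u \<star> z j = 0" if "2 \<le> j" "j \<le> N" "u \<in> C" for u j
    using that
  proof (induction j arbitrary: u rule: dec_induct)
    case base
    have "u \<star> (z 1 \<star> x) = 0"
      using leibniz_identity[of u "z 1" x] leibniz_identity[of u x "z 1"] xy0 base C(1) C(2)[of 1] N by simp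
    then show ?case using zS[of 1] N by (simp add: numeral_2_eq_2)
  next
    case (step j)
    then show ?case using leibniz_identity[of u "z j" x] zS[of j] C by simp
  qed
  obtain \<gamma> m where m: "x \<star> x = \<gamma> *s z m" "3 \<le> m" "m \<le> N" using string_xx by blast
  \<comment> \<open>Since \<open>z (m - 1) \<star> x = z m\<close> and \<open>z (m - 1)\<close>
    annihilates from the right, this correction removes the square of \<open>x\<close>.\<close>
  define u where "u = x - \<gamma> *s z (m - 1)"
  have uC: "u \<in> C" using C m by (simp add: u_def)
  have zu: "z i \<star> u = (if i < N then z (i + 1) else 0)" if "1 \<le> i" "i \<le> N" for i
    using that C m ann[of "m - 1" "z i"] string_x[of i] by (simp add: u_def bracket_simps)
  have "1 \<le> m - 1" "m - 1 < N" "m - 1 + 1 = m" using m by auto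
  then have "z (m - 1) \<star> x = z m" using string_x[of "m - 1"] by simp
  then have uu: "u \<star> u = 0"
    using C m ann[of "m - 1"] by (simp add: u_def bracket_simps)
  have uz1: "u \<star> z 1 = 0" using C m xy0 string_z1[of "m - 1"] by (simp add: u_def bracket_simps)
  have "z (m - 1) \<in> z ` {2..N}" using m by (intro imageI) auto
  then have "x - u \<in> span (z ` {2..N})" by (auto simp: u_def intro: span_base span_scale)
  note fr = string_frame[OF hadapted_adapted[OF had] this]
  have "int (Suc N) \<le> alg_length L"
  proof (rule alg_length_frame[OF fr])
    let ?e = "\<lambda>i. if i = 1 then u else z (i - 1)"
    fix i j assume ij: "i \<in> {1..Suc N}" "j \<in> {1..Suc N}"
    have C': "?e i \<in> C" using ij uC C(2)[of "i - 1"] by auto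
    have 1: "?e i \<star> ?e j = 0" if "j \<ge> 3" using ann[of "j - 1" "?e i"] C' ij that by auto
    have 2: "?e i \<star> ?e 2 = 0"
      using ij uz1 string_z1[of "i - 1"] by (auto simp: numeral_2_eq_2)
    have 3: "?e i \<star> ?e 1 = (if i = 1 then 0 else if i \<le> N then ?e (Suc i) else 0)"
      using ij uu zu[of "i - 1"] by auto
    consider "j = 1" | "j = 2" | "j \<ge> 3" using ij by atomize_elim auto
    then show "?e i \<star> ?e j \<in> (if i + j \<le> Suc N then span {?e (i + j)} else {0})"
    proof cases
      case 1
      then show ?thesis using 3 by (auto simp: span_zero span_base)
    qed (use 1 2 in \<open>auto simp: span_zero\<close>)
  qed simp
  then show False using alg_length by simp
qed

text \<open>Everything is antisymmetric except possibly the square of \<open>x\<close>, which must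
  be a multiple of \<open>z N\<close>. If it vanishes, the degrees \<open>1, ..., N + 1\<close> are
  available and contradict the length; otherwise rescaling gives \<open>M4\<close>.\<close>

lemma case_string_lie:
  assumes xy: "x \<star> z 1 + z 1 \<star> x \<in> LC 3"
  shows "\<exists>F\<in>listed (Suc N). alg_isomorphic L (family_alg (Suc N) F)"
proof -
  note C = string_closed
  have xy0: "x \<star> z 1 = - (z 1 \<star> x)" using string_antisymmetric[of "-1"] xy by simp
  have zz: "z i \<star> z j = 0" if "1 \<le> j" "j \<le> N" "1 \<le> i" "i \<le> N" for i j
    using that
  proof (induction j arbitrary: i rule: dec_induct)
    case base
    then show ?case using string_z1 by simp
  next
    case (step j)
    have "z i \<star> (z j \<star> x) = (z i \<star> z j) \<star> x - (z i \<star> x) \<star> z j"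
      using leibniz_identity step C by simp
    then show ?case using step string_x[of i] zS[of j] C by auto
  qed
  obtain \<gamma>' m where m: "x \<star> x = \<gamma>' *s z m" "3 \<le> m" "m \<le> N" using string_xx by blast
  have xz: "x \<star> z j = - (z j \<star> x)" if "1 \<le> j" "j \<le> N" for j
    using that
  proof (induction j rule: dec_induct)
    case base
    then show ?case using xy0 by simp
  next
    case (step j)
    have "x \<star> (z j \<star> x) = (x \<star> z j) \<star> x - (x \<star> x) \<star> z j"
      using leibniz_identity step C by simp
    then show ?case using step zS[of j] C m zz[of j m] by (simp add: bracket_simps)
  qed
  \<comment> \<open>Combined with antisymmetry against \<open>x\<close>, this makes
    \<open>x \<star> x\<close> vanish under right multiplication by \<open>x\<close>, so it can only
    sit at the end of the string.\<close>
  have "x \<star> (x \<star> x) = 0" using leibniz_identity[of x x x] C by simp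
  then have "\<gamma>' *s (z m \<star> x) = 0" using m xz[of m] C by (simp add: bracket_simps)
  then have "\<gamma>' = 0 \<or> m = N"
    using string_x[of m] m adapted_nonzero(2)[OF hadapted_adapted[OF had], of "m + 1"] by (cases "m = N") auto
  then obtain \<gamma> where \<gamma>: "x \<star> x = \<gamma> *s z N" using m by (metis scale_zero_left)
  let ?e = "\<lambda>i. if i = 1 then x else z (i - 1)"
  show ?thesis
  proof (cases "\<gamma> = 0")
    case True
    have fr: "frame (Suc N) ?e"
      by (rule string_frame[OF hadapted_adapted[OF had]]) (simp add: span_zero)
    have "int (Suc N) \<le> alg_length L"
    proof (rule alg_length_frame[OF fr])
      fix i j assume ij: "i \<in> {1..Suc N}" "j \<in> {1..Suc N}"
      have 1: "z p \<star> x \<in> (if p + 2 \<le> Suc N then span {?e (p + 2)} else {0})"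
        if "1 \<le> p" "p \<le> N" for p
        using that string_x[of p] by (auto simp: span_base)
      consider "i = 1" "j = 1" | "i = 1" "j \<ge> 2" | "i \<ge> 2" "j = 1" | "i \<ge> 2" "j \<ge> 2"
        using ij by fastforce
      then show "?e i \<star> ?e j \<in> (if i + j \<le> Suc N then span {?e (i + j)} else {0})"
      proof cases
        case 1
        then show ?thesis using \<gamma> True by (simp add: span_zero)
      next
        case 2
        then show ?thesis
          using xz[of "j - 1"] 1[of "j - 1"] ij by (auto simp: span_neg split: if_splits)
      next
        case 3
        then show ?thesis using 1[of "i - 1"] ij by (auto split: if_splits)
      next
        case 4
        then show ?thesis using zz[of "j - 1" "i - 1"] ij by (auto simp: span_zero)
      qed
    qed simp
    then show ?thesis using alg_length by simp
  next
    case False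
    \<comment> \<open>Scaling the whole string by \<open>\<gamma>\<close> makes its last vector
      equal to \<open>x \<star> x\<close> and keeps the remaining products.\<close>
    let ?f = "\<lambda>i. if i = 1 then x else \<gamma> *s z (i - 1)"
    have "frame (Suc N) ?f"
    proof (rule adapted_frameI[OF hadapted_adapted[OF had]])
      show "?f i \<in> C" if "i \<in> {1..Suc N}" for i using that C(1) C(2)[of "i - 1"] by auto
      show "x \<in> span (?f ` {1..Suc N})" by (intro span_base image_eqI[of _ _ 1]) auto
      show "z j \<in> span (?f ` {1..Suc N})" if j: "1 \<le> j" "j \<le> N" for j
      proof -
        have "\<gamma> *s z j \<in> span (?f ` {1..Suc N})"
          using j by (intro span_base image_eqI[of _ _ "Suc j"]) auto
        then have "inverse \<gamma> *s (\<gamma> *s z j) \<in> span (?f ` {1..Suc N})" by (rule span_scale)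
        then show ?thesis using False by simp
      qed
    qed
    then show ?thesis
    proof (rule frame_listed)
      show "M4 \<in> listed (Suc N)" by (simp add: listed_def)
      fix i j assume ij: "i \<in> {1..Suc N}" "j \<in> {1..Suc N}"
      consider "i = 1" "j = 1" | "i = 1" "j \<ge> 2" | "i \<ge> 2" "j = 1" | "i \<ge> 2" "j \<ge> 2"
        using ij by fastforce
      then show "?f i \<star> ?f j = comb (Suc N) ?f (family_table (Suc N) M4 i j)"
      proof cases
        case 1
        then show ?thesis using \<gamma> N by simp
      next
        case 2
        then show ?thesis
          using xz[of "j - 1"] string_x[of "j - 1"] ij C(1) C(2)[of "j - 1"] by (auto simp: bracket_simps)
      next
        case 3
        then show ?thesis
          using string_x[of "i - 1"] ij C(1) C(2)[of "i - 1"] by (auto simp: bracket_simps)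
      next
        case 4
        then show ?thesis
          using zz[of "j - 1" "i - 1"] ij C(2)[of "i - 1"] C(2)[of "j - 1"] by (auto simp: bracket_simps)
      qed
    qed
  qed
qed

end

lemma case_switch:
  assumes had: "hadapted x z a d" and a: "a \<ge> 0"
    and odd: "odd N" and N5: "N \<ge> 5"
    and zS: "\<And>i. 1 \<le> i \<Longrightarrow> i < N - 1 \<Longrightarrow> z (i + 1) = z i \<star> x"
    and P00: "const x z 0 0 = 0" and P11: "const x z 1 1 = 0"
    and one: "\<And>i. 1 \<le> i \<Longrightarrow> i < N - 1 \<Longrightarrow> const x z i 0 = 1"
    and anti0: "\<And>i. 1 \<le> i \<Longrightarrow> i < N \<Longrightarrow> const x z 0 i = - const x z i 0"
    and anti1: "\<And>i. 1 \<le> i \<Longrightarrow> i < N \<Longrightarrow> const x z 1 i = - const x z i 1"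
    and nz: "const x z (N - 1) 1 \<noteq> 0"
    and low: "\<And>i j. 1 \<le> i \<Longrightarrow> 1 \<le> j \<Longrightarrow> i + j < N \<Longrightarrow> const x z i j = 0"
    and high: "\<And>i j. 1 \<le> i \<Longrightarrow> 1 \<le> j \<Longrightarrow> i + j = N \<Longrightarrow>
      const x z i j = (-1)^(j-1) * const x z (N - 1) 1"
  shows "\<exists>F\<in>listed (Suc N). alg_isomorphic L (family_alg (Suc N) F)"
proof -
  note ad = hadapted_adapted[OF had]
  note zV = hadapted_z[OF had] and xV = hadapted_x[OF had]
  let ?P = "const x z" and ?E = "elt x z"
  define b where "b = d 1"
  define c where "c = ?P (N - 1) 1"
  have C: "?E p \<in> C" if "p \<le> N" for p using elt_closed[OF ad that] .
  have d: "d j = b + (int j - 1) * a" if "1 \<le> j" "j < N" for j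
    using that
  proof (induction j rule: dec_induct)
    case (step j)
    then have "z (j + 1) \<in> V (b + (int j - 1) * a + a)"
      using zS[of j] V_bracket[OF zV[of j] xV] by simp
    then show ?case
      using degree_unique[OF had, of "Suc j"] step by (simp add: algebra_simps)
  qed (simp add: b_def)
  have dN: "d N = b + d (N - 1)"
  proof -
    have "z (N - 1) \<star> z 1 - c *s z N \<in> LC (Suc N)"
      using lead_const[OF ad, of "N - 1" 1] N by (simp add: lead_def c_def)
    then have "z (N - 1) \<star> z 1 = c *s z N" using LC_top[of "Suc N"] by simp
    moreover have "z (N - 1) \<star> z 1 \<in> V (d (N - 1) + b)"
      unfolding b_def using N by (intro V_bracket zV) auto
    ultimately have "inverse c *s (c *s z N) \<in> V (d (N - 1) + b)"
      using subspace_scale[OF V_subspace] by metis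
    then show ?thesis using nz degree_unique[OF had, of N "d (N - 1) + b"] N by (simp add: c_def)
  qed
  have ab: "a = 1" "b = 1 \<or> b = 2 - int N"
    using interval_switch[OF degrees[OF had] len N5 a d dN] by auto
  have dj: "d j = b + int j - 1" if "1 \<le> j" "j < N" for j using d[OF that] ab by simp
  have dN': "d N = 2 * b + int N - 2" using dN dj[of "N - 1"] N by (simp add: of_nat_diff)
  define D where "D p = (if p = 0 then 1 else d p)" for p
  have EV: "?E p \<in> V (D p)" if "p \<le> N" for p
    using that xV zV[of p] ab by (auto simp: D_def elt_def)
  \<comment> \<open>For either value of \<open>b\<close>, weight at least
    \<open>weight p + weight q\<close> together with degree \<open>D p + D q\<close> leaves a single
    basis vector. Products therefore equal their leading terms, and \<open>const\<close> gives the
    structure constants of \<open>L\<close> itself.\<close>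
  have match: "m = weight p + weight q"
    if "weight p + weight q \<le> m" "m \<le> N" "d m = D p + D q" for p q m
  proof -
    have dm: "d m = (if m = N then 2 * b + int N - 2 else b + int m - 1)"
      using that dj[of m] dN' weight_add_ge_2(1)[of p q] by auto
    have Dp: "D r = (if r = 0 then 1 else b + int r - 1)" if "r < N" for r
      using dj[of r] that by (auto simp: D_def)
    have "p < N" "q < N" using that by (auto simp: weight_def split: if_splits)
    then show ?thesis
      using that(1,2) that(3)[unfolded dm] ab(2) N5 Dp[of p] Dp[of q]
      by (auto simp: weight_def split: if_splits)
  qed
  have prod: "?E p \<star> ?E q = (if weight p + weight q \<le> N then ?P p q *s z (weight p + weight q) else 0)"
    if pq: "p \<le> N" "q \<le> N" for p q
  proof -
    have mem: "?E p \<star> ?E q \<in> LC (weight p + weight q)"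
      using elt_LC[OF ad] pq by (intro bracket_LC) auto
    show ?thesis
    proof (cases "weight p + weight q \<le> N")
      case True
      obtain c' where c': "?E p \<star> ?E q = c' *s z (weight p + weight q)"
        using locate_one[OF had _ mem V_bracket[OF EV EV]] match pq weight_add_ge_2(1) by blast
      have "?E p \<star> ?E q \<in> C" using C pq by simp
      then have "lead z (weight p + weight q) (?E p \<star> ?E q) c'"
        unfolding lead_def using \<open>?E p \<star> ?E q \<in> C\<close> c' by (simp add: subspace_0)
      then have "?P p q = c'" by (rule const_eqI[OF ad True])
      then show ?thesis using c' True by simp
    next
      case False
      then show ?thesis using mem LC_top[of "weight p + weight q"] by simp
    qed
  qed
  have xz: "x \<in> C" "1 \<le> j \<Longrightarrow> j \<le> N \<Longrightarrow> z j \<in> C" for j using C[of 0] C[of j] by auto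
  have xx: "x \<star> x = 0" using prod[of 0 0] P00 by simp
  have x_z: "x \<star> z j = (if j < N then (- ?P j 0) *s z (j + 1) else 0)" if "1 \<le> j" "j \<le> N" for j
    using prod[of 0 j] that anti0[of j] by simp
  have z_x: "z j \<star> x = (if j < N then ?P j 0 *s z (j + 1) else 0)" if "1 \<le> j" "j \<le> N" for j
    using prod[of j 0] that by simp
  have zz: "z i \<star> z j = (if i + j = N then ((-1)^(j-1) * c) *s z N else 0)"
    if "1 \<le> i" "i \<le> N" "1 \<le> j" "j \<le> N" for i j
    using prod[of i j] that low[of i j] high[of i j] by (auto simp: c_def)
  \<comment> \<open>The coefficient is chosen so that \<open>z (N - 1) \<star> u = c *s z N\<close>.
    Taking \<open>c *s z N\<close> as the last basis vector then continues the string and normalises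
    the exceptional products to signs.\<close>
  define t where "t = 1 - ?P (N - 1) 0 / c"
  define u where "u = x + t *s z 1"
  have c0: "c \<noteq> 0" using nz by (simp add: c_def)
  have uC: "u \<in> C" using xz N by (simp add: u_def)
  have sgn: "(-1)^(N - 2) = (-1 :: complex)" using odd N by (simp add: minus_one_power_iff)
  have zu: "z j \<star> u = (if j < N - 1 then z (j + 1) else if j = N - 1 then c *s z N else 0)"
    and uz: "u \<star> z j = - (z j \<star> u)" if j: "1 \<le> j" "j \<le> N" for j
  proof -
    have "z j \<star> z 1 = (if j = N - 1 then c *s z N else 0)"
      using zz[of j 1] j N by auto
    moreover have "z 1 \<star> z j = (if j = N - 1 then (- c) *s z N else 0)"
      using zz[of 1 j] j N sgn by (auto simp: numeral_2_eq_2)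
    moreover have "?P (N - 1) 0 + t * c = c" using c0 by (simp add: t_def algebra_simps)
    then have "?P (N - 1) 0 *s z N + t *s (c *s z N) = c *s z N"
      by (simp flip: scale_left_distrib)
    moreover have "z j \<star> u = z j \<star> x + t *s (z j \<star> z 1)" "u \<star> z j = x \<star> z j + t *s (z 1 \<star> z j)"
      using xz j N by (simp_all add: u_def bracket_simps)
    ultimately show "z j \<star> u = (if j < N - 1 then z (j + 1) else if j = N - 1 then c *s z N else 0)"
      and "u \<star> z j = - (z j \<star> u)"
      using z_x[of j] x_z[of j] one[of j] j N by auto
  qed
  have uu: "u \<star> u = 0"
  proof -
    have "u \<star> u = x \<star> u + t *s (z 1 \<star> u)" using xz N uC 
      by (simp add: u_def bracket_simps scale_right_distrib add_ac)
    moreover have "x \<star> u = t *s (x \<star> z 1)" using xz N xx by (simp add: u_def bracket_simps)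
    moreover have "x \<star> z 1 = - z 2" "z 1 \<star> u = z 2"
      using x_z[of 1] one[of 1] zu[of 1] N5 by (auto simp: numeral_2_eq_2)
    ultimately show ?thesis by simp
  qed
  let ?f = "\<lambda>i. if i = 1 then u else if i = Suc N then c *s z N else z (i - 1)"
  have "frame (Suc N) ?f"
  proof (rule adapted_frameI[OF ad])
    have z_in: "z j \<in> span (?f ` {1..Suc N})" if j: "1 \<le> j" "j \<le> N" for j
    proof (cases "j = N")
      case False
      then show ?thesis using j by (intro span_base image_eqI[of _ _ "Suc j"]) auto
    next
      case True
      have "c *s z N \<in> span (?f ` {1..Suc N})"
        using N by (intro span_base image_eqI[of _ _ "Suc N"]) auto
      then have "inverse c *s (c *s z N) \<in> span (?f ` {1..Suc N})" by (rule span_scale)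
      then show ?thesis using c0 True by simp
    qed
    then show "z j \<in> span (?f ` {1..Suc N})" if "1 \<le> j" "j \<le> N" for j using that .
    show "?f i \<in> C" if "i \<in> {1..Suc N}" for i using that uC xz(2)[of "i - 1"] xz(2)[of N] N by auto
    have "u \<in> span (?f ` {1..Suc N})" by (intro span_base image_eqI[of _ _ 1]) auto
    then have "u - t *s z 1 \<in> span (?f ` {1..Suc N})"
      using z_in[of 1] N by (intro span_diff span_scale) auto
    then show "x \<in> span (?f ` {1..Suc N})" by (simp add: u_def)
  qed
  then show ?thesis
  proof (rule frame_listed)
    show "NGF3 \<in> listed (Suc N)" using odd by (simp add: listed_def)
    fix i j assume ij: "i \<in> {1..Suc N}" "j \<in> {1..Suc N}"
    consider "i = 1" "j = 1" | "i = 1" "j \<ge> 2" | "i \<ge> 2" "j = 1" | "i \<ge> 2" "j \<ge> 2"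
      using ij by fastforce
    then show "?f i \<star> ?f j = comb (Suc N) ?f (family_table (Suc N) NGF3 i j)"
    proof cases
      case 1
      then show ?thesis using uu N by simp
    next
      case 2
      consider "j = Suc N" | "j = N" | "j < N" using ij by fastforce
      then show ?thesis
        using uz[of "j - 1"] zu[of "j - 1"] uz[of N] zu[of N] 2 ij N uC xz(2)[of N]
        by cases (auto simp: bracket_simps)
    next
      case 3
      consider "i = Suc N" | "i = N" | "i < N" using ij by fastforce
      then show ?thesis
        using zu[of "i - 1"] zu[of N] 3 ij N uC xz(2)[of N]
        by cases (auto simp: bracket_simps)
    next
      case 4
      show ?thesis
      proof (cases "i = Suc N \<or> j = Suc N")
        case True
        then show ?thesis
          using 4 ij N zz[of N N] zz[of N "j - 1"] zz[of "i - 1" N] xz(2)[of N] xz(2)[of "i - 1"] xz(2)[of "j - 1"]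
          by (auto simp: bracket_simps)
      next
        case False
        have "z (i - 1) \<star> z (j - 1) = (if i + j = Suc N + 1 then ((-1)^(i+1) * c) *s z N else 0)"
        proof (cases "i + j = Suc N + 1")
          case True
          then have "even (j - 1 - 1) \<longleftrightarrow> even (i + 1)" using odd 4 by presburger
          then have "(-1)^(j-1-1) = ((-1)^(i+1) :: complex)" by (simp add: minus_one_power_iff)
          then show ?thesis using zz[of "i - 1" "j - 1"] True 4 ij False by auto
        next
          case ne: False
          then show ?thesis using zz[of "i - 1" "j - 1"] 4 ij False by auto
        qed
        then show ?thesis using False 4 ij by auto
      qed
    qed
  qed
qed

section \<open>Distribution over the cases\<close>

lemma case_antisymmetric:
  assumes had: "hadapted x z a d" and a: "a \<ge> 0" and chain: "chain x z"
    and phi: "z 2 \<star> x \<notin> LC 4" "z 2 \<star> z 1 \<in> LC 4"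
    and xx: "x \<star> x \<in> LC 3" and yy: "z 1 \<star> z 1 \<in> LC 3" and xy: "x \<star> z 1 + z 1 \<star> x \<in> LC 3"
  shows "\<exists>F\<in>listed (Suc N). alg_isomorphic L (family_alg (Suc N) F)"
proof -
  note ad = hadapted_adapted[OF had]
  let ?P = "const x z"
  interpret gc: graded_constants N ?P using ad phi by (rule graded_constants_const)
  note iff = const_eq_0_iff[OF ad]
  have P00: "?P 0 0 = 0" using iff[of 0 0] xx N by (simp add: numeral_3_eq_3)
  have P11: "?P 1 1 = 0" using iff[of 1 1] yy N by (simp add: numeral_3_eq_3)
  have xC: "x \<in> C" and zC: "z 1 \<in> C" using adapted_generators[OF ad] unfolding generators_def by auto
  have P01: "?P 0 1 = - ?P 1 0"
  proof -
    have l1: "lead z 2 (x \<star> z 1) (?P 0 1)" and l2: "lead z 2 (z 1 \<star> x) (?P 1 0)"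
      using lead_const[OF ad, of 0 1] lead_const[OF ad, of 1 0] N by (simp_all add: numeral_2_eq_2)
    have "lead z 2 (x \<star> z 1 + z 1 \<star> x) 0"
      using xy xC zC lead_0_iff[OF ad, of 2] by (simp add: numeral_3_eq_3)
    from lead_diff[OF ad this l1] have "lead z 2 (z 1 \<star> x) (- ?P 0 1)" by simp
    then have "- ?P 0 1 = ?P 1 0" using lead_unique[OF ad _ _ _ l2] N by simp
    then show ?thesis by (simp only: minus_equation_iff[of "?P 0 1"])
  qed
  have step: "z (i + 1) = z i \<star> x \<and> ?P i 0 = 1" if "1 \<le> i" "i < N" "?P i 0 \<noteq> 0" for i
  proof -
    have "z i \<star> x \<notin> LC (i + 2)" using iff[of i 0] that by simp
    then have eq: "z (i + 1) = z i \<star> x" using chain that unfolding chain_def by auto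
    have "z i \<star> x \<in> C" using xC adapted_closed[OF ad, of i] that by simp
    then have "lead z (i + 1) (z i \<star> x) 1" unfolding lead_def eq by (simp add: subspace_0)
    then show ?thesis using eq const_eqI[OF ad, of i 0 1] that by simp
  qed
  have "?P 1 0 \<noteq> 0" using gc.onto_2 P00 P11 P01 by auto
  then have P10: "?P 1 0 = 1" using step[of 1] N by simp
  interpret gl: graded_constants_lie N ?P
    by unfold_locales (use P00 P11 P01 P10 step in auto)
  show ?thesis
  proof (cases "\<forall>i. 2 \<le> i \<and> i < N \<longrightarrow> ?P i 1 = 0")
    case True
    have "?P i 0 \<noteq> 0" if "1 \<le> i" "i < N" for i
      using that True gc.onto[of i] P10 by (cases "i = 1") auto
    then have zS: "z (i + 1) = z i \<star> x" if "1 \<le> i" "i < N" for i using step that by blast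
    have zy: "z i \<star> z 1 \<in> LC (i + 2)" if "2 \<le> i" "i < N" for i
      using iff[of i 1] True that by simp
    show ?thesis using case_string_lie[OF had a zS xx yy zy xy] by simp
  next
    case False
    \<comment> \<open>The first weight at which \<open>y\<close> acts nontrivially at leading order.
      It exceeds 2 because \<open>z 2 \<star> z 1\<close> lies in \<open>LC 4\<close>, so
      \<open>switch\<close> applies with \<open>p = m - 1\<close>.\<close>
    define m where "m = (LEAST i. 2 \<le> i \<and> i < N \<and> ?P i 1 \<noteq> 0)"
    have m: "2 \<le> m" "m < N" "?P m 1 \<noteq> 0"
      using False LeastI_ex[of "\<lambda>i. 2 \<le> i \<and> i < N \<and> ?P i 1 \<noteq> 0"] unfolding m_def by auto
    have less: "?P i 1 = 0" if "2 \<le> i" "i < m" for i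
      using that m not_less_Least[of i "\<lambda>i. 2 \<le> i \<and> i < N \<and> ?P i 1 \<noteq> 0"] unfolding m_def by auto
    have m2: "m \<noteq> 2" using m gc.P_2_1 by auto
    define p where "p = m - 1"
    have p: "2 \<le> p" "p + 1 < N" "m = p + 1" using m m2 by (auto simp: p_def)
    have pz: "?P i 1 = 0" if "2 \<le> i" "i \<le> p" for i using less that p by simp
    have pnz: "?P (p + 1) 1 \<noteq> 0" using m p by simp
    note sw = gl.switch[OF p(1,2) pz pnz]
    have pN: "p + 2 = N" "odd p" using sw(1,2) by auto
    have nz: "?P i 0 \<noteq> 0" if "1 \<le> i" "i < N - 1" for i
      using that gc.onto[of i] pz[of i] P10 pN by (cases "i = 1") auto
    have oddN: "odd N" using pN by auto
    have N5: "N \<ge> 5" using pN p by (cases "p = 2") auto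
    show ?thesis
    proof (rule case_switch[OF had a oddN N5])
      show "z (i + 1) = z i \<star> x" "?P i 0 = 1" if "1 \<le> i" "i < N - 1" for i
        using step[of i] nz[OF that] that by auto
      show "?P 0 i = - ?P i 0" "?P 1 i = - ?P i 1" if "1 \<le> i" "i < N" for i
        using gl.antisymmetric that by auto
      have "N - 1 = p + 1" using pN by simp
      then show "?P (N - 1) 1 \<noteq> 0" using pnz by simp
    qed (rule P00 P11 sw(3) sw(4); assumption)+
  qed
qed

lemma good_z2:
  assumes "good x y a b" "hadapted x z a d" "z 1 = y"
  shows "z 2 \<star> x \<notin> LC 4" "z 2 \<star> z 1 \<in> LC 4"
proof -
  note ad = hadapted_adapted[OF assms(2)]
  have z2: "z 2 \<in> LC 2" "z 2 \<notin> LC 3" using adapted_LC[OF ad, of 2] adapted_notin[OF ad, of 2] N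
    by (auto simp: numeral_3_eq_3)
  have "x \<in> C" using adapted_generators[OF ad] unfolding generators_def by blast
  then show "z 2 \<star> x \<notin> LC 4" using bracket_LC_2_iff[OF z2] assms(1) unfolding good_def by blast
  show "z 2 \<star> z 1 \<in> LC 4" using assms z2 unfolding good_def by blast
qed

text \<open>This transports \<open>not_antisymmetric\<close> back from the constants. The first two
  conclusions do not depend on the basis, so \<open>z\<close> is quantified only in the
  third.\<close>

lemma good_not_antisymmetric:
  assumes g: "good x y a b"
    and na: "x \<star> x \<notin> LC 3 \<or> y \<star> y \<notin> LC 3 \<or> x \<star> y + y \<star> x \<notin> LC 3"
  shows "x \<star> y \<in> LC 3" "y \<star> y \<in> LC 3"
    "\<And>z d i. hadapted x z a d \<Longrightarrow> z 1 = y \<Longrightarrow> chain x z \<Longrightarrow> 2 \<le> i \<Longrightarrow> i < N \<Longrightarrow>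
      z (i + 1) = z i \<star> x \<and> z i \<star> y \<in> LC (i + 2)"
proof -
  have *: "x \<star> y \<in> LC 3 \<and> y \<star> y \<in> LC 3 \<and> (2 \<le> i \<and> i < N \<longrightarrow>
      z (i + 1) = z i \<star> x \<and> z i \<star> y \<in> LC (i + 2))"
    if had: "hadapted x z a d" and z1: "z 1 = y" and ch: "chain x z" for z d i
  proof -
    note ad = hadapted_adapted[OF had]
    let ?P = "const x z"
    interpret gc: graded_constants N ?P
      using ad good_z2[OF g had z1] by (rule graded_constants_const)
    note iff = const_eq_0_iff[OF ad]
    have xC: "x \<in> C" and zC: "y \<in> C" using adapted_generators[OF ad] z1 unfolding generators_def by auto
    have "?P 0 0 \<noteq> 0 \<or> ?P 1 1 \<noteq> 0 \<or> ?P 1 0 + ?P 0 1 \<noteq> 0"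
    proof (rule ccontr)
      assume n: "\<not> ?thesis"
      have "lead z 2 (x \<star> y) (?P 0 1)" "lead z 2 (y \<star> x) (?P 1 0)"
        using lead_const[OF ad, of 0 1] lead_const[OF ad, of 1 0] N z1 by (simp_all add: numeral_2_eq_2)
      then have "(x \<star> y - ?P 0 1 *s z 2) + (y \<star> x - ?P 1 0 *s z 2) \<in> LC 3"
        unfolding lead_def by (intro subspace_add) (auto simp: numeral_3_eq_3 numeral_2_eq_2)
      moreover have "?P 0 1 *s z 2 + ?P 1 0 *s z 2 = 0"
        using n by (simp add: add.commute flip: scale_left_distrib)
      then have "(x \<star> y - ?P 0 1 *s z 2) + (y \<star> x - ?P 1 0 *s z 2) = x \<star> y + y \<star> x"
        by (simp add: algebra_simps add_eq_0_iff)
      ultimately have "x \<star> y + y \<star> x \<in> LC 3" by (simp only:)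
      then show False
        using n na iff[of 0 0] iff[of 1 1] N z1 by (simp add: numeral_3_eq_3)
    qed
    note na' = gc.not_antisymmetric[OF this]
    have "z i \<star> x \<notin> LC (i + 2)" if "2 \<le> i" "i < N"
      using na'(3)[OF that] iff[of i 0] that by simp
    then have "z (i + 1) = z i \<star> x" if "2 \<le> i" "i < N"
      using ch that unfolding chain_def by auto
    then show ?thesis
      using na' iff[of 0 1] iff[of 1 1] iff[of i 1] N z1 by (auto simp: numeral_3_eq_3)
  qed
  obtain z d where "hadapted x z a d" "z 1 = y" "chain x z" using ex_chain[OF g] by blast
  from *[OF this] show "x \<star> y \<in> LC 3" "y \<star> y \<in> LC 3" by auto
  show "\<And>z d i. hadapted x z a d \<Longrightarrow> z 1 = y \<Longrightarrow> chain x z \<Longrightarrow> 2 \<le> i \<Longrightarrow> i < N \<Longrightarrow>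
      z (i + 1) = z i \<star> x \<and> z i \<star> y \<in> LC (i + 2)"
    using * by blast
qed

lemma case_null:
  assumes g: "good x y a b" and a: "a \<ge> 0" and xx: "x \<star> x \<in> LC 3" and yx: "y \<star> x \<notin> LC 3"
    and xy: "x \<star> y \<in> LC 3"
  shows False
proof -
  have "x \<star> y + y \<star> x \<notin> LC 3"
    using subspace_diff[OF subspace_LC, of "x \<star> y + y \<star> x" 3 "x \<star> y"] xy yx by auto
  then have na: "x \<star> x \<notin> LC 3 \<or> y \<star> y \<notin> LC 3 \<or> x \<star> y + y \<star> x \<notin> LC 3" by blast
  obtain z d where z: "hadapted x z a d" "z 1 = y" "chain x z" using ex_chain[OF g] by blast
  note na' = good_not_antisymmetric[OF g na]
  have zS: "z (i + 1) = z i \<star> x" if "1 \<le> i" "i < N" for i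
  proof (cases "i = 1")
    case True
    then show ?thesis using z yx N unfolding chain_def by (auto simp: numeral_3_eq_3)
  next
    case False
    then show ?thesis using na'(3)[OF z] that by simp
  qed
  show False
    using case_string_null[OF z(1) a zS xx] na'(2) na'(3)[OF z] xy z(2) by simp
qed

lemma listed_of_good:
  assumes g: "good x y a b" and a: "a \<ge> 0"
  shows "\<exists>F\<in>listed (Suc N). alg_isomorphic L (family_alg (Suc N) F)"
proof (cases "x \<star> x \<notin> LC 3 \<or> y \<star> y \<notin> LC 3 \<or> x \<star> y + y \<star> x \<notin> LC 3")
  case False
  obtain z d where z: "hadapted x z a d" "z 1 = y" "chain x z" using ex_chain[OF g] by blast
  show ?thesis using case_antisymmetric[OF z(1) a z(3) good_z2[OF g z(1,2)]] False z(2) by simp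
next
  case na: True
  note na' = good_not_antisymmetric[OF g na]
  have C: "x \<in> C" "y \<in> C" using g unfolding good_def generators_def by auto
  have sq: "u \<star> v \<in> LC 2" if "u \<in> C" "v \<in> C" for u v
    using bracket_LC_left[of u 1 v] that by (simp add: numeral_2_eq_2)
  show ?thesis
  proof (cases "y \<star> x \<in> LC 3")
    case True
    have xx: "x \<star> x \<notin> LC 3" using na na' True by (auto simp: subspace_add)
    obtain z d where z: "hadapted x z a d" "z 1 = y" "chain x z" using ex_chain[OF g] by blast
    have "z 2 = x \<star> x" using z True xx unfolding chain_def by simp
    then show ?thesis
      using case_square[OF z(1) a] na' na'(3)[OF z] True z(2) by simp
  next
    case yx: False
    obtain t where t: "x \<star> x - t *s (y \<star> x) \<in> LC 3"
      using LC_coefficient[of 2 "y \<star> x" "x \<star> x"] sq C yx N by (auto simp: numeral_3_eq_3)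
    \<comment> \<open>As \<open>x \<star> y\<close> and \<open>y \<star> y\<close> already lie in
      \<open>LC 3\<close>, subtracting \<open>t *s y\<close> changes the square of \<open>x\<close>
      by \<open>- t *s (y \<star> x)\<close> modulo \<open>LC 3\<close> and so removes its leading
      term.\<close>
    define x' where "x' = x - t *s y"
    have "x' \<star> x' = (x \<star> x - t *s (y \<star> x)) - t *s (x \<star> y) + t *s (t *s (y \<star> y))"
      using C by (simp add: x'_def bracket_simps scale_right_diff_distrib)
    moreover have "(x \<star> x - t *s (y \<star> x)) - t *s (x \<star> y) + t *s (t *s (y \<star> y)) \<in> LC 3"
      by (intro subspace_add[OF subspace_LC] subspace_diff[OF subspace_LC t]
          subspace_scale[OF subspace_LC] na'(1,2))
    ultimately have xx': "x' \<star> x' \<in> LC 3" by simp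
    have "y \<star> x' = y \<star> x - t *s (y \<star> y)" using C by (simp add: x'_def bracket_simps)
    then have yx': "y \<star> x' \<notin> LC 3"
      using yx na'(2) subspace_add[OF subspace_LC, of "y \<star> x'" 3 "t *s (y \<star> y)"]
      by (auto simp: subspace_scale)
    have "x' \<star> y = x \<star> y - t *s (y \<star> y)" using C by (simp add: x'_def bracket_simps)
    then have xy': "x' \<star> y \<in> LC 3" using na' by (simp add: subspace_diff subspace_scale)
    \<comment> \<open>If \<open>t\<close> is nonzero, the congruence between
      \<open>x \<star> x\<close> and \<open>y \<star> x\<close> forces \<open>a + a = b + a\<close>,
      so \<open>x\<close> and \<open>y\<close> share their degree.\<close>
    have x'V: "x' \<in> V a"
    proof (cases "t = 0")
      case True
      then show ?thesis using g by (simp add: x'_def good_def)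
    next
      case False
      have "x \<star> x \<notin> LC 3"
      proof
        assume "x \<star> x \<in> LC 3"
        then have "x \<star> x - (x \<star> x - t *s (y \<star> x)) \<in> LC 3"
          using subspace_diff[OF subspace_LC _ t] by blast
        then have "t *s (y \<star> x) \<in> LC 3" by simp
        then have "inverse t *s (t *s (y \<star> x)) \<in> LC 3" by (rule subspace_scale[OF subspace_LC])
        then show False using False yx by simp
      qed
      then have "a + a = b + a"
        using homogeneous_congruent[OF _ _ _ t] g unfolding good_def by (meson V_bracket one_le_numeral)
      then show ?thesis using g V_subspace unfolding x'_def good_def by (simp add: subspace_diff subspace_scale)
    qed
    have "good x' y a b"
    proof -
      obtain w where w: "w \<in> LC 2" "w \<star> x \<notin> LC 4" using g unfolding good_def by blast
      have wC: "w \<in> C" using w LC_closed by blast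
      have wy: "t *s (w \<star> y) \<in> LC 4" using g w unfolding good_def by (simp add: subspace_scale)
      have "w \<star> x = w \<star> x' + t *s (w \<star> y)" using C wC by (simp add: x'_def bracket_simps)
      then have "w \<star> x' \<notin> LC 4" using w wy subspace_add[OF subspace_LC] by metis
      then show ?thesis using g x'V generators_shear[of x y t] w unfolding good_def x'_def by blast
    qed
    then show ?thesis using case_null[OF _ a xx' yx' xy'] by blast
  qed
qed

lemma listed_exists:
  "\<exists>F\<in>listed (Suc N). alg_isomorphic L (family_alg (Suc N) F)"
proof -
  obtain x y a b where g: "good x y a b" using ex_good by blast
  show ?thesis
  proof (cases "a \<ge> 0")
    case True
    then show ?thesis using listed_of_good g by blast
  next
    case False
    interpret neg: complex_graded_filiform L N "\<lambda>i. V (- i)" "- l" "- k"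
    proof unfold_locales
      show "gradation L (\<lambda>i. V (- i))" using grad by (rule gradation_uminus)
      show "connected_between (\<lambda>i. V (- i)) (- l) (- k)"
        using conn unfolding connected_between_def by auto
    qed (use len alg_length in auto)
    have "neg.good x y (- a) (- b)"
      using g unfolding good_def neg.good_def by simp
    then show ?thesis using neg.listed_of_good False by simp
  qed
qed

end

section \<open>Small dimensions\<close>

context leibniz_algebra
begin

lemma frame_change:
  assumes "frame n e" "\<And>i. i \<in> {1..n} \<Longrightarrow> e' i \<in> C" "\<And>i. i \<in> {1..n} \<Longrightarrow> e i \<in> span (e' ` {1..n})"
  shows "frame n e'"
proof -
  have "e ` {1..n} \<subseteq> span (e' ` {1..n})" using assms(3) by blast
  then have "C \<subseteq> span (e' ` {1..n})"
    using assms(1) span_minimal[OF _ subspace_span] unfolding frame_def by (meson subset_trans)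
  then show ?thesis using assms(1,2) unfolding frame_def by blast
qed

lemma ex_frame: "has_dimension L n \<Longrightarrow> \<exists>e. frame n e"
proof -
  assume n: "has_dimension L n"
  then obtain B where B: "finite B" "card B = n" "span B = C" by (rule has_dimensionE)
  then obtain e where "bij_betw e {1..n} B" using ex_bij_betw_nat_finite_1[OF B(1)] by blast
  then have "e ` {1..n} = B" by (rule bij_betw_imp_surj_on)
  then show ?thesis using n B span_superset[of B] unfolding frame_def by auto
qed

lemma subset_0_of_dim_0:
  assumes "has_dimension L n" "W \<subseteq> C" "dim W = 0"
  shows "W \<subseteq> {0}"
proof -
  obtain B where B: "finite B" "span B = C" using assms(1) by (rule has_dimensionE)
  show ?thesis using spans_of_card_eq_dim[OF B(1), of W "{}"] assms B independent_empty by simp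
qed

end

text \<open>In dimension 3 the coefficient of \<open>(x + t *s y) \<star> (x + t *s y)\<close> is
  such a polynomial in \<open>t\<close>; a root provides an isotropic vector.\<close>

lemma root_of_quadratic:
  fixes A B D :: complex
  assumes "D \<noteq> 0"
  shows "\<exists>t. A + t * B + t * t * D = 0"
proof -
  define r where "r = csqrt (B\<^sup>2 - 4 * A * D)"
  have r: "r * r = B * B - 4 * A * D" by (simp add: r_def flip: power2_eq_square)
  define t where "t = (r - B) / (2 * D)"
  have t: "2 * D * t = r - B" using assms by (simp add: t_def)
  have "4 * D * (A + t * B + t * t * D) = 4 * A * D + 2 * B * (2 * D * t) + (2 * D * t) * (2 * D * t)"
    by algebra
  also have "\<dots> = 0" unfolding t using r by algebra
  finally show ?thesis using assms by auto
qed

context complex_leibniz_algebra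
begin

text \<open>The product is a bilinear form with values in the line of \<open>e 3\<close>, and
  \<open>e 2\<close> is isotropic. The length bound forbids isotropic vectors
  \<open>e 1 - t *s e 2\<close>, which makes the form antisymmetric between \<open>e 1\<close> and
  \<open>e 2\<close> and nonzero on \<open>e 1\<close>.\<close>

lemma listed_3_of_null:
  assumes e: "frame 3 e" and len: "alg_length L < 3"
    and ann: "\<And>u. u \<in> C \<Longrightarrow> u \<star> e 3 = 0" "\<And>u. u \<in> C \<Longrightarrow> e 3 \<star> u = 0"
    and br: "\<And>u v. u \<in> C \<Longrightarrow> v \<in> C \<Longrightarrow> u \<star> v \<in> span {e 3}"
    and null: "e 2 \<star> e 2 = 0"
  shows "\<exists>F\<in>listed 3. alg_isomorphic L (family_alg 3 F)"
proof -
  have C: "e 1 \<in> C" "e 2 \<in> C" "e 3 \<in> C" using frame_closed[OF e] by auto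
  obtain \<alpha> p r where \<alpha>: "e 1 \<star> e 1 = \<alpha> *s e 3" and p: "e 1 \<star> e 2 = p *s e 3"
    and r: "e 2 \<star> e 1 = r *s e 3"
    using br C by (auto simp: span_singleton image_iff) metis
  have three: "i = 1 \<or> i = 2 \<or> i = 3" if "i \<in> {1..3}" for i :: nat using that by auto
  \<comment> \<open>Such an \<open>f\<close> could replace \<open>e 1\<close>, and the degrees 1, 2,
    3 on \<open>f, e 2, e 3\<close> would give length 3.\<close>
  have no_null: "f \<star> f \<noteq> 0" if f: "f = e 1 - t *s e 2" for f t
  proof
    assume ff: "f \<star> f = 0"
    let ?f = "\<lambda>i. if i = 1 then f else e i"
    have fC: "f \<in> C" using f C by simp
    have "frame 3 ?f"
    proof (rule frame_change[OF e])
      show "?f i \<in> C" if "i \<in> {1..3}" for i using fC C three[OF that] by auto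
      have "f + t *s e 2 \<in> span (?f ` {1..3})"
      proof (intro span_add span_scale)
        show "f \<in> span (?f ` {1..3})" by (intro span_base image_eqI[of _ _ 1]) auto
        show "e 2 \<in> span (?f ` {1..3})" by (intro span_base image_eqI[of _ _ 2]) auto
      qed
      then have "e 1 \<in> span (?f ` {1..3})" using f by simp
      then show "e i \<in> span (?f ` {1..3})" if "i \<in> {1..3}" for i
        using that by (cases "i = 1") (auto intro!: span_base image_eqI[of _ _ i])
    qed
    then have "int 3 \<le> alg_length L"
    proof (rule alg_length_frame)
      fix i j :: nat assume ij: "i \<in> {1..3}" "j \<in> {1..3}"
      show "?f i \<star> ?f j \<in> (if i + j \<le> 3 then span {?f (i + j)} else {0})"
        using three[OF ij(1)] three[OF ij(2)] ff null ann fC C br[OF fC C(2)] br[OF C(2) fC]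
        by (elim disjE) (simp_all add: span_zero eval_nat_numeral)
    qed simp
    then show False using len by simp
  qed
  have pr: "p + r = 0"
  proof (rule ccontr)
    assume pr: "p + r \<noteq> 0"
    define t where "t = \<alpha> / (p + r)"
    have "(e 1 - t *s e 2) \<star> (e 1 - t *s e 2) = \<alpha> *s e 3 - (t * (p + r)) *s e 3"
      using C \<alpha> p r null by (simp add: bracket_simps algebra_simps scale_left_distrib)
    also have "t * (p + r) = \<alpha>" using pr by (simp add: t_def)
    finally show False using no_null by simp
  qed
  then have p': "p = - r" by (simp add: eq_neg_iff_add_eq_0)
  have \<alpha>0: "\<alpha> \<noteq> 0" using no_null[of "e 1" 0] \<alpha> by auto
  \<comment> \<open>For \<open>r \<noteq> 0\<close> this makes
    \<open>(\<beta> *s e 2) \<star> e 1\<close> equal to the last basis vector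
    \<open>\<alpha> *s e 3\<close>, as \<open>M4\<close> requires.\<close>
  define \<beta> where "\<beta> = (if r = 0 then 1 else \<alpha> / r)"
  have \<beta>0: "\<beta> \<noteq> 0" using \<alpha>0 by (simp add: \<beta>_def)
  let ?g = "\<lambda>i::nat. if i = 1 then e 1 else if i = 2 then \<beta> *s e 2 else \<alpha> *s e 3"
  have fr: "frame 3 ?g"
  proof (rule frame_change[OF e])
    show "?g i \<in> C" if "i \<in> {1..3}" for i using C by simp
    have "?g 1 \<in> span (?g ` {1..3})" by (intro span_base image_eqI[of _ _ 1]) auto
    moreover have "\<beta> *s e 2 \<in> span (?g ` {1..3})" by (intro span_base image_eqI[of _ _ 2]) auto
    from span_scale[OF this, of "inverse \<beta>"] have "e 2 \<in> span (?g ` {1..3})" using \<beta>0 by simp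
    moreover have "\<alpha> *s e 3 \<in> span (?g ` {1..3})" by (intro span_base image_eqI[of _ _ 3]) auto
    from span_scale[OF this, of "inverse \<alpha>"] have "e 3 \<in> span (?g ` {1..3})" using \<alpha>0 by simp
    ultimately show "e i \<in> span (?g ` {1..3})" if "i \<in> {1..3}" for i using three[OF that] by auto
  qed
  have out: "family_table 3 F i j m = 0"
    if "F \<in> listed 3" "i \<in> {1..3}" "j \<in> {1..3}" "m \<notin> {1..3}" for F i j m
    using family_table_outside[OF _ that] by simp
  define F where "F = (if r = 0 then NGF2 else M4)"
  have F: "F \<in> listed 3" by (simp add: F_def listed_def)
  have "alg_isomorphic L (family_alg 3 F)"
  proof (rule frame_family[OF fr _ out[OF F]])
    fix i j :: nat assume ij: "i \<in> {1..3}" "j \<in> {1..3}"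
    have \<beta>r: "r \<noteq> 0 \<Longrightarrow> \<beta> * r = \<alpha>" by (simp add: \<beta>_def)
    show "?g i \<star> ?g j = comb 3 ?g (family_table 3 F i j)"
      using three[OF ij(1)] three[OF ij(2)] \<alpha> p p' r null ann C \<beta>r
      by (elim disjE) (simp_all add: F_def bracket_simps)
  qed
  then show ?thesis using F by blast
qed

lemma listed_3:
  assumes n: "has_dimension L 3" and dim2: "dim (LC 2) = 1" and dim3: "dim (LC 3) = 0"
    and len: "alg_length L < 3"
  shows "\<exists>F\<in>listed 3. alg_isomorphic L (family_alg 3 F)"
proof -
  have LC3: "LC 3 \<subseteq> {0}" using subset_0_of_dim_0[OF n _ dim3] LC_closed by blast
  obtain T where T: "T \<subseteq> LC 2" "independent T" "LC 2 \<subseteq> span T" "card T = dim (LC 2)"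
    using basis_exists by blast
  then obtain w where w: "T = {w}" using dim2 by (metis card_1_singletonE)
  have TC: "T \<subseteq> C" using T(1) LC_closed by blast
  obtain B where B: "T \<subseteq> B" "B \<subseteq> C" "independent B" "C \<subseteq> span B"
    using maximal_independent_subset_extend[OF TC T(2)] by blast
  have "card B = 3" using basis_card_eq_dim[OF B(2,4,3)] has_dimension_dim[OF n] by simp
  then have fB: "finite B" by (simp add: card_ge_0_finite)
  have "card (B - {w}) = 2" using \<open>card B = 3\<close> B(1) w fB by simp
  then obtain x y where xy: "B - {w} = {x, y}" by (meson card_2_iff)
  then have Bw: "B = {x, y, w}" using B(1) w by auto
  define e where "e i = (if i = 1 then x else if i = 2 then y else w)" for i :: nat
  have i3: "{1..3::nat} = {1, 2, 3}" by auto
  have "e ` {1..3} = B" unfolding i3 Bw by (auto simp: e_def)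
  then have fr: "frame 3 e" unfolding frame_def using n B by simp
  have "w \<in> LC 2" using T w by simp
  have sq: "u \<star> v \<in> span {w}" if "u \<in> C" "v \<in> C" for u v
    using bracket_LC_left[of u 1 v] that T(3) w by (auto simp: numeral_2_eq_2)
  have ann: "u \<star> w = 0" "w \<star> u = 0" if "u \<in> C" for u
    using bracket_LC[of 1 2 u w] bracket_LC_left[of w 2 u] that \<open>w \<in> LC 2\<close> LC3
    by (auto simp: eval_nat_numeral)
  have xyC: "x \<in> C" "y \<in> C" "w \<in> C" using B Bw by auto
  obtain A where A: "x \<star> x = A *s w" using sq[of x x] xyC by (auto simp: span_singleton)
  obtain D where D: "y \<star> y = D *s w" using sq[of y y] xyC by (auto simp: span_singleton)
  obtain E where E: "x \<star> y = E *s w" using sq[of x y] xyC by (auto simp: span_singleton)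
  obtain F where F: "y \<star> x = F *s w" using sq[of y x] xyC by (auto simp: span_singleton)
  show ?thesis
  proof (cases "D = 0")
    case True
    show ?thesis
      by (rule listed_3_of_null[OF fr len]) (use ann sq True D in \<open>simp_all add: e_def\<close>)
  next
    case False
    obtain t where t: "A + t * (E + F) + t * t * D = 0" using root_of_quadratic[OF False] by blast
    define v where "v = x + t *s y"
    have "v \<star> v = (A + t * (E + F) + t * t * D) *s w"
      using xyC A D E F by (simp add: v_def bracket_simps scale_left_distrib algebra_simps)
    then have vv: "v \<star> v = 0" using t by simp
    let ?f = "\<lambda>i::nat. if i = 1 then y else if i = 2 then v else w"
    have fr': "frame 3 ?f"
    proof (rule frame_change[OF fr])
      show "?f i \<in> C" if "i \<in> {1..3}" for i using xyC by (simp add: v_def)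
      have "v - t *s y \<in> span (?f ` {1..3})"
      proof (intro span_diff span_scale)
        show "v \<in> span (?f ` {1..3})" by (intro span_base image_eqI[of _ _ 2]) auto
        show "y \<in> span (?f ` {1..3})" by (intro span_base image_eqI[of _ _ 1]) auto
      qed
      then have "x \<in> span (?f ` {1..3})" by (simp add: v_def)
      moreover have "y \<in> span (?f ` {1..3})" by (intro span_base image_eqI[of _ _ 1]) auto
      moreover have "w \<in> span (?f ` {1..3})" by (intro span_base image_eqI[of _ _ 3]) auto
      ultimately show "e i \<in> span (?f ` {1..3})" if "i \<in> {1..3}" for i by (simp add: e_def)
    qed
    show ?thesis
      by (rule listed_3_of_null[OF fr' len]) (use ann sq vv in simp_all)
  qed
qed

end

text \<open>Dimension 1 is excluded since a nonzero algebra has length at least 1, and dimension 2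
  since the product is zero and the length is 2. The zero space matches a table over an empty index
  set.\<close>

lemma classification:
  fixes L :: "(complex, 'a::ab_group_add) alg"
  assumes fil: "filiform L n" and len: "alg_length L = int n - 1"
  shows "\<exists>F\<in>listed n. alg_isomorphic L (family_alg n F)"
proof -
  interpret leibniz_algebra L using fil unfolding filiform_def by blast
  interpret complex_leibniz_algebra L by unfold_locales
  have n: "has_dimension L n" and dim: "\<And>i. 2 \<le> i \<Longrightarrow> i \<le> n \<Longrightarrow> dim (LC i) = n - i"
    using fil unfolding filiform_def by auto
  consider "n = 0" | "n = 1" | "n = 2" | "n = 3" | "n \<ge> 4" by linarith
  then show ?thesis
  proof cases
    case 1
    obtain e where "frame 0 e" using ex_frame n 1 by blast
    then have "alg_isomorphic L (family_alg 0 NGF2)" by (rule frame_family) auto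
    then show ?thesis using 1 by (auto simp: listed_def)
  next
    case 2
    then show ?thesis using alg_length(1)[OF n] len by (auto simp: connected_between_def)
  next
    case 3
    have LC2: "LC 2 \<subseteq> {0}" using subset_0_of_dim_0[OF n, of "LC 2"] dim[of 2] 3 LC_closed by auto
    obtain e where e: "frame n e" using ex_frame n by blast
    have "u \<star> v = 0" if "u \<in> C" "v \<in> C" for u v
      using bracket_LC_left[of u 1 v] that LC2 by (auto simp: numeral_2_eq_2)
    then have "int n \<le> alg_length L"
      using 3 frame_closed[OF e] by (intro alg_length_frame[OF e]) (auto simp: span_zero)
    then show ?thesis using len by simp
  next
    case 4
    show ?thesis using listed_3 n dim[of 2] dim[of 3] len 4 by simp
  next
    case 5
    obtain V k l where V: "gradation L V" "connected_between V k l" "l - k + 1 = alg_length L"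
      using alg_length(1)[OF n] 5 by auto
    interpret complex_graded_filiform L "n - 1" V k l
      by unfold_locales (use V 5 n dim len in \<open>auto simp: of_nat_diff\<close>)
    show ?thesis using listed_exists 5 by simp
  qed
qed

section \<open>The listed algebras are pairwise non-isomorphic\<close>

lemma carrier_family_alg: "x \<in> alg_carrier (family_alg n F) \<longleftrightarrow> (\<forall>i. i \<notin> {1..n} \<longrightarrow> x i = 0)"
  by (simp add: family_alg_def carrier_table_alg)

lemma basis_vec_carrier [simp]: "i \<in> {1..n} \<Longrightarrow> basis_vec i \<in> alg_carrier (family_alg n F)"
  by (auto simp: carrier_family_alg basis_vec_def)

lemma scale_family_alg: "alg_scale (family_alg n F) = fun_scale"
  by (simp add: family_alg_def table_alg_def)

lemma bracket_basis_vec: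
  assumes "i \<in> {1..n}" "j \<in> {1..n}"
  shows "bracket (family_alg n F) (basis_vec i) (basis_vec j) = family_table n F i j"
proof
  fix m
  have "bracket (family_alg n F) (basis_vec i) (basis_vec j) m
      = (\<Sum>i'=1..n. \<Sum>j'=1..n. if i' = i then (if j' = j then family_table n F i' j' m else 0) else 0)"
    unfolding family_alg_def bracket_table_alg by (intro sum.cong refl) (simp add: basis_vec_def)
  also have "\<dots> = (\<Sum>i'=1..n. if i' = i then (\<Sum>j'=1..n. if j' = j then family_table n F i' j' m else 0) else 0)"
    by (intro sum.cong refl) simp
  also have "\<dots> = family_table n F i j m" using assms by simp
  finally show "bracket (family_alg n F) (basis_vec i) (basis_vec j) m = family_table n F i j m" .
qed

lemma bracket_family_closed:
  assumes "n \<ge> 3" "F \<in> listed n"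
  shows "bracket (family_alg n F) x y \<in> alg_carrier (family_alg n F)"
  unfolding carrier_family_alg unfolding family_alg_def bracket_table_alg
  using family_table_outside[OF assms] by (auto intro!: sum.neutral)

lemma family_alg_isomorphic_sym:
  assumes "n \<ge> 3" "F \<in> listed n" "alg_isomorphic (family_alg n F) M"
  shows "alg_isomorphic M (family_alg n F)"
  using assms(3)
  by (rule alg_isomorphic_sym)
    (auto simp: carrier_family_alg scale_family_alg fun_scale_apply
      bracket_family_closed[OF assms(1,2), unfolded carrier_family_alg])

lemma alg_isomorphicE:
  assumes "alg_isomorphic (family_alg n F) (family_alg n G)"
  obtains f where "\<And>x. x \<in> alg_carrier (family_alg n F) \<Longrightarrow> f x \<in> alg_carrier (family_alg n G)"
    "\<And>y. y \<in> alg_carrier (family_alg n G) \<Longrightarrow> \<exists>x\<in>alg_carrier (family_alg n F). y = f x"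
    "\<And>x y. x \<in> alg_carrier (family_alg n F) \<Longrightarrow> y \<in> alg_carrier (family_alg n F) \<Longrightarrow> f (x + y) = f x + f y"
    "\<And>a x. x \<in> alg_carrier (family_alg n F) \<Longrightarrow> f (fun_scale a x) = fun_scale a (f x)"
    "\<And>x y. x \<in> alg_carrier (family_alg n F) \<Longrightarrow> y \<in> alg_carrier (family_alg n F) \<Longrightarrow>
      f (bracket (family_alg n F) x y) = bracket (family_alg n G) (f x) (f y)"
    "f 0 = 0" "inj_on f (alg_carrier (family_alg n F))"
proof -
  obtain f where f: "bij_betw f (alg_carrier (family_alg n F)) (alg_carrier (family_alg n G))"
    "\<forall>x\<in>alg_carrier (family_alg n F). \<forall>y\<in>alg_carrier (family_alg n F). f (x + y) = f x + f y"
    "\<forall>a. \<forall>x\<in>alg_carrier (family_alg n F). f (fun_scale a x) = fun_scale a (f x)"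
    "\<forall>x\<in>alg_carrier (family_alg n F). \<forall>y\<in>alg_carrier (family_alg n F).
      f (bracket (family_alg n F) x y) = bracket (family_alg n G) (f x) (f y)"
    using assms unfolding alg_isomorphic_def scale_family_alg by blast
  have "0 \<in> alg_carrier (family_alg n F)" by (simp add: carrier_family_alg)
  then have "f (0 + 0) = f 0 + f 0" using f(2) by blast
  then have "f 0 = 0" by simp
  then show ?thesis
    using f that[of f] unfolding bij_betw_def by blast
qed

section \<open>Invariants separating \<open>NGF3\<close>, \<open>M4\<close> and \<open>NGF2\<close>
  from the rest\<close>

definition square_free :: "nat \<Rightarrow> family \<Rightarrow> bool" where
  "square_free n F \<longleftrightarrow> (\<forall>x\<in>alg_carrier (family_alg n F). bracket (family_alg n F) x x = 0)"

definition right_null :: "nat \<Rightarrow> family \<Rightarrow> bool" where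
  "right_null n F \<longleftrightarrow> (\<forall>x\<in>alg_carrier (family_alg n F). \<forall>y\<in>alg_carrier (family_alg n F).
    \<forall>z\<in>alg_carrier (family_alg n F).
      bracket (family_alg n F) x (bracket (family_alg n F) y z) = 0)"

text \<open>In \<open>NGF2\<close> the coordinate 4 of \<open>[[y, y], y]\<close> is the cube of
  \<open>y 1\<close>, and \<open>y 1 = 0\<close> kills right multiplication by \<open>y\<close>. In
  \<open>M1\<close>, \<open>M2\<close> and \<open>M3\<close> the last basis vector acts nontrivially
  from the right although its cube is zero.\<close>

definition cube_null :: "nat \<Rightarrow> family \<Rightarrow> bool" where
  "cube_null n F \<longleftrightarrow> (\<exists>x\<in>alg_carrier (family_alg n F). \<exists>y\<in>alg_carrier (family_alg n F).
    bracket (family_alg n F) (bracket (family_alg n F) y y) y = 0 \<and> bracket (family_alg n F) x y \<noteq> 0)"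

lemma invariants_transfer:
  assumes n: "n \<ge> 3" "F \<in> listed n" and iso: "alg_isomorphic (family_alg n F) (family_alg n G)"
  shows "square_free n F \<Longrightarrow> square_free n G" "right_null n F \<Longrightarrow> right_null n G"
    "cube_null n F \<Longrightarrow> cube_null n G"
proof -
  let ?A = "family_alg n F" and ?B = "family_alg n G"
  note cl = bracket_family_closed[OF n]
  obtain f where f: "\<And>x. x \<in> alg_carrier ?A \<Longrightarrow> f x \<in> alg_carrier ?B"
    "\<And>y. y \<in> alg_carrier ?B \<Longrightarrow> \<exists>x\<in>alg_carrier ?A. y = f x"
    "\<And>x y. x \<in> alg_carrier ?A \<Longrightarrow> y \<in> alg_carrier ?A \<Longrightarrow> f (bracket ?A x y) = bracket ?B (f x) (f y)"
    "f 0 = 0" "inj_on f (alg_carrier ?A)"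
    by (rule alg_isomorphicE[OF iso]) blast
  have f0: "f x = 0 \<longleftrightarrow> x = 0" if "x \<in> alg_carrier ?A" for x
  proof -
    have "0 \<in> alg_carrier ?A" by (simp add: carrier_family_alg)
    then show ?thesis using inj_on_eq_iff[OF f(5) that, of 0] f(4) by simp
  qed
  show "square_free n G" if "square_free n F"
    unfolding square_free_def
  proof
    fix x assume "x \<in> alg_carrier ?B"
    then obtain x' where "x' \<in> alg_carrier ?A" "x = f x'" using f(2) by blast
    then show "bracket ?B x x = 0" using that f(3)[of x' x'] f(4) unfolding square_free_def by simp
  qed
  show "right_null n G" if "right_null n F"
    unfolding right_null_def
  proof (intro ballI)
    fix x y z assume "x \<in> alg_carrier ?B" "y \<in> alg_carrier ?B" "z \<in> alg_carrier ?B"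
    then obtain x' y' z' where "x' \<in> alg_carrier ?A" "x = f x'" "y' \<in> alg_carrier ?A" "y = f y'"
      "z' \<in> alg_carrier ?A" "z = f z'" using f(2) by meson
    then show "bracket ?B x (bracket ?B y z) = 0"
      using that f(3)[of y' z'] f(3)[of x' "bracket ?A y' z'"] f(4) cl unfolding right_null_def by simp
  qed
  show "cube_null n G" if cn: "cube_null n F"
  proof -
    obtain x y where xy: "x \<in> alg_carrier ?A" "y \<in> alg_carrier ?A"
      "bracket ?A (bracket ?A y y) y = 0" "bracket ?A x y \<noteq> 0"
      using cn unfolding cube_null_def by blast
    have "bracket ?B (bracket ?B (f y) (f y)) (f y) = 0"
      using xy f(3)[of y y] f(3)[of "bracket ?A y y" y] f(4) cl by simp
    moreover have "bracket ?B (f x) (f y) \<noteq> 0"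
    proof -
      have "f (bracket ?A x y) \<noteq> 0" using xy f0[OF cl] by blast
      then show ?thesis using f(3)[OF xy(1,2)] by metis
    qed
    ultimately show ?thesis using f(1) xy unfolding cube_null_def by blast
  qed
qed

lemma square_free_NGF3: "even n \<Longrightarrow> square_free n NGF3"
  unfolding square_free_def
proof
  fix x assume n: "even n"
  have anti: "family_table n NGF3 i j m = - family_table n NGF3 j i m"
    if "i \<in> {1..n}" "j \<in> {1..n}" for i j m
  proof -
    have "i + j = n + 1 \<Longrightarrow> even (i + 1) \<longleftrightarrow> \<not> even (j + 1)" using n by presburger
    then have "i + j = n + 1 \<Longrightarrow> (-1)^(i+1) = - ((-1)^(j+1) :: complex)"
      by (auto simp: minus_one_power_iff)
    then show ?thesis using that by (auto simp: fun_scale_apply)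
  qed
  show "bracket (family_alg n NGF3) x x = 0"
  proof
    fix m
    let ?p = "\<lambda>i j. family_table n NGF3 i j m"
    let ?S = "\<Sum>i=1..n. \<Sum>j=1..n. x i * x j * ?p i j"
    have "?S = (\<Sum>i=1..n. \<Sum>j=1..n. x j * x i * ?p j i)" by (rule sum.swap)
    also have "\<dots> = (\<Sum>i=1..n. \<Sum>j=1..n. - (x i * x j * ?p i j))"
    proof (intro sum.cong refl)
      fix i j assume "i \<in> {1..n}" "j \<in> {1..n}"
      then have "?p j i = - ?p i j" by (rule anti[rotated])
      then show "x j * x i * ?p j i = - (x i * x j * ?p i j)" by (simp only: mult_minus_right mult.commute)
    qed
    also have "\<dots> = - ?S" by (simp add: sum_negf del: family_table.simps)
    finally have "?S = 0" by (simp del: family_table.simps)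
    then show "bracket (family_alg n NGF3) x x m = 0 m"
      unfolding family_alg_def bracket_table_alg by simp
  qed
qed

lemma not_square_free: "n \<ge> 4 \<Longrightarrow> F \<noteq> NGF3 \<Longrightarrow> \<not> square_free n F"
proof
  assume n: "n \<ge> 4" and F: "F \<noteq> NGF3" and sf: "square_free n F"
  have "1 \<in> {1..n}" using n by simp
  then have "family_table n F 1 1 = 0"
    using sf bracket_basis_vec[of 1 n 1 F] unfolding square_free_def by (metis basis_vec_carrier)
  moreover have "\<exists>m. family_table n F 1 1 = basis_vec m" using n F by (cases F) auto
  ultimately obtain m where "basis_vec m = 0" by metis
  then have "basis_vec m m = 0" by simp
  then show False by (simp add: basis_vec_def)
qed

lemma not_right_null_M4: "n \<ge> 4 \<Longrightarrow> \<not> right_null n M4"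
proof
  assume n: "n \<ge> 4" and rn: "right_null n M4"
  have 1: "bracket (family_alg n M4) (basis_vec 2) (basis_vec 1) = basis_vec 3"
    using n bracket_basis_vec[of 2 n 1 M4] by auto
  have 2: "bracket (family_alg n M4) (basis_vec 1) (basis_vec 3) = - basis_vec 4"
    using n bracket_basis_vec[of 1 n 3 M4] by auto
  have "bracket (family_alg n M4) (basis_vec 1) (bracket (family_alg n M4) (basis_vec 2) (basis_vec 1)) = 0"
    using rn n unfolding right_null_def by simp
  then have "- basis_vec 4 = 0" using 1 2 by simp
  then have "(- basis_vec 4) 4 = 0" by (simp only: zero_fun_def)
  then show False by (simp add: basis_vec_def)
qed

lemma right_null_listed:
  assumes n: "n \<ge> 4" and F: "F \<in> listed n" "F \<noteq> NGF3" "F \<noteq> M4"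
  shows "right_null n F"
proof -
  \<comment> \<open>The indices whose basis vectors can act nontrivially from the right. Products
    have no coordinates in \<open>J\<close>, so a product used as a right factor gives 0.\<close>
  define J where "J = (if F = NGF2 then {1} else {1, n})"
  have J1: "family_table n F i j = 0" if "j \<notin> J" for i j
    using F that n by (cases F) (auto simp: J_def)
  have J2: "family_table n F i j m = 0" if "m \<in> J" "i \<in> {1..n}" "j \<in> {1..n}" for i j m
  proof -
    have b: "basis_vec p m = 0" if "p \<notin> J" for p
      using that \<open>m \<in> J\<close> by (auto simp: basis_vec_def)
    show ?thesis
    proof (cases F)
      case NGF2
      then have J: "J = {1}" by (simp add: J_def)
      then have "i + 1 \<notin> J" "3 \<notin> J" using \<open>i \<in> {1..n}\<close> by auto
      then show ?thesis using NGF2 b by simp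
    next
      case (M1 k)
      then have J: "J = {1, n}" by (simp add: J_def)
      have "i \<le> n - 2 \<Longrightarrow> i + 1 \<notin> J" "i \<le> n - k \<Longrightarrow> k + i - 1 \<notin> J"
        using F(1) M1 \<open>i \<in> {1..n}\<close> n unfolding J by (auto simp: listed_def split: if_splits)
      then show ?thesis using M1 b by simp
    next
      case (M2 \<alpha>)
      then have J: "J = {1, n}" by (simp add: J_def)
      have "(n + 1) div 2 + (n - 1) div 2 \<le> n" "2 \<le> (n + 1) div 2" using n by linarith+
      then have "i \<le> (n - 1) div 2 \<Longrightarrow> (n + 1) div 2 + i - 1 \<notin> J"
        using \<open>i \<in> {1..n}\<close> n unfolding J by auto
      moreover have "i \<le> n - 2 \<Longrightarrow> i + 1 \<notin> J" "n - 1 \<notin> J"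
        using \<open>i \<in> {1..n}\<close> n unfolding J by auto
      ultimately show ?thesis using M2 b unfolding family_table.simps by (auto simp: fun_scale_apply)
    next
      case M3
      then have J: "J = {1, n}" by (simp add: J_def)
      have "i \<le> n - 2 \<Longrightarrow> i + 1 \<notin> J" "n - 1 \<notin> J"
        using \<open>i \<in> {1..n}\<close> n unfolding J by auto
      then show ?thesis using M3 b by simp
    qed (use F in auto)
  qed
  have w: "bracket (family_alg n F) y z m = 0" if "m \<in> J" for y z m
    unfolding family_alg_def bracket_table_alg using J2[OF that] by (auto intro!: sum.neutral)
  have "bracket (family_alg n F) x (bracket (family_alg n F) y z) = 0" for x y z
  proof
    fix m
    have "x i * bracket (family_alg n F) y z j * family_table n F i j m = 0" for i j
      using w[of j] J1[of j i] by (cases "j \<in> J") auto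
    then have "(\<Sum>i=1..n. \<Sum>j=1..n. x i * bracket (family_alg n F) y z j * family_table n F i j m) = 0"
      by (simp only: sum.neutral_const)
    then show "bracket (family_alg n F) x (bracket (family_alg n F) y z) m = 0 m"
      unfolding family_alg_def bracket_table_alg[of n _ x] by simp
  qed
  then show ?thesis unfolding right_null_def by blast
qed

lemma bracket_NGF2:
  assumes "n \<ge> 4"
  shows "bracket (family_alg n NGF2) x y 3 = x 1 * y 1" "bracket (family_alg n NGF2) x y 4 = x 3 * y 1"
    "y 1 = 0 \<Longrightarrow> bracket (family_alg n NGF2) x y = 0"
proof -
  have inner: "bracket (family_alg n NGF2) x y m = (\<Sum>i=1..n. x i * y 1 * family_table n NGF2 i 1 m)" for m
  proof -
    have "bracket (family_alg n NGF2) x y m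
        = (\<Sum>i=1..n. \<Sum>j=1..n. if j = 1 then x i * y j * family_table n NGF2 i j m else 0)"
      unfolding family_alg_def bracket_table_alg by (intro sum.cong refl) simp
    also have "\<dots> = (\<Sum>i=1..n. x i * y 1 * family_table n NGF2 i 1 m)"
      using assms by (intro sum.cong refl) (simp del: family_table.simps)
    finally show ?thesis .
  qed
  have "bracket (family_alg n NGF2) x y 3 = (\<Sum>i=1..n. if i = 1 then x i * y 1 else 0)"
    unfolding inner using assms by (intro sum.cong refl) (auto simp: basis_vec_def)
  then show "bracket (family_alg n NGF2) x y 3 = x 1 * y 1" using assms by simp
  have "bracket (family_alg n NGF2) x y 4 = (\<Sum>i=1..n. if i = 3 then x i * y 1 else 0)"
    unfolding inner using assms by (intro sum.cong refl) (auto simp: basis_vec_def)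
  then show "bracket (family_alg n NGF2) x y 4 = x 3 * y 1" using assms by simp
  show "y 1 = 0 \<Longrightarrow> bracket (family_alg n NGF2) x y = 0"
    by (rule ext) (simp add: inner del: family_table.simps)
qed

lemma not_cube_null_NGF2:
  assumes "n \<ge> 4"
  shows "\<not> cube_null n NGF2"
proof
  assume "cube_null n NGF2"
  then obtain x y where xy: "bracket (family_alg n NGF2) (bracket (family_alg n NGF2) y y) y = 0"
    "bracket (family_alg n NGF2) x y \<noteq> 0"
    unfolding cube_null_def by blast
  have "bracket (family_alg n NGF2) (bracket (family_alg n NGF2) y y) y 4 = y 1 * y 1 * y 1"
    using bracket_NGF2[OF assms] by simp
  then have "y 1 = 0" using xy(1) by simp
  then show False using bracket_NGF2(3)[OF assms] xy(2) by blast
qed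

text \<open>
  \<open>M\<^sub>1\<close>, \<open>M\<^sub>2\<close> and \<open>M\<^sub>3\<close> share the products \<open>[y\<^sub>i, y\<^sub>1] = y\<^sub>i\<^sub>+\<^sub>1\<close>, \<open>[y\<^sub>i, y\<^sub>n] = \<mu> y\<^sub>k\<^sub>+\<^sub>i\<^sub>-\<^sub>1\<close>, \<open>[y\<^sub>n, y\<^sub>n] = \<nu> y\<^sub>n\<^sub>-\<^sub>1\<close>.
\<close>

definition shift_bracket ::
    "nat \<Rightarrow> nat \<Rightarrow> complex \<Rightarrow> complex \<Rightarrow> (nat \<Rightarrow> complex) \<Rightarrow> (nat \<Rightarrow> complex) \<Rightarrow> nat \<Rightarrow> complex" where
  "shift_bracket n k \<mu> \<nu> x y m =
    (if 2 \<le> m \<and> m \<le> n - 1 then x (m - 1) * y 1 else 0)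
    + (if k \<le> m \<and> m \<le> n - 1 then \<mu> * (x (m + 1 - k) * y n) else 0)
    + (if m = n - 1 then \<nu> * (x n * y n) else 0)"

text \<open>\<open>M3\<close> receives the same \<open>k\<close> as \<open>M2\<close>, so that the
  two are compared at a common position and told apart by \<open>\<mu>\<close>.\<close>

fun shift_parameters :: "nat \<Rightarrow> family \<Rightarrow> nat \<times> complex \<times> complex" where
  "shift_parameters n (M1 k) = (k, 1, 0)"
| "shift_parameters n (M2 \<alpha>) = ((n + 1) div 2, 1, \<alpha>)"
| "shift_parameters n F = ((n + 1) div 2, 0, 1)"

text \<open>For fixed \<open>m\<close> each term is supported at a single pair
  \<open>(i, j)\<close>; the nested conditionals are the shape in which \<open>sum.delta\<close>
  collapses the double sum in \<open>bracket_shift\<close>.\<close>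

lemma shift_table:
  assumes n: "n \<ge> 4" and F: "F \<in> listed n" "F \<notin> {NGF2, NGF3, M4}"
    and par: "shift_parameters n F = (k, \<mu>, \<nu>)" and ij: "i \<in> {1..n}" "j \<in> {1..n}"
  shows "family_table n F i j m =
    (if j = 1 then if i = m - 1 then if 2 \<le> m \<and> m \<le> n - 1 then 1 else 0 else 0 else 0)
    + (if j = n then if i = m + 1 - k then if k \<le> m \<and> m \<le> n - 1 then \<mu> else 0 else 0 else 0)
    + (if j = n then if i = n then if m = n - 1 then \<nu> else 0 else 0 else 0)"
proof -
  have k: "3 \<le> k" "k \<le> n - 1 \<or> F = M3"
  proof -
    have "k = (n + 1) div 2 \<and> odd n \<or> (\<exists>k'. F = M1 k' \<and> k = k')"
      using F par by (cases F) (auto simp: listed_def split: if_splits)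
    moreover have "3 \<le> (n + 1) div 2 \<and> (n + 1) div 2 \<le> n - 1" if "odd n"
    proof -
      have "n \<ge> 5" using n that by (cases "n = 4") auto
      then show ?thesis by linarith
    qed
    ultimately show "3 \<le> k" "k \<le> n - 1 \<or> F = M3"
      using F by (auto simp: listed_def split: if_splits)
  qed
  have "i = m - 1 \<and> 2 \<le> m \<and> m \<le> n - 1 \<longleftrightarrow> i \<le> n - 2 \<and> m = i + 1" using ij n by auto
  then have 1: "(if i = m - 1 then if 2 \<le> m \<and> m \<le> n - 1 then 1 else 0 else 0)
    = (if i \<le> n - 2 \<and> m = i + 1 then 1 else 0 :: complex)" by (simp flip: if_if_eq_conj) auto
  have "i = m + 1 - k \<and> k \<le> m \<and> m \<le> n - 1 \<longleftrightarrow> i \<le> n - k \<and> m = k + i - 1" using ij k n by auto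
  then have 2: "(if i = m + 1 - k then if k \<le> m \<and> m \<le> n - 1 then \<mu> else 0 else 0)
    = (if i \<le> n - k \<and> m = k + i - 1 then \<mu> else 0)" by (simp flip: if_if_eq_conj) auto
  have 3: "n - k < n" using k n by simp
  show ?thesis
  proof (cases F)
    case (M1 k')
    then have "\<mu> = 1" "\<nu> = 0" "k' = k" using par by auto
    then show ?thesis unfolding 1 2 using M1 ij n 3 by (simp add: basis_vec_def)
  next
    case (M2 \<alpha>)
    then have "odd n" and p: "k = (n + 1) div 2" "\<mu> = 1" "\<nu> = \<alpha>"
      using F(1) par by (auto simp: listed_def split: if_splits)
    then have h: "(n - 1) div 2 = n - k" using n by presburger
    show ?thesis
      unfolding 1 2 M2 family_table.simps p(1)[symmetric] h
      using p(2,3) ij n 3 by (simp add: basis_vec_def fun_scale_apply)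
  next
    case M3
    then have "\<mu> = 0" "\<nu> = 1" using par by auto
    note defs = 1 2 M3 family_table.simps \<open>\<mu> = 0\<close> \<open>\<nu> = 1\<close> basis_vec_def
    show ?thesis
    proof (cases "j = 1")
      case True
      then have "j \<noteq> n" "1 \<le> i" using n ij by auto
      then show ?thesis unfolding defs using True by simp
    next
      case False
      then show ?thesis unfolding defs by (cases "j = n"; cases "i = n") simp_all
    qed
  qed (use F in auto)
qed

lemma bracket_shift:
  assumes n: "n \<ge> 4" and F: "F \<in> listed n" "F \<notin> {NGF2, NGF3, M4}"
    and par: "shift_parameters n F = (k, \<mu>, \<nu>)" and k: "3 \<le> k"
  shows "bracket (family_alg n F) x y m = shift_bracket n k \<mu> \<nu> x y m"
proof -
  define c1 c2 c3 where "c1 = (if 2 \<le> m \<and> m \<le> n - 1 then 1 else 0 :: complex)"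
    and "c2 = (if k \<le> m \<and> m \<le> n - 1 then \<mu> else 0)"
    and "c3 = (if m = n - 1 then \<nu> else 0)"
  have "bracket (family_alg n F) x y m
    = (\<Sum>i=1..n. \<Sum>j=1..n. (if j = 1 then if i = m - 1 then x i * y j * c1 else 0 else 0)
      + (if j = n then if i = m + 1 - k then x i * y j * c2 else 0 else 0)
      + (if j = n then if i = n then x i * y j * c3 else 0 else 0))"
    unfolding family_alg_def bracket_table_alg
    by (intro sum.cong refl)
      (simp add: shift_table[OF n F par] c1_def c2_def c3_def distrib_left del: family_table.simps)
  also have "\<dots> = (\<Sum>i=1..n. (if i = m - 1 then x i * y 1 * c1 else 0)
      + (if i = m + 1 - k then x i * y n * c2 else 0) + (if i = n then x i * y n * c3 else 0))"
    using n by (intro sum.cong refl) (simp add: sum.distrib)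
  also have "\<dots> = shift_bracket n k \<mu> \<nu> x y m"
  proof -
    have "m - 1 \<in> {1..n}" if "2 \<le> m \<and> m \<le> n - 1" using that by auto
    then have 1: "(if m - 1 \<in> {1..n} then x (m - 1) * y 1 * c1 else 0)
        = (if 2 \<le> m \<and> m \<le> n - 1 then x (m - 1) * y 1 else 0)"
      unfolding c1_def by simp
    have "m + 1 - k \<in> {1..n}" if "k \<le> m \<and> m \<le> n - 1" using that k by auto
    then have 2: "(if m + 1 - k \<in> {1..n} then x (m + 1 - k) * y n * c2 else 0)
        = (if k \<le> m \<and> m \<le> n - 1 then \<mu> * (x (m + 1 - k) * y n) else 0)"
      unfolding c2_def by simp
    have 3: "(if n \<in> {1..n} then x n * y n * c3 else 0) = (if m = n - 1 then \<nu> * (x n * y n) else 0)"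
      unfolding c3_def using n by simp
    show ?thesis
      unfolding shift_bracket_def 1[symmetric] 2[symmetric] 3[symmetric]
      by (simp only: sum.distrib sum.delta' sum.delta finite_atLeastAtMost)
  qed
  finally show ?thesis .
qed

section \<open>Isomorphisms among \<open>M1\<close>, \<open>M2\<close> and \<open>M3\<close>\<close>

lemma shift_bracket_first:
  "n \<ge> 4 \<Longrightarrow> shift_bracket n k \<mu> \<nu> x (basis_vec 1) m = (if 2 \<le> m \<and> m \<le> n - 1 then x (m - 1) else 0)"
  unfolding shift_bracket_def basis_vec_def by simp

lemma shift_bracket_last:
  "n \<ge> 4 \<Longrightarrow> shift_bracket n k \<mu> \<nu> x (basis_vec n) m =
    (if k \<le> m \<and> m \<le> n - 1 then \<mu> * x (m + 1 - k) else 0) + (if m = n - 1 then \<nu> * x n else 0)"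
  unfolding shift_bracket_def basis_vec_def by simp

text \<open>The square of the last basis vector is a multiple of \<open>basis_vec (n - 1)\<close>,
  and its right action raises indices by \<open>k - 1 \<ge> 2\<close>, which leaves the
  range.\<close>

lemma shift_cube:
  assumes n: "n \<ge> 4" and F: "F \<in> listed n" "F \<notin> {NGF2, NGF3, M4}"
    and par: "shift_parameters n F = (k, \<mu>, \<nu>)" and k: "3 \<le> k"
  shows "bracket (family_alg n F) (bracket (family_alg n F) (basis_vec n) (basis_vec n)) (basis_vec n) = 0"
proof
  fix m
  note br = bracket_shift[OF n F par k]
  have b: "basis_vec n 1 = 0" "basis_vec n n = 1" "\<And>i. i \<noteq> n \<Longrightarrow> basis_vec n i = 0"
    using n by (auto simp: basis_vec_def)
  define w where "w = bracket (family_alg n F) (basis_vec n) (basis_vec n)"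
  have w: "w i = 0" if "i \<noteq> n - 1" for i
  proof -
    have "(if k \<le> i \<and> i \<le> n - 1 then \<mu> * (basis_vec n (i + 1 - k) * basis_vec n n) else 0) = 0"
      using b(3)[of "i + 1 - k"] n k by auto
    then show ?thesis unfolding w_def br shift_bracket_def using \<open>i \<noteq> n - 1\<close> b(1) by simp
  qed
  have "n \<noteq> n - 1" using n by simp
  then have "w n = 0" by (rule w)
  moreover have z: "(if k \<le> m \<and> m \<le> n - 1 then \<mu> * (w (m + 1 - k) * basis_vec n n) else 0) = 0"
    using w[of "m + 1 - k"] n k by auto
  ultimately show "bracket (family_alg n F) w (basis_vec n) m = 0 m"
    unfolding br shift_bracket_def z using b(1) by simp
qed

text \<open>\<open>A\<close> is the first coordinate of the image of \<open>basis_vec 1\<close>, and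
  \<open>c\<close> the last coordinate of the image of \<open>basis_vec n\<close>. The images are
  triangular with diagonal entries \<open>A ^ i\<close>. The two relations compare
  \<open>[y_n, y_n]\<close> in coordinate \<open>n - 1\<close> and \<open>[y_1, y_n]\<close> in its
  first nonzero coordinate; the latter must be at most \<open>n - 2\<close>, before the term with
  \<open>\<nu>\<close> enters.\<close>

lemma isomorphic_shift:
  assumes n: "n \<ge> 4" and F: "F \<in> listed n" "F \<notin> {NGF2, NGF3, M4}"
    and parF: "shift_parameters n F = (k, \<mu>, \<nu>)" and k: "3 \<le> k" "k \<le> n - 1"
    and G: "G \<in> listed n" "G \<notin> {NGF2, NGF3, M4}"
    and parG: "shift_parameters n G = (k', \<mu>', \<nu>')" and k': "3 \<le> k'" "k' \<le> n - 1"
    and iso: "alg_isomorphic (family_alg n F) (family_alg n G)"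
  obtains A c where "A \<noteq> 0" "c \<noteq> 0" "c\<^sup>2 * \<nu>' = \<nu> * A ^ (n - 1)"
    "k' \<le> n - 2 \<Longrightarrow> k' < k \<or> \<mu> = 0 \<Longrightarrow> \<mu>' = 0"
    "k \<le> n - 2 \<Longrightarrow> k < k' \<or> \<mu>' = 0 \<Longrightarrow> \<mu> = 0"
    "k = k' \<Longrightarrow> k \<le> n - 2 \<Longrightarrow> \<mu>' * c * A = \<mu> * A ^ k"
proof -
  let ?A = "family_alg n F" and ?B = "family_alg n G"
  note brA = bracket_shift[OF n F parF k(1)] and brB = bracket_shift[OF n G parG k'(1)]
  obtain f where f: "\<And>x. x \<in> alg_carrier ?A \<Longrightarrow> f x \<in> alg_carrier ?B"
    "\<And>y. y \<in> alg_carrier ?B \<Longrightarrow> \<exists>x\<in>alg_carrier ?A. y = f x"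
    "\<And>x y. x \<in> alg_carrier ?A \<Longrightarrow> y \<in> alg_carrier ?A \<Longrightarrow> f (x + y) = f x + f y"
    "\<And>a x. x \<in> alg_carrier ?A \<Longrightarrow> f (fun_scale a x) = fun_scale a (f x)"
    "\<And>x y. x \<in> alg_carrier ?A \<Longrightarrow> y \<in> alg_carrier ?A \<Longrightarrow> f (bracket ?A x y) = bracket ?B (f x) (f y)"
    "f 0 = 0"
    by (rule alg_isomorphicE[OF iso]) blast
  have bv: "basis_vec i \<in> alg_carrier ?A" if "1 \<le> i" "i \<le> n" for i using that by simp
  define g u where "g = f (basis_vec 1)" and "u = f (basis_vec n)"
  define A c where "A = g 1" and "c = u n"
  have ends: "bracket ?B x y 1 = 0" "bracket ?B x y n = 0" for x y
    using n k' by (auto simp: brB shift_bracket_def)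
  have prod: "f (family_table n F i j) = bracket ?B (f (basis_vec i)) (f (basis_vec j))"
    if "1 \<le> i" "i \<le> n" "1 \<le> j" "j \<le> n" for i j
    using f(5)[OF bv[OF that(1,2)] bv[OF that(3,4)]] bracket_basis_vec[of i n j F] that by simp
  have A_c: "A \<noteq> 0 \<and> c \<noteq> 0 \<and> u 1 = 0"
  proof -
    \<comment> \<open>Products have zero coordinates 1 and \<open>n\<close>, so in these two
      coordinates only the images \<open>g\<close> and \<open>u\<close> of the generators count.
      Surjectivity then makes \<open>A\<close> and \<open>c\<close> nonzero.\<close>
    have expand: "\<exists>a b w. f v = fun_scale a g + fun_scale b u + w \<and> w 1 = 0 \<and> w n = 0"
      if v: "v \<in> alg_carrier ?A" for v
    proof -
      define w where "w i = (if 1 \<le> i \<and> i \<le> n - 2 then v (i + 1) else 0)" for i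
      have wc: "w \<in> alg_carrier ?A" using n by (auto simp: carrier_family_alg w_def)
      have "v = fun_scale (v 1) (basis_vec 1) + fun_scale (v n) (basis_vec n) + bracket ?A w (basis_vec 1)"
      proof
        fix i
        have out: "v i = 0" if "i \<notin> {1..n}" using v that by (simp add: carrier_family_alg)
        have br: "bracket ?A w (basis_vec 1) i = (if 2 \<le> i \<and> i \<le> n - 1 then v i else 0)"
        proof -
          have "w (i - 1) = v i" if "2 \<le> i \<and> i \<le> n - 1" using that by (auto simp: w_def)
          moreover have "basis_vec 1 1 = 1" "basis_vec 1 n = 0" using n by (auto simp: basis_vec_def)
          ultimately show ?thesis unfolding brA shift_bracket_def by simp
        qed
        consider "i \<notin> {1..n}" | "i = 1" | "i = n" | "2 \<le> i" "i \<le> n - 1" by fastforce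
        then show "v i = (fun_scale (v 1) (basis_vec 1) + fun_scale (v n) (basis_vec n)
            + bracket ?A w (basis_vec 1)) i"
          unfolding plus_fun_apply br using n out by cases (auto simp: fun_scale_apply basis_vec_def)
      qed
      moreover have "fun_scale (v 1) (basis_vec 1) \<in> alg_carrier ?A" "fun_scale (v n) (basis_vec n) \<in> alg_carrier ?A"
        "fun_scale (v 1) (basis_vec 1) + fun_scale (v n) (basis_vec n) \<in> alg_carrier ?A"
        "bracket ?A w (basis_vec 1) \<in> alg_carrier ?A"
        using n bracket_family_closed[of n F] F by (auto simp: carrier_family_alg fun_scale_apply basis_vec_def)
      ultimately have "f v = fun_scale (v 1) g + fun_scale (v n) u + bracket ?B (f w) g"
        using f(3)[of "fun_scale (v 1) (basis_vec 1) + fun_scale (v n) (basis_vec n)" "bracket ?A w (basis_vec 1)"]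
          f(3)[of "fun_scale (v 1) (basis_vec 1)" "fun_scale (v n) (basis_vec n)"]
          f(4)[OF bv[of 1], of "v 1"] f(4)[OF bv[of n], of "v n"] f(5)[OF wc bv[of 1]] n
        by (simp add: g_def u_def)
      then show ?thesis using ends by blast
    qed
    have reach: "\<exists>a b. y 1 = a * A + b * u 1 \<and> y n = a * g n + b * c" if "y \<in> alg_carrier ?B" for y
    proof -
      obtain v where "v \<in> alg_carrier ?A" "y = f v" using f(2)[OF \<open>y \<in> alg_carrier ?B\<close>] by blast
      then obtain a b w where "y = fun_scale a g + fun_scale b u + w" "w 1 = 0" "w n = 0"
        using expand by blast
      then show ?thesis by (auto simp: fun_scale_apply A_def c_def)
    qed
    have "bracket ?A (bracket ?A (basis_vec n) (basis_vec n)) (basis_vec n) = 0"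
      by (rule shift_cube[OF n F parF k(1)])
    then have "bracket ?B (bracket ?B u u) u = 0"
      using f(5)[of "basis_vec n" "basis_vec n"] f(5)[of "bracket ?A (basis_vec n) (basis_vec n)" "basis_vec n"]
        f(6) bv[of n] n bracket_family_closed[of n F] F by (simp add: u_def)
    \<comment> \<open>Coordinate 3 of this cube is the cube of \<open>u 1\<close>, so the image of
      the last basis vector has no first coordinate.\<close>
    then have "bracket ?B (bracket ?B u u) u 3 = 0" by simp
    moreover have "bracket ?B u u 2 = u 1 * u 1"
      unfolding brB shift_bracket_def using n k' by simp
    then have "bracket ?B (bracket ?B u u) u 3 = u 1 * u 1 * u 1"
      unfolding brB[of "bracket ?B u u"] shift_bracket_def using n k' ends[of u u] by (cases "k' = 3") auto
    ultimately have u1: "u 1 = 0" by simp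
    have e: "basis_vec 1 1 = 1" "basis_vec n 1 = 0" "basis_vec n n = 1"
      using n by (auto simp: basis_vec_def)
    have "1 \<in> {1..n}" "n \<in> {1..n}" using n by auto
    note reach_1 = reach[OF basis_vec_carrier[OF this(1)]] and reach_n = reach[OF basis_vec_carrier[OF this(2)]]
    obtain a where "1 = a * A" using reach_1 u1 e by auto
    then have "A \<noteq> 0" by auto
    moreover obtain a b where "0 = a * A" "1 = a * g n + b * c"
      using reach_n u1 e by auto
    ultimately show ?thesis using u1 by auto
  qed
  then have A: "A \<noteq> 0" and c: "c \<noteq> 0" and u1: "u 1 = 0" by auto
  define Y where "Y i = f (basis_vec i)" for i
  have Yg: "Y 1 = g" by (simp add: Y_def g_def)
  have "bracket ?A (basis_vec n) (basis_vec 1) = 0"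
    by (rule ext, unfold brA shift_bracket_first[OF n]) (auto simp: basis_vec_def)
  then have ug: "bracket ?B u g = 0"
    using f(5)[OF bv[of n] bv[of 1]] f(6) n by (simp add: u_def g_def)
  \<comment> \<open>Coordinate \<open>j + 1\<close> of \<open>bracket ?B u g = 0\<close> is read
    off. It stays below \<open>n - 1\<close>, where \<open>\<nu>'\<close> would contribute, and its
    term with \<open>\<mu>'\<close> involves only earlier coordinates of \<open>u\<close>.\<close>
  have u0: "u j = 0" if "1 \<le> j" "j \<le> n - 3" for j
    using that
  proof (induction j rule: less_induct)
    case (less j)
    have "shift_bracket n k' \<mu>' \<nu>' u g (j + 1) = 0" using ug brB[of u g "j + 1"] by simp
    moreover have z: "(if k' \<le> j + 1 \<and> j + 1 \<le> n - 1 then \<mu>' * (u (j + 1 + 1 - k') * g n) else 0) = 0"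
      using less k' by auto
    moreover have "2 \<le> j + 1" "j + 1 \<le> n - 1" "j + 1 \<noteq> n - 1" using less.prems n by auto
    ultimately have "u j * A = 0" unfolding shift_bracket_def z by (simp add: A_def)
    then show ?case using A by simp
  qed
  have next_basis: "bracket ?A (basis_vec i) (basis_vec 1) = basis_vec (Suc i)" if "1 \<le> i" "i \<le> n - 2" for i
  proof
    fix m
    show "bracket ?A (basis_vec i) (basis_vec 1) m = basis_vec (Suc i) m"
      unfolding brA shift_bracket_first[OF n] using that by (auto simp: basis_vec_def)
  qed
  have Y: "(\<forall>m. 1 \<le> m \<and> m < i \<longrightarrow> Y i m = 0) \<and> Y i i = A ^ i" if "1 \<le> i" "i \<le> n - 1" for i
    using that
  proof (induction i rule: dec_induct)
    case base
    then show ?case using Yg by (auto simp: A_def)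
  next
    case (step i)
    have "bracket ?A (basis_vec i) (basis_vec 1) = basis_vec (Suc i)"
      using next_basis step by simp
    then have YS: "Y (Suc i) = bracket ?B (Y i) g"
      using f(5)[OF bv[of i] bv[of 1]] step n by (simp add: Y_def g_def)
    have rec: "Y (Suc i) m = (if m = 1 then 0 else Y i (m - 1) * A)" if "1 \<le> m" "m \<le> Suc i" for m
    proof (cases "m = 1")
      case True
      then show ?thesis using YS ends by simp
    next
      case False
      have "k' \<le> m \<Longrightarrow> 1 \<le> m + 1 - k' \<and> m + 1 - k' < i" using that k' by auto
      then have "k' \<le> m \<Longrightarrow> Y i (m + 1 - k') = 0" using step by simp
      moreover have "m = n - 1 \<Longrightarrow> Y i n = 0"
      proof -
        assume m: "m = n - 1"
        then have i: "2 \<le> i" using that n by simp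
        then have "bracket ?A (basis_vec (i - 1)) (basis_vec 1) = basis_vec i"
          using next_basis[of "i - 1"] step by simp
        then have "Y i = bracket ?B (Y (i - 1)) g"
          using f(5)[OF bv[of "i - 1"] bv[of 1]] step n i by (simp add: Y_def g_def)
        then show ?thesis using ends by simp
      qed
      moreover have "m \<le> n - 1" "2 \<le> m" using that step False by auto
      ultimately show ?thesis
        unfolding YS brB shift_bracket_def using False by (auto simp: A_def)
    qed
    show ?case
    proof (intro conjI allI impI)
      fix m assume m: "1 \<le> m \<and> m < Suc i"
      then have "m \<noteq> 1 \<Longrightarrow> 1 \<le> m - 1 \<and> m - 1 < i" by auto
      then show "Y (Suc i) m = 0" using rec[of m] m step by auto
    next
      show "Y (Suc i) (Suc i) = A ^ Suc i" using rec[of "Suc i"] step by simp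
    qed
  qed
  have "bracket ?A (basis_vec n) (basis_vec n) = fun_scale \<nu> (basis_vec (n - 1))"
    by (rule ext, unfold brA shift_bracket_last[OF n])
      (use n k in \<open>auto simp: basis_vec_def fun_scale_apply\<close>)
  then have "bracket ?B u u = fun_scale \<nu> (Y (n - 1))"
    using f(5)[OF bv[of n] bv[of n]] f(4)[OF bv[of "n - 1"], of \<nu>] n by (simp add: u_def Y_def)
  then have "bracket ?B u u (n - 1) = \<nu> * A ^ (n - 1)"
    using Y[of "n - 1"] n by (simp add: fun_scale_apply)
  \<comment> \<open>The mixed term contains \<open>u (n - k')\<close>, which vanishes because
    \<open>k' \<ge> 3\<close>.\<close>
  moreover have "bracket ?B u u (n - 1) = \<nu>' * (c * c)"
    unfolding brB shift_bracket_def using n k' u1 u0[of "n - k'"] by (simp add: c_def)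
  ultimately have sq: "c\<^sup>2 * \<nu>' = \<nu> * A ^ (n - 1)" by (simp add: power2_eq_square mult.commute)
  have "bracket ?A (basis_vec 1) (basis_vec n) = fun_scale \<mu> (basis_vec k)"
    by (rule ext, unfold brA shift_bracket_last[OF n])
      (use n k in \<open>auto simp: basis_vec_def fun_scale_apply\<close>)
  then have gu: "bracket ?B g u = fun_scale \<mu> (Y k)"
    using f(5)[OF bv[of 1] bv[of n]] f(4)[OF bv[of k], of \<mu>] n k by (simp add: u_def g_def Y_def)
  have gu_m: "(if k' \<le> m then \<mu>' * (g (m + 1 - k') * c) else 0) = \<mu> * Y k m" if "1 \<le> m" "m \<le> n - 2" for m
  proof -
    have "bracket ?B g u m = (if k' \<le> m then \<mu>' * (g (m + 1 - k') * c) else 0)"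
      unfolding brB shift_bracket_def using that n u1 by (auto simp: c_def)
    then show ?thesis using gu by (simp add: fun_scale_apply)
  qed
  show thesis
  proof (rule that[OF A c sq])
    assume 1: "k' \<le> n - 2" "k' < k \<or> \<mu> = 0"
    have "\<mu> * Y k k' = 0" using 1 Y[of k] k k' by auto
    then have "\<mu>' * (A * c) = 0" using gu_m[of k'] 1 k' by (simp add: A_def)
    then show "\<mu>' = 0" using A c by simp
  next
    assume 1: "k \<le> n - 2" "k < k' \<or> \<mu>' = 0"
    then have "(if k' \<le> k then \<mu>' * (g (k + 1 - k') * c) else 0) = 0" by auto
    then have "\<mu> * Y k k = 0" using gu_m[of k] 1 k by simp
    then show "\<mu> = 0" using Y[of k] k A by simp
  next
    assume 1: "k = k'" "k \<le> n - 2"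
    then show "\<mu>' * c * A = \<mu> * A ^ k" using gu_m[of k] Y[of k] k by (simp add: A_def mult_ac)
  qed
qed

text \<open>Vanishing of \<open>\<nu>\<close> singles out \<open>M1\<close>, where \<open>k\<close>
  is the first coordinate reached by \<open>[y_1, y_n]\<close>. For \<open>M2\<close> the relation
  \<open>c * A = A ^ k\<close> gives \<open>c = A ^ (k - 1)\<close>, and
  \<open>2 * (k - 1) = n - 1\<close> turns \<open>c\<^sup>2 * \<nu>' = \<nu> * A ^ (n - 1)\<close>
  into equality of the parameters.\<close>

lemma isomorphic_shift_eq:
  assumes n: "n \<ge> 4" and F: "F \<in> listed n" "F \<notin> {NGF2, NGF3, M4}"
    and G: "G \<in> listed n" "G \<notin> {NGF2, NGF3, M4}"
    and iso: "alg_isomorphic (family_alg n F) (family_alg n G)"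
  shows "F = G"
proof -
  define h where "h = (n + 1) div 2"
  have h: "3 \<le> h" "h \<le> n - 2" "2 * h = n + 1" if "odd n"
  proof -
    have "n \<ge> 5" using n that by (cases "n = 4") auto
    then show "3 \<le> h" "h \<le> n - 2" unfolding h_def by linarith+
    show "2 * h = n + 1" unfolding h_def using that by simp
  qed
  obtain k \<mu> \<nu> where parF: "shift_parameters n F = (k, \<mu>, \<nu>)" by (metis prod_cases3)
  obtain k' \<mu>' \<nu>' where parG: "shift_parameters n G = (k', \<mu>', \<nu>')" by (metis prod_cases3)
  have F': "(\<exists>j. F = M1 j \<and> k = j \<and> \<mu> = 1 \<and> \<nu> = 0 \<and> 3 \<le> j \<and> j \<le> n - 1)
    \<or> (\<exists>\<alpha>. F = M2 \<alpha> \<and> odd n \<and> k = h \<and> \<mu> = 1 \<and> \<nu> = \<alpha> \<and> \<alpha> \<noteq> 0)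
    \<or> (F = M3 \<and> odd n \<and> k = h \<and> \<mu> = 0 \<and> \<nu> = 1)"
    using F parF by (cases F) (auto simp: listed_def h_def split: if_splits)
  have G': "(\<exists>j. G = M1 j \<and> k' = j \<and> \<mu>' = 1 \<and> \<nu>' = 0 \<and> 3 \<le> j \<and> j \<le> n - 1)
    \<or> (\<exists>\<alpha>. G = M2 \<alpha> \<and> odd n \<and> k' = h \<and> \<mu>' = 1 \<and> \<nu>' = \<alpha> \<and> \<alpha> \<noteq> 0)
    \<or> (G = M3 \<and> odd n \<and> k' = h \<and> \<mu>' = 0 \<and> \<nu>' = 1)"
    using G parG by (cases G) (auto simp: listed_def h_def split: if_splits)
  have k: "3 \<le> k" "k \<le> n - 1" "3 \<le> k'" "k' \<le> n - 1" using F' G' h by auto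
  obtain A c where Ac: "A \<noteq> 0" "c \<noteq> 0" "c\<^sup>2 * \<nu>' = \<nu> * A ^ (n - 1)"
    "k' \<le> n - 2 \<Longrightarrow> k' < k \<or> \<mu> = 0 \<Longrightarrow> \<mu>' = 0"
    "k \<le> n - 2 \<Longrightarrow> k < k' \<or> \<mu>' = 0 \<Longrightarrow> \<mu> = 0"
    "k = k' \<Longrightarrow> k \<le> n - 2 \<Longrightarrow> \<mu>' * c * A = \<mu> * A ^ k"
    by (rule isomorphic_shift[OF n F parF k(1,2) G parG k(3,4) iso]) blast
  have nu: "\<nu>' = 0 \<longleftrightarrow> \<nu> = 0"
  proof
    assume "\<nu>' = 0"
    then show "\<nu> = 0" using Ac(1,3) by simp
  next
    assume "\<nu> = 0"
    then show "\<nu>' = 0" using Ac(2,3) by simp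
  qed
  show ?thesis
  proof (cases "\<nu> = 0")
    case True
    then have FG: "F = M1 k" "G = M1 k'" "\<mu> = 1" "\<mu>' = 1" using F' G' nu by auto
    have "k' < k \<Longrightarrow> k' \<le> n - 2" "k < k' \<Longrightarrow> k \<le> n - 2" using k n by linarith+
    then have "\<not> k' < k" "\<not> k < k'" using Ac(4,5) FG(3,4) by auto
    then show ?thesis using FG by simp
  next
    case False
    then have o: "odd n" "k = h" "k' = h" using F' G' nu by auto
    have kn: "k \<le> n - 2" using h o by simp
    have mu: "\<mu>' = 0 \<longleftrightarrow> \<mu> = 0" using Ac(4,5) kn o by auto
    show ?thesis
    proof (cases "\<mu> = 0")
      case True
      then show ?thesis using F' G' mu False nu by auto
    next
      case \<mu>: False
      then have FG: "F = M2 \<nu>" "G = M2 \<nu>'" "\<mu> = 1" "\<mu>' = 1" using F' G' mu False nu by auto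
      have "c * A = A ^ k" using Ac(6) FG o kn by simp
      also have "\<dots> = A ^ (k - 1) * A" using k by (metis power_minus_mult zero_less_iff_neq_zero not_numeral_le_zero)
      finally have "c = A ^ (k - 1)" using Ac(1) by simp
      then have "c\<^sup>2 = A ^ ((k - 1) * 2)" by (simp add: power_mult)
      also have "(k - 1) * 2 = n - 1" using h(3) o by simp
      finally have "\<nu>' = \<nu>" using Ac(1,3) by simp
      then show ?thesis using FG by simp
    qed
  qed
qed

text \<open>The bound on \<open>n\<close> is sharp: for \<open>n = 3\<close> the algebra
  \<open>M2 (1/4)\<close> is isomorphic to \<open>M4\<close>, through the basis
  \<open>y_1, y_1 - 2 y_3, y_2\<close>.\<close>

lemma pairwise_not_isomorphic:
  assumes n: "n \<ge> 4" and F: "F \<in> listed n" and G: "G \<in> listed n"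
    and iso: "alg_isomorphic (family_alg n F) (family_alg n G)"
  shows "F = G"
proof -
  have n3: "n \<ge> 3" using n by simp
  note iso' = family_alg_isomorphic_sym[OF n3 F iso]
  note tr = invariants_transfer[OF n3 F iso] invariants_transfer[OF n3 G iso']
  have sq: "square_free n H \<longleftrightarrow> H = NGF3" if "H \<in> listed n" for H
    using square_free_NGF3[of n] not_square_free[OF n, of H] that by (auto simp: listed_def split: if_splits)
  have rn: "right_null n H \<longleftrightarrow> H \<noteq> M4" if "H \<in> listed n" "H \<noteq> NGF3" for H
    using right_null_listed[OF n that] not_right_null_M4[OF n] by auto
  have cn: "cube_null n H \<longleftrightarrow> H \<noteq> NGF2" if H: "H \<in> listed n" "H \<noteq> NGF3" "H \<noteq> M4" for H
  proof (cases "H = NGF2")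
    case True
    then show ?thesis using not_cube_null_NGF2[OF n] by simp
  next
    case False
    obtain k \<mu> \<nu> where par: "shift_parameters n H = (k, \<mu>, \<nu>)" by (metis prod_cases3)
    have k: "3 \<le> k \<and> k \<le> n - 1 \<and> (\<mu> \<noteq> 0 \<or> \<nu> \<noteq> 0)"
    proof -
      have "3 \<le> (n + 1) div 2 \<and> (n + 1) div 2 \<le> n - 1" if "odd n"
      proof -
        have "n \<ge> 5" using n that by (cases "n = 4") auto
        then show ?thesis by linarith
      qed
      then show ?thesis using H False par by (cases H) (auto simp: listed_def split: if_splits)
    qed
    have br: "bracket (family_alg n H) x y m = shift_bracket n k \<mu> \<nu> x y m" for x y m
      by (rule bracket_shift[OF n H(1) _ par]) (use H False k in auto)
    have c: "basis_vec i \<in> alg_carrier (family_alg n H)" if "i = 1 \<or> i = n" for i using that n by auto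
    have "bracket (family_alg n H) (bracket (family_alg n H) (basis_vec n) (basis_vec n)) (basis_vec n) = 0"
      by (rule shift_cube[OF n H(1) _ par]) (use H False k in auto)
    moreover have "bracket (family_alg n H) (basis_vec 1) (basis_vec n) k = \<mu>"
      unfolding br shift_bracket_def using n k by (auto simp: basis_vec_def)
    moreover have "bracket (family_alg n H) (basis_vec n) (basis_vec n) (n - 1) = \<nu>"
      unfolding br shift_bracket_def using n k by (auto simp: basis_vec_def)
    ultimately have "cube_null n H"
      unfolding cube_null_def using k c by (metis zero_fun_apply)
    then show ?thesis using False by simp
  qed
  show ?thesis
  proof (cases "F = NGF3 \<or> G = NGF3")
    case True
    then show ?thesis using tr(1,4) sq F G by auto
  next
    case 1: False
    show ?thesis
    proof (cases "F = M4 \<or> G = M4")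
      case True
      then show ?thesis using tr(2,5) rn F G 1 by auto
    next
      case 2: False
      show ?thesis
      proof (cases "F = NGF2 \<or> G = NGF2")
        case True
        then show ?thesis using tr(3,6) cn F G 1 2 by auto
      next
        case False
        then show ?thesis using isomorphic_shift_eq[OF n F _ G _ iso] 1 2 by simp
      qed
    qed
  qed
qed

theorem theorem3p6:
  fixes n :: nat
  shows "(\<forall>L :: (complex, 'a::ab_group_add) alg.
            filiform L n \<and> alg_length L = int n - 1 \<longrightarrow>
            (\<exists>F\<in>listed n. alg_isomorphic L (family_alg n F))) \<and>
         (n \<ge> 4 \<longrightarrow>
            (\<forall>F\<in>listed n. \<forall>G\<in>listed n. F \<noteq> G \<longrightarrow>
               \<not> alg_isomorphic (family_alg n F) (family_alg n G)))"
  using classification pairwise_not_isomorphic by blast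

end
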